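(* Let $0<p\le q\le 1$, let $g$ be analytic in $\mathbb D$, and let $\mu_{g,q}$ be the Borel measure on $\mathbb D$ given by $d\mu_{g,q}(z)=|g'(z)|^q(1-|z|^2)^{q-1}\,dA(z)$. (a) If $g\in H^\infty\cap\mathcal B_{\log}$ and $\mu_{g,q}$ is a Carleson measure, then $g\in\mathcal M(\mathcal D^p_{p-1}\cap\mathcal B,\ \mathcal D^q_{q-1}\cap\mathcal B)$. (b) If $g$ is given by a lacunary power series, then $g\in\mathcal M(\mathcal D^p_{p-1}\cap\mathcal B,\ \mathcal D^q_{q-1}\cap\mathcal B)$ if and only if $g\in H^\infty\cap\mathcal B_{\log}$ and $\mu_{g,q}$ is a Carleson measure.
   Context: $\mathbb D$ is the open unit disc, $dA=\frac1\pi dx\,dy$. For $0<p<\infty$, $\mathcal D^p_{p-1}$ is the space of analytic $f$ with $\int_{\mathbb D}(1-|z|)^{p-1}|f'(z)|^p\,dA(z)<\infty$. $\mathcal B$ is the Bloch space of analytic $f$ with $\sup_z(1-|z|^2)|f'(z)|<\infty$; $\mathcal B_{\log}$ is the space of analytic $g$ with $\sup_z(1-|z|^2)|g'(z)|\log\frac{e}{1-|z|^2}<\infty$. $H^\infty$ is the space of bounded analytic functions. For an arc $I\subset\partial\mathbb D$ of length $|I|$, the Carleson box is $S(I)=\{re^{it}: e^{it}\in I,\ 1-\frac{|I|}{2\pi}\le r<1\}$; a positive Borel measure $\mu$ on $\mathbb D$ is a Carleson measure if $\mu(S(I))\le C|I|$ for all arcs $I$. A lacunary power series is $\sum_k a_k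 z^{n_k}$ with $n_{k+1}\ge\lambda n_k$ for all $k$ and some $\lambda>1$. $\mathcal M(X,Y)=\{g: fg\in Y\ \forall f\in X\}$. *)

theory Defs
  imports "HOL-Analysis.Analysis"
begin

abbreviation unit_disc :: "complex set" where
  "unit_disc \<equiv> ball 0 1"

text \<open>Normalised area measure dA = (1/pi) dx dy, restricted to the disc, applied
  to a nonnegative weight w: the integral of w over the disc.\<close>
definition disc_integral :: "(complex \<Rightarrow> real) \<Rightarrow> ennreal" where
  "disc_integral w = (\<integral>\<^sup>+ z. ennreal (indicator unit_disc z * w z / pi) \<partial>lborel)"

definition Dp_space :: "real \<Rightarrow> (complex \<Rightarrow> complex) set" where
  "Dp_space p = {f. f analytic_on unit_disc \<and>
     disc_integral (\<lambda>z. (1 - norm z) powr (p - 1) * norm (deriv f z) powr p) < \<infinity>}"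

definition Bloch :: "(complex \<Rightarrow> complex) set" where
  "Bloch = {f. f analytic_on unit_disc \<and>
     (\<exists>C. \<forall>z\<in>unit_disc. (1 - (norm z)\<^sup>2) * norm (deriv f z) \<le> C)}"

definition Bloch_log :: "(complex \<Rightarrow> complex) set" where
  "Bloch_log = {g. g analytic_on unit_disc \<and>
     (\<exists>C. \<forall>z\<in>unit_disc.
        (1 - (norm z)\<^sup>2) * norm (deriv g z) * ln (exp 1 / (1 - (norm z)\<^sup>2)) \<le> C)}"

definition H_inf :: "(complex \<Rightarrow> complex) set" where
  "H_inf = {g. g analytic_on unit_disc \<and> bounded (g ` unit_disc)}"

text \<open>Carleson box S(I) of the closed arc I = {e^{it} : |t - theta| \<le> l/2} of length l
  (0 < l \<le> 2 pi).\<close>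
definition carleson_box :: "real \<Rightarrow> real \<Rightarrow> complex set" where
  "carleson_box \<theta> l = {z. \<exists>r t. z = complex_of_real r * cis t \<and> \<bar>t - \<theta>\<bar> \<le> l / 2 \<and>
       1 - l / (2 * pi) \<le> r \<and> r < 1}"

definition carleson_measure :: "complex measure \<Rightarrow> bool" where
  "carleson_measure \<mu> \<longleftrightarrow>
     (\<exists>C. \<forall>\<theta> l. 0 < l \<and> l \<le> 2 * pi \<longrightarrow> emeasure \<mu> (carleson_box \<theta> l) \<le> ennreal (C * l))"

definition mu_gq :: "(complex \<Rightarrow> complex) \<Rightarrow> real \<Rightarrow> complex measure" where
  "mu_gq g q = density lborel (\<lambda>z. ennreal (indicator unit_disc z *
       norm (deriv g z) powr q * (1 - (norm z)\<^sup>2) powr (q - 1) / pi))"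

definition multipliers :: "(complex \<Rightarrow> complex) set \<Rightarrow> (complex \<Rightarrow> complex) set \<Rightarrow> (complex \<Rightarrow> complex) set" where
  "multipliers X Y = {g. \<forall>f\<in>X. (\<lambda>z. f z * g z) \<in> Y}"

definition lacunary_series :: "(complex \<Rightarrow> complex) \<Rightarrow> bool" where
  "lacunary_series g \<longleftrightarrow>
     (\<exists>(a :: nat \<Rightarrow> complex) (n :: nat \<Rightarrow> nat) (lam::real).
        lam > 1 \<and> strict_mono n \<and> (\<forall>k. lam * real (n k) \<le> real (n (Suc k))) \<and>
        (\<forall>z\<in>unit_disc. (\<lambda>k. a k * z ^ n k) sums g z))"

end

theory Submission
  imports Defs "HOL-Complex_Analysis.Complex_Analysis"
begin

text \<open>
  Part (a) rests on a Carleson embedding: for \<open>q \<le> 1\<close> a Carleson measure \<open>\<mu>\<close> satisfies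
  \<open>\<integral>|f|\<^sup>q d\<mu> < \<infinity>\<close> for all \<open>f\<close> in the space \<open>D\<^sup>q\<close>, so that both terms of \<open>(fg)' = f'g + fg'\<close>
  have finite weighted \<open>q\<close>-norm; the Bloch condition on \<open>fg\<close> follows from the logarithmic growth of
  Bloch functions.

  For a lacunary \<open>g = \<Sum>\<^sub>k a\<^sub>k z\<^bsup>n\<^sub>k\<^esup>\<close>, testing a multiplier on \<open>1\<close> gives \<open>g \<in> D\<^sup>q\<close>, and the comparison of
  \<open>L\<^sup>q\<close>-means with coefficients on the circles \<open>|z| \<approx> 1 - 1/n\<^sub>k\<close> gives \<open>\<Sum>|a\<^sub>k|\<^sup>q < \<infinity>\<close>. Hence \<open>g\<close> is
  bounded, and \<open>|g'|\<^sup>q\<close> has a radial majorant of finite integral, which makes the measure Carleson.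
  Testing on \<open>log (1/(1 - z))\<close> shows that \<open>(1 - |z|)|g'(z)| log (1/(1 - |z|))\<close> is bounded near \<open>1\<close>;
  Fejer's kernel transfers this to \<open>|a\<^sub>k| log n\<^sub>k = O(1)\<close>, which is the logarithmic Bloch condition.
\<close>

section \<open>Rotations of the plane\<close>

text \<open>Area integrals become circle integrals by averaging over rotations instead of by polar
  coordinates: the plane integral of a function equals that of its rotational means, and a radial
  weight passes out of the inner mean. The bound q <= 1 enters through (x + y)^q <= x^q + y^q,
  applied to increments along a radius, to the two terms of (fg)' and to the terms of a series.

  The obstacle in the converse is that log (1/(1 - z)) is large only near z = 1, so it controls g'
  on short arcs only. With m = n_k, the arc |t| <= m^(-1/4) of the circle |z| = 1 - 1/m is a
  compromise. It is short enough for the logarithm to be at least (ln m)/8 on it, so that |g'| = O(m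
  / ln m) there; it is long enough for a Fejer kernel of order comparable to m, the size of the
  spectral gap, to be O(m^(-1/2)) off it. The Bloch bound |g'| = O(m) then makes the rest of the
  circle contribute O(m^(1/2)), which m / ln m absorbs. Since the k-th term of g' has size about m
  |a_k| on this circle, |a_k| ln m stays bounded.\<close>

lemma measurable_Complex [measurable]:
  assumes [measurable]: "f \<in> borel_measurable M" "g \<in> borel_measurable M"
  shows "(\<lambda>x. Complex (f x) (g x)) \<in> borel_measurable M"
  unfolding Complex_eq by measurable

lemma measurable_cis [measurable]:
  assumes [measurable]: "f \<in> borel_measurable M"
  shows "(\<lambda>x. cis (f x)) \<in> borel_measurable M"
  unfolding cis_conv_exp by measurable

lemma measurable_Complex_prod [measurable]:
  "(\<lambda>(x, y). Complex x y) \<in> borel_measurable borel"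
  unfolding borel_prod[symmetric] by measurable

text \<open>Lebesgue measure is determined by its values on boxes, and a box in the complex plane
  corresponds to a product of two intervals. The identification makes Tonelli's theorem available in
  real and imaginary parts.\<close>

lemma lborel_complex_prod:
  "distr (lborel :: (real \<times> real) measure) borel (\<lambda>(x, y). Complex x y) = lborel"
proof (rule lborel_eqI[symmetric])
  fix l u :: complex
  have "(\<lambda>(x, y). Complex x y) -` box l u \<inter> space (lborel :: (real \<times> real) measure)
      = box (Re l) (Re u) \<times> box (Im l) (Im u)"
    by (auto simp: box_def Basis_complex_def inner_complex_def)
  then have "emeasure (distr (lborel :: (real \<times> real) measure) borel (\<lambda>(x, y). Complex x y)) (box l u)
     = emeasure (lborel :: (real \<times> real) measure) (box (Re l) (Re u) \<times> box (Im l) (Im u))"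
    by (subst emeasure_distr) (use measurable_Complex_prod in auto)
  also assume le: "\<And>b. b \<in> Basis \<Longrightarrow> l \<bullet> b \<le> u \<bullet> b"
  have le': "Re l \<le> Re u" "Im l \<le> Im u"
    using le[of 1] le[of \<i>] by (auto simp: Basis_complex_def inner_complex_def)
  have "emeasure (lborel :: (real \<times> real) measure) (box (Re l) (Re u) \<times> box (Im l) (Im u)) =
     emeasure lborel (box (Re l) (Re u)) * emeasure lborel (box (Im l) (Im u))"
    by (subst lborel_prod[symmetric], subst lborel.emeasure_pair_measure_Times) auto
  also have "\<dots> = (\<Prod>b\<in>Basis. (u - l) \<bullet> b)"
    using le' by (simp add: Basis_complex_def inner_complex_def ennreal_mult)
  finally show "emeasure (distr (lborel :: (real \<times> real) measure) borel (\<lambda>(x, y). Complex x y)) (box l u)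
     = (\<Prod>b\<in>Basis. (u - l) \<bullet> b)" .
qed simp

lemma nn_integral_complex:
  fixes f :: "complex \<Rightarrow> ennreal"
  assumes [measurable]: "f \<in> borel_measurable borel"
  shows "(\<integral>\<^sup>+ z. f z \<partial>lborel) = (\<integral>\<^sup>+ x. \<integral>\<^sup>+ y. f (Complex x y) \<partial>lborel \<partial>lborel)"
    and "(\<integral>\<^sup>+ z. f z \<partial>lborel) = (\<integral>\<^sup>+ y. \<integral>\<^sup>+ x. f (Complex x y) \<partial>lborel \<partial>lborel)"
proof -
  have m: "(\<lambda>(x, y). f (Complex x y)) \<in> borel_measurable (lborel \<Otimes>\<^sub>M lborel)"
    by measurable
  have "(\<integral>\<^sup>+ z. f z \<partial>lborel) = (\<integral>\<^sup>+ (x, y). f (Complex x y) \<partial>(lborel \<Otimes>\<^sub>M lborel))"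
    by (subst lborel_complex_prod[symmetric], subst nn_integral_distr)
       (use measurable_Complex_prod in \<open>auto simp: lborel_prod split_def\<close>)
  also have "\<dots> = (\<integral>\<^sup>+ x. \<integral>\<^sup>+ y. f (Complex x y) \<partial>lborel \<partial>lborel)"
    by (subst lborel.nn_integral_fst[symmetric]) (use m in auto)
  finally show 1: "(\<integral>\<^sup>+ z. f z \<partial>lborel) = (\<integral>\<^sup>+ x. \<integral>\<^sup>+ y. f (Complex x y) \<partial>lborel \<partial>lborel)" .
  show "(\<integral>\<^sup>+ z. f z \<partial>lborel) = (\<integral>\<^sup>+ y. \<integral>\<^sup>+ x. f (Complex x y) \<partial>lborel \<partial>lborel)"
    unfolding 1 by (rule lborel_pair.Fubini'[OF m, symmetric])
qed

lemma nn_integral_lborel_translate: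
  fixes f :: "'a::euclidean_space \<Rightarrow> ennreal"
  assumes [measurable]: "f \<in> borel_measurable borel"
  shows "(\<integral>\<^sup>+ x. f (a + x) \<partial>lborel) = (\<integral>\<^sup>+ x. f x \<partial>lborel)"
proof -
  have "(\<integral>\<^sup>+ x. f x \<partial>lborel) = (\<integral>\<^sup>+ x. f x \<partial>distr lborel borel ((+) a))"
    by (simp add: lborel_distr_plus)
  then show ?thesis by (simp add: nn_integral_distr)
qed

text \<open>A rotation by an angle that is not a multiple of \<open>\<pi>\<close> is a product of three shears,
  and shears preserve area by Tonelli's theorem.\<close>
lemma nn_integral_rotate:
  fixes f :: "complex \<Rightarrow> ennreal"
  assumes f [measurable]: "f \<in> borel_measurable borel" and c: "norm c = 1"
  shows "(\<integral>\<^sup>+ z. f (c * z) \<partial>lborel) = (\<integral>\<^sup>+ z. f z \<partial>lborel)"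
proof -
  have H: "(\<integral>\<^sup>+ z. h (z + of_real (a * Im z)) \<partial>lborel) = (\<integral>\<^sup>+ z. h z \<partial>lborel)"
    if [measurable]: "h \<in> borel_measurable borel" for a and h :: "complex \<Rightarrow> ennreal"
  proof -
    have "(\<integral>\<^sup>+ z. h (z + of_real (a * Im z)) \<partial>lborel)
        = (\<integral>\<^sup>+ y. \<integral>\<^sup>+ x. h (Complex (a * y + x) y) \<partial>lborel \<partial>lborel)"
      by (subst nn_integral_complex(2)) (auto simp: Complex_eq algebra_simps)
    also have "\<dots> = (\<integral>\<^sup>+ y. \<integral>\<^sup>+ x. h (Complex x y) \<partial>lborel \<partial>lborel)"
      by (subst nn_integral_lborel_translate) auto
    also have "\<dots> = (\<integral>\<^sup>+ z. h z \<partial>lborel)" by (simp add: nn_integral_complex(2))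
    finally show ?thesis .
  qed
  have V: "(\<integral>\<^sup>+ z. h (z + \<i> * of_real (a * Re z)) \<partial>lborel) = (\<integral>\<^sup>+ z. h z \<partial>lborel)"
    if [measurable]: "h \<in> borel_measurable borel" for a and h :: "complex \<Rightarrow> ennreal"
  proof -
    have "(\<integral>\<^sup>+ z. h (z + \<i> * of_real (a * Re z)) \<partial>lborel)
        = (\<integral>\<^sup>+ x. \<integral>\<^sup>+ y. h (Complex x (a * x + y)) \<partial>lborel \<partial>lborel)"
      by (subst nn_integral_complex(1)) (auto simp: Complex_eq algebra_simps)
    also have "\<dots> = (\<integral>\<^sup>+ x. \<integral>\<^sup>+ y. h (Complex x y) \<partial>lborel \<partial>lborel)"
      by (subst nn_integral_lborel_translate) auto
    also have "\<dots> = (\<integral>\<^sup>+ z. h z \<partial>lborel)" by (simp add: nn_integral_complex(1))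
    finally show ?thesis .
  qed
  have main: "(\<integral>\<^sup>+ z. h (c * z) \<partial>lborel) = (\<integral>\<^sup>+ z. h z \<partial>lborel)"
    if [measurable]: "h \<in> borel_measurable borel" and c: "norm c = 1" "Im c \<noteq> 0"
    for c and h :: "complex \<Rightarrow> ennreal"
  proof -
    \<comment> \<open>For c = e^(i phi) these are a = -tan(phi/2) and b = sin phi, the classical
      factorisation of a rotation into a horizontal, a vertical and again the same horizontal
      shear.\<close>
    define a where "a = (Re c - 1) / Im c"
    define b where "b = Im c"
    have nc: "(Re c)\<^sup>2 + (Im c)\<^sup>2 = 1" using c(1) by (simp add: cmod_def)
    have 1: "1 + a * b = Re c" using c(2) by (simp add: a_def b_def)
    have 2: "2 * a + a * a * b = - Im c"
    proof -
      have "2 * a + a * a * b = a * (1 + (1 + a * b))" by algebra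
      also have "\<dots> = ((Re c)\<^sup>2 - 1) / Im c"
        unfolding 1 by (simp add: a_def power2_eq_square algebra_simps)
      also have "\<dots> = - Im c" using nc c(2) by (simp add: field_simps power2_eq_square)
      finally show ?thesis .
    qed
    define s where "s = (\<lambda>z::complex. z + of_real (a * Im z))"
    define v where "v = (\<lambda>z::complex. z + \<i> * of_real (b * Re z))"
    have [measurable]: "s \<in> borel_measurable borel" "v \<in> borel_measurable borel"
      unfolding s_def v_def by measurable
    have eq: "c * z = s (v (s z))" for z
    proof (rule complex_eqI)
      have "Re (s (v (s z))) = (1 + a * b) * Re z + (2 * a + a * a * b) * Im z"
        by (simp add: s_def v_def algebra_simps)
      then show "Re (c * z) = Re (s (v (s z)))" by (simp add: 1 2)
      have "Im (s (v (s z))) = b * Re z + (1 + a * b) * Im z"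
        by (simp add: s_def v_def algebra_simps)
      then show "Im (c * z) = Im (s (v (s z)))" unfolding 1 by (simp add: b_def)
    qed
    have "(\<integral>\<^sup>+ z. h (c * z) \<partial>lborel) = (\<integral>\<^sup>+ z. h (s (v (s z))) \<partial>lborel)" by (simp add: eq)
    also have "\<dots> = (\<integral>\<^sup>+ z. h (s (v z)) \<partial>lborel)"
      using H[of "\<lambda>z. h (s (v z))" a] by (simp add: s_def)
    also have "\<dots> = (\<integral>\<^sup>+ z. h (s z) \<partial>lborel)"
      using V[of "\<lambda>z. h (s z)" b] by (simp add: v_def)
    also have "\<dots> = (\<integral>\<^sup>+ z. h z \<partial>lborel)" using H[of h a] by (simp add: s_def)
    finally show ?thesis .
  qed
  show ?thesis
  proof (cases "Im c = 0")
    case False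
    then show ?thesis using main c by simp
  next
    case True
    then have "c = 1 \<or> c = -1" using c by (auto simp: cmod_def complex_eq_iff power2_eq_1_iff)
    then show ?thesis
    proof
      \<comment> \<open>The half turn is the quarter turn applied twice, and \<open>\<i>\<close> has
        nonzero imaginary part.\<close>
      assume c: "c = -1"
      have "(\<integral>\<^sup>+ z. f (\<i> * (\<i> * z)) \<partial>lborel) = (\<integral>\<^sup>+ z. f z \<partial>lborel)"
        using main[of "\<lambda>z. f (\<i> * z)" \<i>] main[of f \<i>] by simp
      then show ?thesis by (simp add: c mult.assoc[symmetric])
    qed simp
  qed
qed

text \<open>Arc length on the circle normalised to mass 1 and carried by the angle, so that
  integrals against it are circle means and integrands are functions of t entering through
  \<open>cis t\<close>.\<close>

definition circ :: "real measure" where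
  "circ = density lborel (\<lambda>t. ennreal (indicator {-pi..pi} t / (2 * pi)))"

lemma sets_circ [simp, measurable_cong]: "sets circ = sets borel"
  and space_circ [simp]: "space circ = UNIV"
  by (auto simp: circ_def)

lemma nn_integral_circ:
  "f \<in> borel_measurable borel \<Longrightarrow>
    (\<integral>\<^sup>+ t. f t \<partial>circ) = (\<integral>\<^sup>+ t. ennreal (indicator {-pi..pi} t / (2 * pi)) * f t \<partial>lborel)"
  unfolding circ_def by (subst nn_integral_density) auto

lemma emeasure_circ_UNIV [simp]: "emeasure circ UNIV = 1"
proof -
  have "emeasure circ (space circ) = (\<integral>\<^sup>+ t. ennreal (1 / (2 * pi)) * indicator {-pi..pi} t \<partial>lborel)"
    unfolding circ_def by (auto simp: emeasure_density intro!: nn_integral_cong split: split_indicator)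
  also have "\<dots> = ennreal (1 / (2 * pi)) * ennreal (2 * pi)"
    by (subst nn_integral_cmult_indicator) auto
  also have "\<dots> = 1" by (subst ennreal_mult[symmetric]) auto
  finally show ?thesis by simp
qed

interpretation circ: finite_measure circ
  by (rule finite_measureI) simp

text \<open>Each rotated copy of f has the same integral, and Tonelli's theorem moves the mean over
  the angles inside. This takes the place of polar coordinates throughout.\<close>

lemma nn_integral_rotation_average:
  fixes f :: "complex \<Rightarrow> ennreal"
  assumes f [measurable]: "f \<in> borel_measurable borel"
  shows "(\<integral>\<^sup>+ z. f z \<partial>lborel) = (\<integral>\<^sup>+ z. \<integral>\<^sup>+ t. f (cis t * z) \<partial>circ \<partial>lborel)"
proof -
  interpret pair_sigma_finite circ "lborel :: complex measure" ..
  have "(\<integral>\<^sup>+ z. \<integral>\<^sup>+ t. f (cis t * z) \<partial>circ \<partial>lborel) = (\<integral>\<^sup>+ t. \<integral>\<^sup>+ z. f (cis t * z) \<partial>lborel \<partial>circ)"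
    by (rule Fubini'[where f="\<lambda>t z. f (cis t * z)"]) measurable
  also have "\<dots> = (\<integral>\<^sup>+ t. \<integral>\<^sup>+ z. f z \<partial>lborel \<partial>circ)"
    by (subst nn_integral_rotate) auto
  also have "\<dots> = (\<integral>\<^sup>+ z. f z \<partial>lborel)" by simp
  finally show ?thesis by simp
qed

section \<open>Circle averages and radial integrals\<close>

lemma integral_circ:
  fixes f :: "real \<Rightarrow> 'a::{banach, second_countable_topology}"
  assumes [measurable]: "f \<in> borel_measurable borel"
  shows "(LINT t|circ. f t) = (LINT t|lborel. (indicator {-pi..pi} t / (2 * pi)) *\<^sub>R f t)"
  unfolding circ_def by (subst integral_density) auto

lemma integral_circ_cis:
  "(LINT t|circ. cis (of_int k * t)) = (if k = 0 then 1 else 0)"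
proof (cases "k = 0")
  case True
  then show ?thesis by (simp add: measure_def)
next
  case False
  define F where "F = (\<lambda>t::real. cis (of_int k * t) / (\<i> * of_int k))"
  have D: "(F has_vector_derivative cis (of_int k * t)) (at t within S)" for t S
  proof -
    have "((\<lambda>z. exp (\<i> * of_int k * z) / (\<i> * of_int k)) has_field_derivative
        exp (\<i> * of_int k * of_real t)) (at (of_real t))"
      using False by (auto intro!: derivative_eq_intros)
    from has_vector_derivative_real_field[OF this, of S] show ?thesis
      by (simp add: F_def cis_conv_exp mult_ac)
  qed
  have "(LINT t|lborel. indicator {-pi..pi} t *\<^sub>R cis (of_int k * t)) = F pi - F (-pi)"
    by (rule integral_FTC_Icc) (auto intro!: D continuous_intros)
  also have "\<dots> = 0"
  proof -
    have "cis (of_int k * pi) = cis (of_int k * - pi)"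
      by (auto simp: complex_eq_iff sin_zero_iff_int2)
    then show ?thesis by (simp add: F_def)
  qed
  finally have 0: "(LINT t|lborel. indicator {-pi..pi} t *\<^sub>R cis (of_int k * t)) = 0" .
  have "(LINT t|circ. cis (of_int k * t))
      = (LINT t|lborel. (1 / (2 * pi)) *\<^sub>R (indicator {-pi..pi} t *\<^sub>R cis (of_int k * t)))"
    by (subst integral_circ) auto
  also have "\<dots> = 0" by (subst integral_scaleR_right) (simp add: 0)
  finally show ?thesis using False by simp
qed

lemma integrable_circ_bounded:
  fixes f :: "real \<Rightarrow> 'a::{banach, second_countable_topology}"
  assumes "f \<in> borel_measurable borel" "\<And>t. norm (f t) \<le> B"
  shows "integrable circ f"
  by (rule circ.integrable_const_bound[of _ B]) (use assms in auto)

text \<open>Absolute convergence permits integration term by term, and only frequency 0 survives.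
  The frequencies are an arbitrary sequence of integers, so the lemma also reads off Fourier
  coefficients after a shift of the spectrum.\<close>

lemma circ_integral_series:
  fixes b :: "nat \<Rightarrow> complex" and m :: "nat \<Rightarrow> int"
  assumes b: "summable (\<lambda>k. norm (b k))"
  shows "(LINT t|circ. (\<Sum>k. b k * cis (of_int (m k) * t))) = (\<Sum>k. if m k = 0 then b k else 0)"
proof -
  have "(LINT t|circ. (\<Sum>k. b k * cis (of_int (m k) * t)))
      = (\<Sum>k. LINT t|circ. b k * cis (of_int (m k) * t))"
  proof (rule integral_suminf)
    show "integrable circ (\<lambda>t. b k * cis (of_int (m k) * t))" for k
      by (rule integrable_circ_bounded[of _ "norm (b k)"]) (auto simp: norm_mult)
    show "AE t in circ. summable (\<lambda>k. norm (b k * cis (of_int (m k) * t)))"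
      using b by (simp add: norm_mult)
    show "summable (\<lambda>k. LINT t|circ. norm (b k * cis (of_int (m k) * t)))"
      using b by (simp add: norm_mult measure_def)
  qed
  also have "\<dots> = (\<Sum>k. if m k = 0 then b k else 0)"
    by (intro suminf_cong) (simp add: integral_circ_cis)
  finally show ?thesis .
qed

lemma borel_measurable_cis_series [measurable]:
  fixes b :: "nat \<Rightarrow> complex" and m :: "nat \<Rightarrow> int"
  shows "(\<lambda>t. \<Sum>k. b k * cis (of_int (m k) * t)) \<in> borel_measurable borel"
  by measurable

lemma norm_cis_series_le:
  fixes b :: "nat \<Rightarrow> complex" and m :: "nat \<Rightarrow> int"
  assumes b: "summable (\<lambda>k. norm (b k))"
  shows "norm (\<Sum>k. b k * cis (of_int (m k) * t)) \<le> (\<Sum>k. norm (b k))"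
proof -
  have "norm (\<Sum>k. b k * cis (of_int (m k) * t)) \<le> (\<Sum>k. norm (b k * cis (of_int (m k) * t)))"
    by (rule summable_norm) (simp add: norm_mult b)
  then show ?thesis by (simp add: norm_mult)
qed

text \<open>A disc of squared radius s has area pi * s, so in the variable s = |z|^2 area becomes pi
  times Lebesgue measure on [0, 1], with no Jacobian. The two measures on the line are compared on
  right half-lines.\<close>

lemma nn_integral_radial:
  fixes w :: "real \<Rightarrow> ennreal"
  assumes [measurable]: "w \<in> borel_measurable borel"
  shows "(\<integral>\<^sup>+ z. indicator unit_disc z * w ((norm z)\<^sup>2) \<partial>lborel)
       = ennreal pi * (\<integral>\<^sup>+ s. indicator {0..1} s * w s \<partial>lborel)"
proof -
  let ?M = "distr (density lborel (indicator unit_disc)) borel (\<lambda>z::complex. (norm z)\<^sup>2)"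
  let ?N = "density lborel (\<lambda>s::real. ennreal pi * indicator {0..1} s)"
  have ball: "emeasure lborel (ball (0::complex) r) = ennreal (pi * r\<^sup>2)"
       "emeasure lborel (cball (0::complex) r) = ennreal (pi * r\<^sup>2)" if "r \<ge> 0" for r
    using that by (simp_all add: emeasure_ball emeasure_cball unit_ball_vol_2)
  have M: "emeasure ?M {x<..} = emeasure lborel {z::complex. z \<in> unit_disc \<and> x < (norm z)\<^sup>2}" for x
  proof -
    have "emeasure ?M {x<..} = emeasure (density lborel (indicator unit_disc)) {z::complex. x < (norm z)\<^sup>2}"
      by (subst emeasure_distr) (auto intro!: arg_cong2[where f=emeasure])
    also have "\<dots> = emeasure lborel {z::complex. z \<in> unit_disc \<and> x < (norm z)\<^sup>2}"
      by (subst emeasure_restricted) (auto intro!: arg_cong2[where f=emeasure])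
    finally show ?thesis .
  qed
  have N: "emeasure ?N {x<..} = ennreal pi * emeasure lborel {max 0 x .. 1}" for x
  proof -
    have "emeasure ?N {x<..} = ennreal pi * emeasure lborel ({x<..} \<inter> {0..1})"
      by (subst emeasure_density)
         (auto simp: nn_integral_cmult_indicator[symmetric] intro!: nn_integral_cong split: split_indicator)
    also have "emeasure lborel ({x<..} \<inter> {0..1}) = emeasure lborel {max 0 x .. 1}"
    proof (cases "0 \<le> x \<and> x \<le> 1")
      case True
      then have "{x<..} \<inter> {0..1} = {x<..1}" by auto
      then show ?thesis using True by simp
    next
      case False
      then have "{x<..} \<inter> {0..1} = {max 0 x .. 1}" by auto
      then show ?thesis by simp
    qed
    finally show ?thesis .
  qed
  have "?M = ?N"
  proof (rule measure_eqI_lessThan)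
    show eq: "emeasure ?M {x<..} = emeasure ?N {x<..}" for x
    proof -
      consider "x < 0" | "0 \<le> x" "x < 1" | "1 \<le> x" by linarith
      then show ?thesis
      proof cases
        case 1
        then have "{z::complex. z \<in> unit_disc \<and> x < (norm z)\<^sup>2} = ball 0 1"
          using less_le_trans[OF 1] by auto
        then show ?thesis unfolding M N using ball[of 1] 1 by simp
      next
        case 2
        have "{z::complex. z \<in> unit_disc \<and> x < (norm z)\<^sup>2} = ball 0 1 - cball 0 (sqrt x)"
        proof -
          have R: "x < (norm z)\<^sup>2 \<longleftrightarrow> sqrt x < norm z" for z :: complex
            using real_sqrt_less_iff[of x "(norm z)\<^sup>2"] by (simp del: real_sqrt_less_iff)
          show ?thesis unfolding R by auto
        qed
        moreover have "emeasure lborel (ball (0::complex) 1 - cball 0 (sqrt x))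
            = emeasure lborel (ball (0::complex) 1) - emeasure lborel (cball (0::complex) (sqrt x))"
          using 2 le_less_trans[of _ "sqrt x" 1] by (intro emeasure_Diff) (auto simp: ball)
        moreover have "\<dots> = ennreal (pi * (1 - x))"
          using 2 by (simp add: ball ennreal_minus algebra_simps)
        ultimately show ?thesis unfolding M N using 2 by (simp add: ennreal_mult)
      next
        case 3
        have "(norm z)\<^sup>2 < 1" if "norm z < 1" for z :: complex
          using that by (simp add: abs_square_less_1)
        then have E: "{z::complex. z \<in> unit_disc \<and> x < (norm z)\<^sup>2} = {}"
          using 3 by force
        moreover have "{max 0 x..1} = {} \<or> {max 0 x..1} = {1}" using 3 by auto
        ultimately show ?thesis unfolding M N E by auto
      qed
    qed
    show "emeasure ?M {x<..} < \<infinity>" for x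
      unfolding eq N by (auto simp: ennreal_mult_less_top emeasure_lborel_Icc_eq)
  qed auto
  then have "(\<integral>\<^sup>+ s. w s \<partial>?M) = (\<integral>\<^sup>+ s. w s \<partial>?N)" by simp
  moreover have "(\<integral>\<^sup>+ s. w s \<partial>?M) = (\<integral>\<^sup>+ z. indicator unit_disc z * w ((norm z)\<^sup>2) \<partial>lborel)"
    by (subst nn_integral_distr, measurable, subst nn_integral_density)
       (auto intro!: borel_measurable_indicator)
  moreover have "(\<integral>\<^sup>+ s. w s \<partial>?N) = ennreal pi * (\<integral>\<^sup>+ s. indicator {0..1} s * w s \<partial>lborel)"
    by (subst nn_integral_density) (auto simp: mult.assoc nn_integral_cmult)
  ultimately show ?thesis by simp
qed

section \<open>Sub-mean value inequality\<close>

text \<open>Nothing is known about \<open>f\<close> and \<open>deriv f\<close> outside the disc; the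
  indicator factor is what makes the integrands Borel functions on the whole plane.\<close>

lemma measurable_indicator_continuous_on:
  fixes F :: "'a::topological_space \<Rightarrow> real"
  assumes "open S" "continuous_on S F"
  shows "(\<lambda>z. indicator S z * ennreal (F z)) \<in> borel_measurable borel"
proof -
  have "(\<lambda>z. indicator S z *\<^sub>R F z) \<in> borel_measurable borel"
    by (rule borel_measurable_continuous_on_indicator) (use assms in auto)
  then have "(\<lambda>z. ennreal (indicator S z *\<^sub>R F z)) \<in> borel_measurable borel" by measurable
  also have "(\<lambda>z. ennreal (indicator S z *\<^sub>R F z)) = (\<lambda>z. indicator S z * ennreal (F z))"
    by (auto split: split_indicator)
  finally show ?thesis .
qed

lemma continuous_on_norm_powr:
  fixes h :: "'a::topological_space \<Rightarrow> 'b::real_normed_vector"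
  assumes "continuous_on S h" "q > 0"
  shows "continuous_on S (\<lambda>z. norm (h z) powr q)"
  by (rule continuous_on_powr') (use assms in \<open>auto intro!: continuous_intros\<close>)

text \<open>The mean of h over a circle about z0 is the constant term h(z0) of its Taylor series
  there. The rotation average then assembles the circles into the disc.\<close>

lemma holomorphic_area_mean:
  assumes h: "h holomorphic_on ball z0 \<rho>" and "\<rho> > 0"
  shows "ennreal (norm (h z0) * (pi * \<rho>\<^sup>2))
      \<le> (\<integral>\<^sup>+ z. indicator (ball z0 \<rho>) z * ennreal (norm (h z)) \<partial>lborel)"
proof -
  define u where "u = (\<lambda>z. indicator (ball z0 \<rho>) z * ennreal (norm (h z)))"
  have [measurable]: "u \<in> borel_measurable borel"
    unfolding u_def using h
    by (intro measurable_indicator_continuous_on continuous_intros holomorphic_on_imp_continuous_on) auto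
  have mean: "ennreal (norm (h z0)) \<le> (\<integral>\<^sup>+ t. u (z0 + cis t * z) \<partial>circ)" if z: "z \<in> ball 0 \<rho>" for z
  proof -
    define c where "c = (\<lambda>n. (deriv ^^ n) h z0 / fact n)"
    have sums: "(\<lambda>n. c n * w ^ n) sums h (z0 + w)" if "norm w < \<rho>" for w
      using holomorphic_power_series[OF h, of "z0 + w"] that by (simp add: c_def dist_norm)
    obtain s where s: "norm z < s" "s < \<rho>" using z dense by auto
    have sm: "summable (\<lambda>n. norm (c n * z ^ n))"
    proof (rule powser_insidea[of _ "of_real s"])
      show "summable (\<lambda>n. c n * of_real s ^ n)"
        using sums[of "of_real s"] s(2) order.strict_trans1[OF norm_ge_zero s(1)]
        by (auto simp: sums_iff)
    qed (use s order.strict_trans1[OF norm_ge_zero s(1)] in auto)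
    have eq: "(\<Sum>k. (c k * z ^ k) * cis (of_int (int k) * t)) = h (z0 + cis t * z)" for t
      using sums[of "cis t * z"] z
      by (simp add: sums_iff norm_mult power_mult_distrib Complex.DeMoivre mult_ac)
    have u: "u (z0 + cis t * z) = ennreal (norm (h (z0 + cis t * z)))" for t
      using z by (simp add: u_def dist_norm norm_mult)
    have m: "(\<lambda>t. h (z0 + cis t * z)) \<in> borel_measurable borel"
      using borel_measurable_cis_series[of "\<lambda>k. c k * z ^ k" int] unfolding eq .
    have bd: "norm (h (z0 + cis t * z)) \<le> (\<Sum>k. norm (c k * z ^ k))" for t
      using norm_cis_series_le[OF sm, of int t] unfolding eq .
    have "(LINT t|circ. h (z0 + cis t * z)) = (\<Sum>k. if int k = 0 then c k * z ^ k else 0)"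
      using circ_integral_series[OF sm, of int] unfolding eq .
    also have "\<dots> = (\<Sum>k\<in>{0}. if int k = 0 then c k * z ^ k else 0)"
      by (rule suminf_finite) auto
    also have "\<dots> = h z0" by (simp add: c_def)
    finally have "ennreal (norm (h z0)) = ennreal (norm (LINT t|circ. h (z0 + cis t * z)))" by simp
    also have "\<dots> \<le> (\<integral>\<^sup>+ t. ennreal (norm (h (z0 + cis t * z))) \<partial>circ)"
      by (rule integral_norm_bound_ennreal) (rule integrable_circ_bounded[OF m bd])
    finally show ?thesis by (simp add: u)
  qed
  have "ennreal (norm (h z0) * (pi * \<rho>\<^sup>2)) = ennreal (norm (h z0)) * emeasure lborel (ball (0::complex) \<rho>)"
    using \<open>\<rho> > 0\<close> by (simp add: emeasure_ball unit_ball_vol_2 ennreal_mult)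
  also have "\<dots> = (\<integral>\<^sup>+ z. ennreal (norm (h z0)) * indicator (ball 0 \<rho>) (z::complex) \<partial>lborel)"
    by (rule nn_integral_cmult_indicator[symmetric]) auto
  also have "\<dots> \<le> (\<integral>\<^sup>+ z. \<integral>\<^sup>+ t. u (z0 + cis t * z) \<partial>circ \<partial>lborel)"
    by (intro nn_integral_mono) (use mean in \<open>auto split: split_indicator\<close>)
  also have "\<dots> = (\<integral>\<^sup>+ z. u (z0 + z) \<partial>lborel)"
    by (rule nn_integral_rotation_average[symmetric]) measurable
  also have "\<dots> = (\<integral>\<^sup>+ z. u z \<partial>lborel)" by (rule nn_integral_lborel_translate) measurable
  finally show ?thesis by (simp add: u_def)
qed

text \<open>For \<open>q < 1\<close> the sub-mean value property of \<open>|h|\<^sup>q\<close> follows from the case \<open>q = 1\<close>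
  at a point where \<open>|h z|\<^sup>q (R - |z - a|)\<^sup>2\<close> is maximal.\<close>
lemma holomorphic_powr_submean:
  assumes h: "h holomorphic_on S" and S: "open S" "cball a R \<subseteq> S" and R: "R > 0"
    and q: "0 < q" "q \<le> 1"
  shows "ennreal (norm (h a) powr q * (pi * R\<^sup>2))
     \<le> ennreal (4 powr (1 / q)) * (\<integral>\<^sup>+ z. indicator (ball a R) z * ennreal (norm (h z) powr q) \<partial>lborel)"
proof -
  have hc: "continuous_on (cball a R) h"
    using h S(2) holomorphic_on_imp_continuous_on continuous_on_subset by blast
  define \<Phi> where "\<Phi> = (\<lambda>z. norm (h z) powr q * (R - norm (z - a))\<^sup>2)"
  have "continuous_on (cball a R) \<Phi>"
    unfolding \<Phi>_def by (intro continuous_intros continuous_on_norm_powr hc q)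
  then obtain z1 where z1: "z1 \<in> cball a R" and max: "\<And>z. z \<in> cball a R \<Longrightarrow> \<Phi> z \<le> \<Phi> z1"
    using continuous_attains_sup[of "cball a R" \<Phi>] R by auto
  define I where "I = (\<integral>\<^sup>+ z. indicator (ball a R) z * ennreal (norm (h z) powr q) \<partial>lborel)"
  have a: "norm (h a) powr q * R\<^sup>2 \<le> \<Phi> z1"
    using max[of a] R by (simp add: \<Phi>_def)
  show ?thesis
  proof (cases "\<Phi> z1 = 0")
    case True
    then have "norm (h a) powr q * R\<^sup>2 \<le> 0" using a by simp
    then have "norm (h a) powr q = 0" using R by (simp add: mult_le_0_iff not_less antisym)
    then show ?thesis by simp
  next
    case False
    define N where "N = norm (h z1)"
    have N: "N > 0" using False by (auto simp: N_def \<Phi>_def)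
    \<comment> \<open>Half the distance from z1 to the bounding circle: on the disc of this radius
      about z1 the factor \<open>R - norm (z - a)\<close> is at least half its value at z1, so
      maximality of \<open>\<Phi>\<close> gives |h|^q <= 4 N^q.\<close>
    define \<rho> where "\<rho> = (R - norm (z1 - a)) / 2"
    have \<rho>: "\<rho> > 0"
      using False z1 by (auto simp: \<rho>_def \<Phi>_def dist_norm norm_minus_commute less_le)
    have in_ball: "R - norm (z - a) \<ge> \<rho>" if "z \<in> ball z1 \<rho>" for z
    proof -
      have "norm (z - a) \<le> norm (z - z1) + norm (z1 - a)" using norm_triangle_ineq[of "z - z1" "z1 - a"] by simp
      moreover have "norm (z - z1) < \<rho>" using that by (simp add: dist_norm norm_minus_commute)
      moreover have "2 * \<rho> = R - norm (z1 - a)" by (simp add: \<rho>_def)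
      ultimately show ?thesis by linarith
    qed
    have sub: "ball z1 \<rho> \<subseteq> ball a R"
      using in_ball \<rho> by (fastforce simp: dist_norm norm_minus_commute)
    \<comment> \<open>Write |h| = |h|^(1-q) |h|^q and bound the first factor by the power (1-q)/q of
      |h|^q <= 4 N^q. The area mean of |h| thus becomes one of |h|^q.\<close>
    have bound: "norm (h z) \<le> 4 powr ((1 - q) / q) * N powr (1 - q) * norm (h z) powr q"
      if z: "z \<in> ball z1 \<rho>" for z
    proof (cases "h z = 0")
      case False
      have "norm (h z) powr q * \<rho>\<^sup>2 \<le> \<Phi> z"
        unfolding \<Phi>_def using in_ball[OF z] \<rho> by (intro mult_left_mono power_mono) auto
      also have "\<dots> \<le> \<Phi> z1" using sub z by (intro max) auto
      also have "\<dots> = N powr q * 4 * \<rho>\<^sup>2" by (simp add: \<Phi>_def N_def \<rho>_def power_divide)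
      finally have "norm (h z) powr q \<le> N powr q * 4" using \<rho> by simp
      then have "(norm (h z) powr q) powr ((1 - q) / q) \<le> (N powr q * 4) powr ((1 - q) / q)"
        using q by (intro powr_mono2) auto
      then have "norm (h z) powr (1 - q) \<le> N powr (1 - q) * 4 powr ((1 - q) / q)"
        using q by (simp add: powr_powr powr_mult)
      then have "norm (h z) powr (1 - q) * norm (h z) powr q
          \<le> N powr (1 - q) * 4 powr ((1 - q) / q) * norm (h z) powr q"
        by (rule mult_right_mono) simp
      moreover have "norm (h z) powr (1 - q) * norm (h z) powr q = norm (h z)"
        using False by (simp add: powr_add[symmetric])
      ultimately show ?thesis by (simp add: mult_ac)
    qed simp
    define K where "K = 4 powr ((1 - q) / q) * N powr (1 - q)"
    have [measurable]: "(\<lambda>z. indicator (ball a R) z * ennreal (norm (h z) powr q)) \<in> borel_measurable borel"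
      by (intro measurable_indicator_continuous_on continuous_on_norm_powr q)
         (use hc continuous_on_subset ball_subset_cball in blast)+
    have "ennreal (N * (pi * \<rho>\<^sup>2)) \<le> (\<integral>\<^sup>+ z. indicator (ball z1 \<rho>) z * ennreal (norm (h z)) \<partial>lborel)"
      unfolding N_def by (rule holomorphic_area_mean[OF _ \<rho>])
        (use h sub S(2) ball_subset_cball in \<open>blast intro: holomorphic_on_subset\<close>)
    also have "\<dots> \<le> (\<integral>\<^sup>+ z. ennreal K * (indicator (ball a R) z * ennreal (norm (h z) powr q)) \<partial>lborel)"
      using bound sub
      by (intro nn_integral_mono) (auto simp: K_def ennreal_mult[symmetric] intro!: ennreal_leI split: split_indicator)
    also have "\<dots> = ennreal K * I" unfolding I_def by (rule nn_integral_cmult) measurable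
    finally have main: "ennreal (N * (pi * \<rho>\<^sup>2)) \<le> ennreal K * I" .
    have "ennreal (norm (h a) powr q * (pi * R\<^sup>2)) \<le> ennreal (4 * N powr (q - 1)) * ennreal (N * (pi * \<rho>\<^sup>2))"
    proof -
      have "norm (h a) powr q * (pi * R\<^sup>2) \<le> pi * \<Phi> z1"
        using mult_left_mono[OF a, of pi] by (simp add: mult_ac)
      also have "\<dots> = 4 * N powr q * (pi * \<rho>\<^sup>2)" by (simp add: \<Phi>_def N_def \<rho>_def power_divide)
      also have "N powr q = N powr (q - 1) * N" using N by (simp add: powr_mult_base powr_diff)
      finally have "norm (h a) powr q * (pi * R\<^sup>2) \<le> (4 * N powr (q - 1)) * (N * (pi * \<rho>\<^sup>2))"
        by (simp only: mult_ac)
      then show ?thesis using N by (subst ennreal_mult[symmetric]) (auto intro: ennreal_leI)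
    qed
    also have "\<dots> \<le> ennreal (4 * N powr (q - 1)) * (ennreal K * I)"
      by (rule mult_left_mono[OF main]) simp
    also have "\<dots> = ennreal (4 powr (1 / q)) * I"
    proof -
      \<comment> \<open>One factor 4 comes from \<open>\<Phi> z1\<close>, the factor 4^((1-q)/q)
        from \<open>bound\<close>; together they make 4^(1/q), and the powers of N cancel.\<close>
      have "4 * N powr (q - 1) * K = (4 powr 1 * 4 powr ((1 - q) / q)) * (N powr (q - 1) * N powr (1 - q))"
        by (simp add: K_def)
      also have "\<dots> = 4 powr (1 + (1 - q) / q) * N powr 0"
        by (simp only: powr_add[symmetric]) simp
      also have "1 + (1 - q) / q = 1 / q" using q by (simp add: field_simps)
      finally have "4 * N powr (q - 1) * K = 4 powr (1 / q)" using N by simp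
      then show ?thesis by (simp add: mult.assoc[symmetric] ennreal_mult[symmetric] K_def)
    qed
    finally show ?thesis by (simp add: I_def)
  qed
qed

section \<open>Carleson boxes\<close>

text \<open>After division by x + y the two summands lie in [0, 1], where t <= t^q, and they add up
  to 1.\<close>

lemma powr_add_le:
  fixes x y q :: real
  assumes "0 \<le> x" "0 \<le> y" "0 < q" "q \<le> 1"
  shows "(x + y) powr q \<le> x powr q + y powr q"
proof (cases "x + y = 0")
  case False
  then have s: "x + y > 0" using assms by linarith
  have le: "t \<le> t powr q" if "0 \<le> t" "t \<le> 1" for t :: real
  proof (cases "t = 0")
    case False
    then have "t powr 1 \<le> t powr q" using that assms by (intro powr_mono') auto
    then show ?thesis using that False by simp
  qed simp
  have "1 = x / (x + y) + y / (x + y)" using s by (simp add: add_divide_distrib[symmetric])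
  also have "\<dots> \<le> (x / (x + y)) powr q + (y / (x + y)) powr q"
    using assms s by (intro add_mono le) (auto simp: field_simps)
  also have "\<dots> = (x powr q + y powr q) / (x + y) powr q"
    using assms s by (simp add: powr_divide add_divide_distrib)
  finally show ?thesis using s by (simp add: field_simps)
qed (use assms in simp)

lemma norm_add_powr_le:
  assumes "0 < q" "q \<le> 1"
  shows "norm (a + b) powr q \<le> norm a powr q + norm b powr q"
  by (rule order_trans[OF powr_mono2 powr_add_le]) (use assms in \<open>auto intro: norm_triangle_ineq\<close>)

lemma jordan_sin_ge:
  assumes "0 \<le> x" "x \<le> pi / 2"
  shows "2 * x / pi \<le> sin x"
proof -
  have "concave_on {0..pi/2} sin"
    by (rule f''_le0_imp_concave[where f' = cos and f'' = "\<lambda>x. - sin x"])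
       (auto intro!: derivative_eq_intros sin_ge_zero)
  from concave_onD_Icc'[OF this, of x] show ?thesis using assms by simp
qed

lemma norm_cis_minus_one_ge:
  assumes "\<bar>t\<bar> \<le> pi"
  shows "2 * \<bar>t\<bar> / pi \<le> norm (cis t - 1)"
proof -
  have "norm (cis t - 1) = 2 * \<bar>sin (t / 2)\<bar>"
    by (simp add: dist_exp_i_1 cis_conv_exp)
  also have "\<bar>sin (t / 2)\<bar> = sin (\<bar>t\<bar> / 2)"
    using assms sin_ge_zero[of "\<bar>t\<bar> / 2"] by (cases "t \<ge> 0") auto
  moreover have "2 * (\<bar>t\<bar> / 2) / pi \<le> sin (\<bar>t\<bar> / 2)"
    using assms by (intro jordan_sin_ge) auto
  ultimately show ?thesis by simp
qed

text \<open>The strict bound r < 1 keeps the box from being compact. Cutting it off at r <= 1 -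
  1/(n+1) gives continuous images of compact rectangles, and the box is their countable
  union.\<close>

lemma carleson_box_borel [measurable]: "carleson_box \<theta> l \<in> sets borel"
proof -
  let ?A = "\<lambda>n. (\<lambda>(r, t). complex_of_real r * cis t) `
      ({1 - l / (2 * pi) .. 1 - 1 / real (Suc n)} \<times> {\<theta> - l / 2 .. \<theta> + l / 2})"
  have "carleson_box \<theta> l = (\<Union>n. ?A n)"
  proof (intro equalityI subsetI)
    fix z assume "z \<in> carleson_box \<theta> l"
    then obtain r t where z: "z = complex_of_real r * cis t" "\<bar>t - \<theta>\<bar> \<le> l / 2"
       "1 - l / (2 * pi) \<le> r" "r < 1" by (auto simp: carleson_box_def)
    obtain n where "inverse (of_nat (Suc n)) < 1 - r" using reals_Archimedean[of "1 - r"] z by auto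
    then have "r \<le> 1 - 1 / real (Suc n)" by (simp add: field_simps)
    moreover have "t \<in> {\<theta> - l / 2 .. \<theta> + l / 2}" using z(2) unfolding atLeastAtMost_iff abs_le_iff by linarith
    ultimately show "z \<in> (\<Union>n. ?A n)" using z
      by (intro UN_I[of n] image_eqI[of _ _ "(r, t)"]) auto
  next
    fix z assume "z \<in> (\<Union>n. ?A n)"
    then obtain n r t where z: "z = complex_of_real r * cis t" "1 - l / (2 * pi) \<le> r"
      "r \<le> 1 - 1 / real (Suc n)" "\<theta> - l / 2 \<le> t" "t \<le> \<theta> + l / 2"
      by auto
    have "0 < 1 / real (Suc n)" by simp
    with z(3) have "r < 1" by linarith
    moreover have "\<bar>t - \<theta>\<bar> \<le> l / 2" using z(4,5) unfolding abs_le_iff by linarith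
    ultimately show "z \<in> carleson_box \<theta> l" using z unfolding carleson_box_def by blast
  qed
  moreover have "?A n \<in> sets borel" for n
  proof -
    have "compact (?A n)"
      unfolding split_beta cis_conv_exp
      by (intro compact_continuous_image continuous_intros compact_Times compact_Icc)
    then show ?thesis by (intro borel_closed compact_imp_closed)
  qed
  ultimately show ?thesis by auto
qed

text \<open>The whole circle counts as an arc, so the Carleson condition includes finiteness of the
  total mass on the disc.\<close>

lemma unit_disc_subset_carleson_box: "unit_disc \<subseteq> carleson_box \<theta> (2 * pi)"
proof
  fix z :: complex assume z: "z \<in> unit_disc"
  define s where "s = Arg (z * cis (- \<theta>))"
  have "z * cis (-\<theta>) = of_real (norm z) * cis s"
    using Arg_eq[of "z * cis (- \<theta>)"]
    by (cases "z = 0") (auto simp: s_def norm_mult cis_conv_exp)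
  then have "z * cis (-\<theta>) * cis \<theta> = of_real (norm z) * cis (\<theta> + s)"
    by (simp add: cis_mult[symmetric] mult_ac)
  then have "z = of_real (norm z) * cis (\<theta> + s)"
    by (simp add: mult.assoc cis_mult)
  moreover have "\<bar>(\<theta> + s) - \<theta>\<bar> \<le> 2 * pi / 2"
    using Arg_bounded[of "z * cis (- \<theta>)"] by (auto simp: s_def)
  ultimately show "z \<in> carleson_box \<theta> (2 * pi)"
    unfolding carleson_box_def mem_Collect_eq
    using z by (intro exI[of _ "norm z"] exI[of _ "\<theta> + s"] conjI) auto
qed

text \<open>The points z beyond the k-th dyadic point (1 - 2^-k) z/|z| of their radius for which w
  lies in a disc about that point. For fixed z the disc in w carries the k-th increment of f along
  the radius; for fixed w this set is what Tonelli's theorem leaves to be measured. The radius 3/4 *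
  2^-k is the length 2^-k / 2 of the dyadic segment plus a margin 2^-k / 4.\<close>

definition radial_shadow :: "nat \<Rightarrow> complex \<Rightarrow> complex set" where
  "radial_shadow k w = {z \<in> unit_disc. z \<noteq> 0 \<and> 1 - (1/2)^k \<le> norm z \<and>
     w \<in> ball (of_real (1 - (1/2)^k) * sgn z) (3/4 * (1/2)^k)}"

text \<open>The discs in the definition stay at distance more than 2^-k / 4 from the unit circle,
  since 1 - 3/4 = 1/4. Hence w is met only on levels with 2^-k < 4 (1 - |w|), which later makes the
  sum over k of size 1 - |w|.\<close>

lemma radial_shadow_empty:
  assumes "radial_shadow k w \<noteq> {}"
  shows "(1/2)^k / 4 < 1 - norm w"
proof -
  obtain z where z: "z \<noteq> 0" "w \<in> ball (of_real (1 - (1/2)^k) * sgn z) (3/4 * (1/2)^k)"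
    using assms by (auto simp: radial_shadow_def)
  let ?c = "complex_of_real (1 - (1/2)^k) * sgn z"
  have 1: "norm ?c = 1 - (1/2)^k"
    using z by (simp add: norm_mult norm_sgn power_le_one del: of_real_diff)
  have "norm w \<le> norm ?c + norm (w - ?c)" by (rule norm_triangle_sub)
  moreover have "norm (w - ?c) < 3/4 * (1/2)^k" using z(2) by (simp add: dist_norm norm_minus_commute)
  ultimately show ?thesis unfolding 1 by linarith
qed

text \<open>Two points of one shadow have k-th dyadic points less than 3/2 * 2^-k apart on a circle
  of radius at least 3/4, so their arguments differ by at most pi * 2^-k. An arc of length 2 pi 2^-k
  about any one of them has this half-width, and its box has depth 2^-k.\<close>

lemma radial_shadow_subset_box:
  assumes z0: "z0 \<in> radial_shadow k w" and k: "k \<ge> 2"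
  shows "radial_shadow k w \<subseteq> carleson_box (Arg z0) (2 * pi * (1/2)^k)"
proof
  fix z assume z: "z \<in> radial_shadow k w"
  define d :: real where "d = (1/2)^k"
  have d: "0 < d" "d \<le> 1/4"
    using power_decreasing[OF k, of "1/2::real"] by (auto simp: d_def power2_eq_square)
  have nz: "z \<noteq> 0" "z0 \<noteq> 0" using z z0 by (auto simp: radial_shadow_def)
  define s where "s = Arg (z / z0)"
  have s: "\<bar>s\<bar> \<le> pi" using Arg_bounded[of "z / z0"] by (auto simp: s_def)
  have zz0: "z / z0 = of_real (norm z / norm z0) * cis s"
    using Arg_eq[of "z / z0"] nz by (simp add: s_def cis_conv_exp norm_divide)
  then have zsgn: "sgn z = cis s * sgn z0"
    using nz by (simp add: sgn_eq field_simps)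
  have "dist (of_real (1 - d) * sgn z) (of_real (1 - d) * sgn z0)
     \<le> dist (of_real (1 - d) * sgn z) w + dist (of_real (1 - d) * sgn z0) w"
    by (rule dist_triangle2)
  also have "\<dots> < 3/2 * d" using z z0 by (auto simp: radial_shadow_def d_def)
  also have "dist (of_real (1 - d) * sgn z) (of_real (1 - d) * sgn z0) = (1 - d) * norm (cis s - 1)"
  proof -
    have "of_real (1 - d) * sgn z - of_real (1 - d) * sgn z0 = of_real (1 - d) * ((cis s - 1) * sgn z0)"
      by (simp add: zsgn algebra_simps)
    then show ?thesis unfolding dist_norm using d nz by (simp add: norm_mult norm_sgn del: of_real_diff)
  qed
  finally have 1: "(1 - d) * norm (cis s - 1) < 3/2 * d" .
  have "3/4 * norm (cis s - 1) \<le> (1 - d) * norm (cis s - 1)"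
    using d by (intro mult_right_mono) auto
  with 1 have "norm (cis s - 1) \<le> 2 * d" by linarith
  with norm_cis_minus_one_ge[OF s] have "2 * \<bar>s\<bar> / pi \<le> 2 * d" by linarith
  then have "\<bar>s\<bar> \<le> pi * d" by (simp add: field_simps)
  moreover have "z = of_real (norm z) * cis (Arg z0 + s)"
  proof -
    have "z0 = of_real (norm z0) * cis (Arg z0)" using Arg_eq[of z0] nz by (simp add: cis_conv_exp)
    then have "z = of_real (norm z0) * cis (Arg z0) * (of_real (norm z / norm z0) * cis s)"
      using zz0 nz by (metis nonzero_mult_div_cancel_left times_divide_eq_right)
    then show ?thesis using nz by (simp add: cis_mult[symmetric] mult_ac)
  qed
  moreover have "1 - d \<le> norm z" "norm z < 1" using z by (auto simp: radial_shadow_def d_def)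
  ultimately show "z \<in> carleson_box (Arg z0) (2 * pi * (1/2)^k)"
    unfolding carleson_box_def d_def[symmetric] mem_Collect_eq
    by (intro exI[of _ "norm z"] exI[of _ "Arg z0 + s"] conjI) auto
qed

lemma emeasure_radial_shadow_le:
  assumes sets: "sets \<mu> = sets borel" and C: "C \<ge> 0"
    and car: "\<And>\<theta> l. 0 < l \<Longrightarrow> l \<le> 2 * pi \<Longrightarrow> emeasure \<mu> (carleson_box \<theta> l) \<le> ennreal (C * l)"
  shows "emeasure \<mu> (radial_shadow k w) \<le> ennreal (4 * pi * C * (1/2)^k)"
proof (cases "radial_shadow k w = {}")
  case False
  then obtain z0 where z0: "z0 \<in> radial_shadow k w" by auto
  show ?thesis
  proof (cases "k \<ge> 2")
    case True
    have "emeasure \<mu> (radial_shadow k w) \<le> emeasure \<mu> (carleson_box (Arg z0) (2 * pi * (1/2)^k))"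
      using radial_shadow_subset_box[OF z0 True] by (intro emeasure_mono) (auto simp: sets)
    also have "\<dots> \<le> ennreal (C * (2 * pi * (1/2)^k))"
      by (rule car) (auto simp: power_le_one)
    also have "\<dots> \<le> ennreal (4 * pi * C * (1/2)^k)"
      using C by (intro ennreal_leI) auto
    finally show ?thesis .
  next
    \<comment> \<open>For k = 0 and k = 1 the whole disc serves as the box. As (1/2)^k >= 1/2 there,
      this costs a factor 2, whence 4 pi in place of 2 pi.\<close>
    case False
    have "emeasure \<mu> (radial_shadow k w) \<le> emeasure \<mu> (carleson_box 0 (2 * pi))"
      using unit_disc_subset_carleson_box[of 0] by (intro emeasure_mono) (auto simp: sets radial_shadow_def)
    also have "\<dots> \<le> ennreal (C * (2 * pi))" by (rule car) auto
    also have "\<dots> \<le> ennreal (4 * pi * C * (1/2)^k)"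
    proof (rule ennreal_leI)
      have "(1/2::real) \<le> (1/2)^k" using False power_decreasing[of k 1 "1/2::real"] by simp
      then have "4 * pi * C * (1/2) \<le> 4 * pi * C * (1/2)^k"
        using C by (intro mult_left_mono) auto
      then show "C * (2 * pi) \<le> 4 * pi * C * (1/2)^k" by simp
    qed
    finally show ?thesis .
  qed
qed simp

section \<open>Carleson embedding\<close>

text \<open>With d = 2^-k, the increment is at most d times the maximum of |f'| on the dyadic
  segment, and the sub-mean value inequality on a disc of radius d/4 about the maximum point
  replaces that maximum by an area integral. There 1 - |w| is at most 5/4 d, and the exponent q - 2
  of the weight balances d^q against the area d^2.\<close>

lemma radial_increment_le:
  assumes f: "f holomorphic_on unit_disc" and q: "0 < q" "q \<le> 1" and u: "norm u = 1"
    and r: "1 - (1/2)^k \<le> r" "r \<le> 1 - (1/2)^Suc k"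
  shows "ennreal (norm (f (of_real r * u) - f (of_real (1 - (1/2)^k) * u)) powr q)
    \<le> ennreal (16 * 4 powr (1/q)) * (\<integral>\<^sup>+ w. indicator (ball (of_real (1 - (1/2)^k) * u) (3/4 * (1/2)^k)) w *
         ennreal (norm (deriv f w) powr q * (1 - norm w) powr (q - 2)) \<partial>lborel)"
proof -
  define d :: real where "d = (1/2)^k"
  have d: "0 < d" "d \<le> 1" by (auto simp: d_def power_le_one)
  have r: "1 - d \<le> r" "r \<le> 1 - d / 2" using r by (auto simp: d_def)
  define P where "P = (\<lambda>s. complex_of_real s * u)"
  define seg where "seg = P ` {1 - d .. 1 - d / 2}"
  have nP: "norm (P s) = s" if "0 \<le> s" for s using that u by (simp add: P_def norm_mult)
  have sub: "seg \<subseteq> unit_disc" using d by (auto simp: seg_def nP)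
  have f': "deriv f holomorphic_on unit_disc" using f by (intro holomorphic_deriv) auto
  have "compact seg" unfolding seg_def P_def
    by (intro compact_continuous_image continuous_intros compact_Icc)
  moreover have "continuous_on seg (\<lambda>z. norm (deriv f z))"
    using f' sub by (intro continuous_intros holomorphic_on_imp_continuous_on) (auto intro: holomorphic_on_subset)
  ultimately obtain \<xi> where \<xi>: "\<xi> \<in> seg" "\<And>z. z \<in> seg \<Longrightarrow> norm (deriv f z) \<le> norm (deriv f \<xi>)"
    using continuous_attains_sup[of seg "\<lambda>z. norm (deriv f z)"] d by (auto simp: seg_def)
  have "convex seg"
  proof -
    have "linear P" unfolding P_def by (rule linearI) (auto simp: algebra_simps scaleR_conv_of_real)
    then show ?thesis unfolding seg_def by (intro convex_linear_image) auto
  qed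
  then have "norm (f (P r) - f (P (1 - d))) \<le> norm (deriv f \<xi>) * norm (P r - P (1 - d))"
  proof (rule field_differentiable_bound[where f' = "deriv f"])
    show "(f has_field_derivative deriv f z) (at z within seg)" if "z \<in> seg" for z
      using that sub f by (intro DERIV_subset[OF holomorphic_derivI[OF f]]) auto
  qed (use \<xi> r d in \<open>auto simp: seg_def\<close>)
  also have "norm (P r - P (1 - d)) = r - (1 - d)"
  proof -
    have "P r - P (1 - d) = of_real (r - (1 - d)) * u" by (simp add: P_def algebra_simps)
    then show ?thesis using r u by (simp add: norm_mult del: of_real_diff)
  qed
  also have "norm (deriv f \<xi>) * (r - (1 - d)) \<le> norm (deriv f \<xi>) * d"
    using r d by (intro mult_left_mono) auto
  finally have 1: "norm (f (P r) - f (P (1 - d))) powr q \<le> norm (deriv f \<xi>) powr q * d powr q"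
    using q d by (subst powr_mult[symmetric]) (auto intro: powr_mono2)
  obtain s where s: "1 - d \<le> s" "s \<le> 1 - d / 2" "\<xi> = P s" using \<xi> by (auto simp: seg_def)
  define J where "J = (\<integral>\<^sup>+ w. indicator (ball (P (1 - d)) (3/4 * d)) w *
         ennreal (norm (deriv f w) powr q * (1 - norm w) powr (q - 2)) \<partial>lborel)"
  have in_disc: "norm w < 1 - d / 4" if "w \<in> ball (P (1 - d)) (3/4 * d)" for w
  proof -
    have "norm w \<le> norm (P (1 - d)) + norm (w - P (1 - d))" by (rule norm_triangle_sub)
    moreover have "norm (w - P (1 - d)) < 3/4 * d" using that by (simp add: dist_norm norm_minus_commute)
    ultimately show ?thesis using nP[of "1 - d"] d by linarith
  qed
  have bsub: "ball \<xi> (d / 4) \<subseteq> ball (P (1 - d)) (3/4 * d)"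
  proof (rule ball_subset_ball_iff[THEN iffD2], rule disjI1)
    have "\<xi> - P (1 - d) = of_real (s - (1 - d)) * u" by (simp add: s P_def algebra_simps)
    then have "dist \<xi> (P (1 - d)) = s - (1 - d)"
      using s u by (simp add: dist_norm norm_mult del: of_real_diff)
    then show "dist \<xi> (P (1 - d)) + d / 4 \<le> 3/4 * d" using s by simp
  qed
  have csub: "cball \<xi> (d / 4) \<subseteq> unit_disc"
  proof
    fix w assume "w \<in> cball \<xi> (d / 4)"
    then have "norm (w - \<xi>) \<le> d / 4" by (simp add: dist_norm norm_minus_commute)
    moreover have "norm w \<le> norm \<xi> + norm (w - \<xi>)" by (rule norm_triangle_sub)
    moreover have "norm \<xi> \<le> 1 - d / 2" using s d by (simp add: nP)
    ultimately show "w \<in> unit_disc" using d by simp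
  qed
  have low: "(5/4 * d) powr (q - 2) \<le> (1 - norm w) powr (q - 2)" if "w \<in> ball \<xi> (d / 4)" for w
  proof (rule powr_mono2')
    have "norm \<xi> \<le> norm w + norm (\<xi> - w)" by (rule norm_triangle_sub)
    moreover have "norm (\<xi> - w) < d / 4" using that by (simp add: dist_norm)
    moreover have "norm \<xi> \<ge> 1 - d" using s d by (simp add: nP)
    ultimately show "1 - norm w \<le> 5/4 * d" by linarith
    have "norm w < 1 - d / 4" using in_disc bsub that by blast
    then show "0 < 1 - norm w" using d by linarith
  qed (use q in auto)
  define L where "L = (5/4 * d) powr (q - 2)"
  have L: "L > 0" using d by (simp add: L_def)
  have m1: "(\<lambda>w. indicator (ball \<xi> (d / 4)) w * ennreal (norm (deriv f w) powr q)) \<in> borel_measurable borel"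
    using f' csub q by (intro measurable_indicator_continuous_on continuous_on_norm_powr
       holomorphic_on_imp_continuous_on holomorphic_on_subset[OF f']) auto
  have "ennreal (L * (norm (deriv f \<xi>) powr q * (pi * (d / 4)\<^sup>2)))
      = ennreal L * ennreal (norm (deriv f \<xi>) powr q * (pi * (d / 4)\<^sup>2))"
    using L by (simp add: ennreal_mult)
  also have "\<dots> \<le> ennreal L * (ennreal (4 powr (1 / q)) *
      (\<integral>\<^sup>+ w. indicator (ball \<xi> (d / 4)) w * ennreal (norm (deriv f w) powr q) \<partial>lborel))"
    using holomorphic_powr_submean[OF f' open_ball csub _ q] d by (intro mult_left_mono) auto
  also have "\<dots> = ennreal (4 powr (1 / q)) *
      (\<integral>\<^sup>+ w. ennreal L * (indicator (ball \<xi> (d / 4)) w * ennreal (norm (deriv f w) powr q)) \<partial>lborel)"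
    by (subst nn_integral_cmult) (use m1 in \<open>auto simp: mult_ac\<close>)
  also have "\<dots> \<le> ennreal (4 powr (1 / q)) * J"
    unfolding J_def
  proof (intro mult_left_mono nn_integral_mono)
    fix w
    show "ennreal L * (indicator (ball \<xi> (d / 4)) w * ennreal (norm (deriv f w) powr q))
      \<le> indicator (ball (P (1 - d)) (3/4 * d)) w * ennreal (norm (deriv f w) powr q * (1 - norm w) powr (q - 2))"
    proof (cases "w \<in> ball \<xi> (d / 4)")
      case True
      have "L * norm (deriv f w) powr q \<le> norm (deriv f w) powr q * (1 - norm w) powr (q - 2)"
        using low[OF True] by (subst mult.commute) (auto simp: L_def intro!: mult_left_mono)
      moreover have "w \<in> ball (P (1 - d)) (3/4 * d)" using True bsub by blast
      ultimately show ?thesis using True L by (simp add: ennreal_mult[symmetric] ennreal_leI)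
    qed simp
  qed simp
  finally have 2: "ennreal (L * (norm (deriv f \<xi>) powr q * (pi * (d / 4)\<^sup>2))) \<le> ennreal (4 powr (1 / q)) * J" .
  \<comment> \<open>The 16 undoes the square in (d/4)^2. What remains is pi * (5/4)^(q-2) >= 1,
    which follows from (5/4)^(-2) = 16/25 and 3 * 16/25 > 1.\<close>
  have 3: "d powr q \<le> 16 * (L * (pi * (d / 4)\<^sup>2))"
  proof -
    have "1 \<le> pi * (5/4) powr (q - 2)"
    proof -
      have "(5/4) powr (-2) \<le> (5/4::real) powr (q - 2)" using q by (intro powr_mono) auto
      moreover have "(5/4) powr (-2) = (16/25::real)"
        by (simp add: powr_minus powr_numeral power2_eq_square)
      ultimately have "3 * (16/25) \<le> pi * (5/4) powr (q - 2)"
        using pi_gt3 by (intro mult_mono) auto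
      then show ?thesis by simp
    qed
    then have "d powr q * 1 \<le> d powr q * (pi * (5/4) powr (q - 2))" by (intro mult_left_mono) auto
    also have "d powr q = d powr (q - 2) * d\<^sup>2" using d by (simp add: powr_diff powr_numeral)
    also have "d powr (q - 2) * d\<^sup>2 * (pi * (5/4) powr (q - 2)) = 16 * (L * (pi * (d / 4)\<^sup>2))"
      using d powr_mult[of "5/4" d "q - 2"] by (simp add: L_def power_divide)
    finally show ?thesis using d by (simp add: powr_diff powr_numeral)
  qed
  have "ennreal (norm (f (P r) - f (P (1 - d))) powr q)
     \<le> ennreal (16 * (L * (norm (deriv f \<xi>) powr q * (pi * (d / 4)\<^sup>2))))"
    by (rule ennreal_leI, rule order_trans[OF 1], rule order_trans[OF mult_left_mono[OF 3]]) (auto simp: mult_ac)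
  also have "\<dots> = ennreal 16 * ennreal (L * (norm (deriv f \<xi>) powr q * (pi * (d / 4)\<^sup>2)))"
    by (rule ennreal_mult') simp
  also have "\<dots> \<le> ennreal 16 * (ennreal (4 powr (1 / q)) * J)"
    by (rule mult_left_mono[OF 2]) simp
  also have "\<dots> = ennreal (16 * 4 powr (1 / q)) * J"
    by (subst ennreal_mult') (simp_all add: mult.assoc)
  finally show ?thesis by (simp add: J_def P_def d_def)
qed

text \<open>Subadditivity of the q-th power along the dyadic points of the radius; the chain ends at
  the origin because 1 - (1/2)^0 = 0.\<close>

lemma norm_powr_radial_chain:
  assumes f: "f holomorphic_on unit_disc" and q: "0 < q" "q \<le> 1" and u: "norm u = 1"
    and r: "1 - (1/2)^k \<le> r" "r \<le> 1 - (1/2)^Suc k"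
  shows "ennreal (norm (f (of_real r * u)) powr q) \<le> ennreal (norm (f 0) powr q) +
     ennreal (16 * 4 powr (1/q)) * (\<Sum>j\<le>k. \<integral>\<^sup>+ w. indicator (ball (of_real (1 - (1/2)^j) * u) (3/4 * (1/2)^j)) w *
         ennreal (norm (deriv f w) powr q * (1 - norm w) powr (q - 2)) \<partial>lborel)"
  using r
proof (induction k arbitrary: r)
  let ?C = "ennreal (16 * 4 powr (1/q))"
  let ?D = "\<lambda>j. \<integral>\<^sup>+ w. indicator (ball (of_real (1 - (1/2)^j) * u) (3/4 * (1/2)^j)) w *
         ennreal (norm (deriv f w) powr q * (1 - norm w) powr (q - 2)) \<partial>lborel"
  have split: "ennreal (norm (f (of_real r * u)) powr q) \<le>
      ennreal (norm (f (of_real (1 - (1/2)^k) * u)) powr q) + ?C * ?D k"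
    if "1 - (1/2)^k \<le> r" "r \<le> 1 - (1/2)^Suc k" for k r
  proof -
    have "ennreal (norm (f (of_real r * u)) powr q) \<le>
       ennreal (norm (f (of_real (1 - (1/2)^k) * u)) powr q)
       + ennreal (norm (f (of_real r * u) - f (of_real (1 - (1/2)^k) * u)) powr q)"
      using ennreal_leI[OF norm_add_powr_le[OF q, of "f (of_real (1 - (1/2)^k) * u)"
          "f (of_real r * u) - f (of_real (1 - (1/2)^k) * u)"]] by simp
    then show ?thesis
      by (rule order_trans) (intro add_left_mono radial_increment_le assms that)
  qed
  {
    case 0
    then show ?case using split[of 0 r] by simp
  next
    case (Suc k)
    have "ennreal (norm (f (of_real r * u)) powr q) \<le>
      ennreal (norm (f (of_real (1 - (1/2)^Suc k) * u)) powr q) + ?C * ?D (Suc k)"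
      by (rule split) (use Suc.prems in auto)
    also have "\<dots> \<le> ennreal (norm (f 0) powr q) + ?C * (\<Sum>j\<le>k. ?D j) + ?C * ?D (Suc k)"
      by (intro add_right_mono Suc.IH) auto
    finally show ?case by (simp add: distrib_left add.assoc)
  }
qed

lemma ex_dyadic_shell:
  fixes x :: real
  assumes "0 \<le> x" "x < 1"
  obtains k where "1 - (1/2)^k \<le> x" "x \<le> 1 - (1/2)^Suc k"
proof -
  let ?P = "\<lambda>k. x \<le> 1 - (1/2)^Suc k"
  obtain n where "(1/2::real)^n < 1 - x" using real_arch_pow_inv[of "1 - x" "1/2"] assms by auto
  moreover have "(1/2::real)^Suc n \<le> (1/2)^n" by simp
  ultimately have "?P n" by linarith
  define k where "k = (LEAST k. ?P k)"
  have "?P k" unfolding k_def by (rule LeastI) (rule \<open>?P n\<close>)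
  moreover have "1 - (1/2)^k \<le> x"
  proof (cases k)
    case (Suc j)
    then have "j < k" by simp
    then have "\<not> ?P j" unfolding k_def by (rule not_less_Least)
    then show ?thesis using Suc by simp
  qed (use assms in simp)
  ultimately show ?thesis using that by blast
qed

text \<open>For y <= 1 the term k = 0 is absent, and taking out a factor 1/2 leaves the same sum for
  2 * y. The induction therefore keeps y free.\<close>

lemma sum_half_powers_below_le:
  fixes y :: real
  assumes "y > 0"
  shows "(\<Sum>k<n. if (1/2)^k < y then (1/2)^k else 0) \<le> 2 * y"
  using assms
proof (induction n arbitrary: y)
  case (Suc n)
  show ?case
  proof (cases "y > 1")
    case True
    have "(\<Sum>k<Suc n. if (1/2)^k < y then (1/2)^k else 0) \<le> (\<Sum>k<Suc n. (1/2::real)^k)"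
      by (intro sum_mono) auto
    also have "\<dots> \<le> 2" by (subst geometric_sum) (auto simp: field_simps)
    finally show ?thesis using True by simp
  next
    case False
    have "(\<Sum>k<Suc n. if (1/2)^k < y then (1/2)^k else 0)
       = (\<Sum>k<n. if (1/2)^k < 2 * y then (1/2::real)^k else 0) / 2"
      using False by (subst sum.lessThan_Suc_shift) (auto simp: sum_divide_distrib intro!: sum.cong)
    then show ?thesis using Suc.IH[of "2 * y"] Suc.prems by simp
  qed
qed simp

text \<open>Carleson's embedding for \<open>q \<le> 1\<close>: along each radius \<open>|f|\<^sup>q\<close> is at most the sum of the
  \<open>q\<close>-th powers of its dyadic increments, which are averages of \<open>|f'|\<^sup>q\<close> over hyperbolic
  discs; Tonelli's theorem then leaves the \<open>\<mu>\<close>-measure of the shadow of a point.\<close>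
theorem carleson_embedding:
  fixes \<mu> :: "complex measure"
  assumes f: "f holomorphic_on unit_disc" and q: "0 < q" "q \<le> 1"
    and fin: "(\<integral>\<^sup>+ w. indicator unit_disc w * ennreal ((1 - norm w) powr (q - 1) * norm (deriv f w) powr q)
        \<partial>lborel) < \<infinity>"
    and sets: "sets \<mu> = sets borel" and \<mu>: "emeasure \<mu> UNIV < \<infinity>" and C: "C \<ge> 0"
    and car: "\<And>\<theta> l. 0 < l \<Longrightarrow> l \<le> 2 * pi \<Longrightarrow> emeasure \<mu> (carleson_box \<theta> l) \<le> ennreal (C * l)"
  shows "(\<integral>\<^sup>+ z. indicator unit_disc z * ennreal (norm (f z) powr q) \<partial>\<mu>) < \<infinity>"
proof -
  note [measurable_cong] = sets
  have space: "space \<mu> = UNIV" using sets_eq_imp_space_eq[OF sets] by simp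
  interpret \<mu>: finite_measure \<mu> by (rule finite_measureI) (use \<mu> in \<open>simp add: space\<close>)
  interpret pair_sigma_finite \<mu> "lborel :: complex measure" ..
  have f': "deriv f holomorphic_on unit_disc" using f by (intro holomorphic_deriv) auto
  define \<phi> where "\<phi> = (\<lambda>w. indicator unit_disc w * ennreal (norm (deriv f w) powr q * (1 - norm w) powr (q - 2)))"
  have [measurable]: "\<phi> \<in> borel_measurable borel"
    unfolding \<phi>_def using q
    by (intro measurable_indicator_continuous_on continuous_intros continuous_on_norm_powr
          holomorphic_on_imp_continuous_on f') auto
  \<comment> \<open>The k-th summand of the chain for z, written with the shadow in place of the
    disc so that it is an integral of a jointly measurable function of z and w.\<close>
  define G where "G = (\<lambda>k z. \<integral>\<^sup>+ w. indicator (radial_shadow k w) z * \<phi> w \<partial>lborel)"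
  have ms: "(\<lambda>(z, w). indicator (radial_shadow k w) z * \<phi> w) \<in> borel_measurable (borel \<Otimes>\<^sub>M borel)" for k
  proof -
    have "Measurable.pred (borel \<Otimes>\<^sub>M borel) (\<lambda>(z, w). z \<in> radial_shadow k w)"
      unfolding radial_shadow_def sgn_div_norm mem_Collect_eq mem_ball by measurable
    then have [measurable]: "(\<lambda>x. indicator (radial_shadow k (snd x)) (fst x) :: ennreal) \<in> borel_measurable (borel \<Otimes>\<^sub>M borel)"
      by (intro borel_measurable_indicator') (simp add: split_beta)
    show ?thesis unfolding split_beta by measurable
  qed
  have mG [measurable]: "G k \<in> borel_measurable \<mu>" for k
    unfolding G_def by (rule lborel.borel_measurable_nn_integral) (use ms in \<open>simp cong: measurable_cong_sets\<close>)
  let ?c = "ennreal (16 * 4 powr (1/q))"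
  have pt: "indicator unit_disc z * ennreal (norm (f z) powr q) \<le> ennreal (norm (f 0) powr q) + ?c * (\<Sum>k. G k z)" for z
  proof (cases "z \<in> unit_disc \<and> z \<noteq> 0")
    case True
    then obtain k where k: "1 - (1/2)^k \<le> norm z" "norm z \<le> 1 - (1/2)^Suc k"
      using ex_dyadic_shell[of "norm z"] by auto
    have z: "z = of_real (norm z) * sgn z" using True by (simp add: sgn_eq)
    \<comment> \<open>On levels j <= k the point z lies beyond the j-th dyadic point of its radius,
      so membership in the shadow is just membership of w in the disc.\<close>
    have eq: "(\<integral>\<^sup>+ w. indicator (ball (of_real (1 - (1/2)^j) * sgn z) (3/4 * (1/2)^j)) w *
         ennreal (norm (deriv f w) powr q * (1 - norm w) powr (q - 2)) \<partial>lborel) = G j z" if "j \<le> k" for j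
      unfolding G_def
    proof (rule nn_integral_cong)
      fix w
      have "(1/2::real)^k \<le> (1/2)^j" using that by (intro power_decreasing) auto
      then have "1 - (1/2)^j \<le> norm z" using k(1) by linarith
      then have "z \<in> radial_shadow j w \<longleftrightarrow> w \<in> ball (of_real (1 - (1/2)^j) * sgn z) (3/4 * (1/2)^j)"
        using True by (simp add: radial_shadow_def)
      moreover have "w \<in> unit_disc" if "z \<in> radial_shadow j w"
      proof -
        have "(0::real) < (1/2)^j / 4" by simp
        also have "\<dots> < 1 - norm w" using radial_shadow_empty that by blast
        finally show ?thesis by simp
      qed
      ultimately show "indicator (ball (of_real (1 - (1/2)^j) * sgn z) (3/4 * (1/2)^j)) w *
         ennreal (norm (deriv f w) powr q * (1 - norm w) powr (q - 2)) = indicator (radial_shadow j w) z * \<phi> w"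
        unfolding \<phi>_def by (auto split: split_indicator)
    qed
    have "ennreal (norm (f z) powr q) \<le> ennreal (norm (f 0) powr q) + ?c * (\<Sum>j\<le>k. G j z)"
    proof -
      have "(\<Sum>j\<le>k. \<integral>\<^sup>+ w. indicator (ball (of_real (1 - (1/2)^j) * sgn z) (3/4 * (1/2)^j)) w *
         ennreal (norm (deriv f w) powr q * (1 - norm w) powr (q - 2)) \<partial>lborel) = (\<Sum>j\<le>k. G j z)"
        by (intro sum.cong refl eq) auto
      moreover have "norm (sgn z) = 1" using True by (simp add: norm_sgn)
      ultimately show ?thesis using norm_powr_radial_chain[OF f q _ k, of "sgn z"] by (simp only: z[symmetric])
    qed
    also have "(\<Sum>j\<le>k. G j z) \<le> (\<Sum>k. G k z)"
      by (rule sum_le_suminf) auto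
    finally show ?thesis using True by (simp add: add_left_mono mult_left_mono)
  qed (auto split: split_indicator)
  have int_G: "(\<integral>\<^sup>+ z. G k z \<partial>\<mu>) \<le> (\<integral>\<^sup>+ w. \<phi> w * ennreal (if (1/2)^k < 4 * (1 - norm w) then 4 * pi * C * (1/2)^k else 0) \<partial>lborel)" for k
  proof -
    have "(\<integral>\<^sup>+ z. G k z \<partial>\<mu>) = (\<integral>\<^sup>+ w. \<integral>\<^sup>+ z. indicator (radial_shadow k w) z * \<phi> w \<partial>\<mu> \<partial>lborel)"
      unfolding G_def by (rule Fubini'[symmetric]) (use ms in \<open>simp cong: measurable_cong_sets\<close>)
    also have "\<dots> \<le> (\<integral>\<^sup>+ w. \<phi> w * ennreal (if (1/2)^k < 4 * (1 - norm w) then 4 * pi * C * (1/2)^k else 0) \<partial>lborel)"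
    proof (rule nn_integral_mono)
      fix w :: complex
      have S: "radial_shadow k w \<in> sets \<mu>"
        unfolding radial_shadow_def sgn_div_norm mem_ball by measurable
      have "(\<integral>\<^sup>+ z. indicator (radial_shadow k w) z * \<phi> w \<partial>\<mu>) = \<phi> w * emeasure \<mu> (radial_shadow k w)"
        using nn_integral_cmult_indicator[OF S, of "\<phi> w"] by (simp add: mult.commute)
      also have "\<dots> \<le> \<phi> w * ennreal (if (1/2)^k < 4 * (1 - norm w) then 4 * pi * C * (1/2)^k else 0)"
      proof (rule mult_left_mono)
        show "emeasure \<mu> (radial_shadow k w) \<le> ennreal (if (1/2)^k < 4 * (1 - norm w) then 4 * pi * C * (1/2)^k else 0)"
        proof (cases "radial_shadow k w = {}")
          case False
          then show ?thesis using emeasure_radial_shadow_le[OF sets C car, of k w] radial_shadow_empty[OF False] by simp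
        qed simp
      qed simp
      finally show "(\<integral>\<^sup>+ z. indicator (radial_shadow k w) z * \<phi> w \<partial>\<mu>)
          \<le> \<phi> w * ennreal (if (1/2)^k < 4 * (1 - norm w) then 4 * pi * C * (1/2)^k else 0)" .
    qed
    finally show ?thesis .
  qed
  \<comment> \<open>The levels reaching w satisfy 2^-k < 4 (1 - |w|) and their powers 2^-k sum to at
    most 8 (1 - |w|). This extra factor raises the exponent q - 2 in \<open>\<phi>\<close> to the q
    - 1 of the hypothesis \<open>fin\<close>.\<close>
  have sumw: "\<phi> w * (\<Sum>k. ennreal (if (1/2)^k < 4 * (1 - norm w) then 4 * pi * C * (1/2)^k else 0))
      \<le> ennreal (32 * pi * C) * (indicator unit_disc w * ennreal ((1 - norm w) powr (q - 1) * norm (deriv f w) powr q))" for w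
  proof (cases "w \<in> unit_disc")
    case True
    have "(\<Sum>k. ennreal (if (1/2)^k < 4 * (1 - norm w) then 4 * pi * C * (1/2)^k else 0)) \<le> ennreal (32 * pi * C * (1 - norm w))"
    proof (rule suminf_le_const)
      fix n
      have "(\<Sum>k<n. if (1/2)^k < 4 * (1 - norm w) then 4 * pi * C * (1/2)^k else 0)
         = 4 * pi * C * (\<Sum>k<n. if (1/2)^k < 4 * (1 - norm w) then (1/2)^k else 0)"
        unfolding sum_distrib_left by (rule sum.cong) auto
      also have "\<dots> \<le> 4 * pi * C * (2 * (4 * (1 - norm w)))"
        using True C by (intro mult_left_mono sum_half_powers_below_le) auto
      also have "\<dots> = 32 * pi * C * (1 - norm w)" by simp
      finally have "(\<Sum>k<n. if (1/2)^k < 4 * (1 - norm w) then 4 * pi * C * (1/2)^k else 0) \<le> 32 * pi * C * (1 - norm w)" .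
      then show "(\<Sum>k<n. ennreal (if (1/2)^k < 4 * (1 - norm w) then 4 * pi * C * (1/2)^k else 0))
          \<le> ennreal (32 * pi * C * (1 - norm w))"
        using C by (subst sum_ennreal) (auto intro: ennreal_leI)
    qed auto
    then have "\<phi> w * (\<Sum>k. ennreal (if (1/2)^k < 4 * (1 - norm w) then 4 * pi * C * (1/2)^k else 0))
        \<le> \<phi> w * ennreal (32 * pi * C * (1 - norm w))" by (rule mult_left_mono) simp
    also have "\<dots> = ennreal (norm (deriv f w) powr q * (1 - norm w) powr (q - 2) * (32 * pi * C * (1 - norm w)))"
      using True C by (simp add: \<phi>_def ennreal_mult)
    also have "norm (deriv f w) powr q * (1 - norm w) powr (q - 2) * (32 * pi * C * (1 - norm w))
        = (32 * pi * C) * ((1 - norm w) powr (q - 1) * norm (deriv f w) powr q)"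
    proof -
      have "(1 - norm w) powr (q - 1) = (1 - norm w) powr (q - 2) * (1 - norm w)"
        using True powr_add[of "1 - norm w" "q - 2" 1] by simp
      then show ?thesis by simp
    qed
    finally show ?thesis using True C by (simp add: ennreal_mult)
  qed (simp add: \<phi>_def)
  have "(\<Sum>k. \<integral>\<^sup>+ z. G k z \<partial>\<mu>)
      \<le> (\<Sum>k. \<integral>\<^sup>+ w. \<phi> w * ennreal (if (1/2)^k < 4 * (1 - norm w) then 4 * pi * C * (1/2)^k else 0) \<partial>lborel)"
    by (rule suminf_le[OF int_G]) auto
  also have "\<dots> = (\<integral>\<^sup>+ w. (\<Sum>k. \<phi> w * ennreal (if (1/2)^k < 4 * (1 - norm w) then 4 * pi * C * (1/2)^k else 0)) \<partial>lborel)"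
    by (rule nn_integral_suminf[symmetric]) measurable
  also have "\<dots> \<le> (\<integral>\<^sup>+ w. ennreal (32 * pi * C) * (indicator unit_disc w *
        ennreal ((1 - norm w) powr (q - 1) * norm (deriv f w) powr q)) \<partial>lborel)"
    by (intro nn_integral_mono) (use sumw in simp)
  also have "\<dots> = ennreal (32 * pi * C) * (\<integral>\<^sup>+ w. indicator unit_disc w *
        ennreal ((1 - norm w) powr (q - 1) * norm (deriv f w) powr q) \<partial>lborel)"
    by (rule nn_integral_cmult)
       (use q in \<open>auto intro!: measurable_indicator_continuous_on continuous_intros continuous_on_norm_powr
          holomorphic_on_imp_continuous_on f'\<close>)
  also have "\<dots> < \<infinity>" using fin by (simp add: ennreal_mult_less_top)
  finally have fin_sum: "(\<Sum>k. \<integral>\<^sup>+ z. G k z \<partial>\<mu>) < \<infinity>" .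
  have "(\<integral>\<^sup>+ z. indicator unit_disc z * ennreal (norm (f z) powr q) \<partial>\<mu>)
      \<le> (\<integral>\<^sup>+ z. ennreal (norm (f 0) powr q) + ?c * (\<Sum>k. G k z) \<partial>\<mu>)"
    by (intro nn_integral_mono pt)
  also have "\<dots> = ennreal (norm (f 0) powr q) * emeasure \<mu> UNIV + ?c * (\<Sum>k. \<integral>\<^sup>+ z. G k z \<partial>\<mu>)"
    by (simp add: nn_integral_add nn_integral_cmult nn_integral_suminf space)
  also have "\<dots> < \<infinity>" using fin_sum \<mu> by (simp add: ennreal_mult_less_top)
  finally show ?thesis .
qed

section \<open>The sufficient condition\<close>

lemma disc_integral_less_top_iff:
  assumes "continuous_on unit_disc w" "\<And>z. z \<in> unit_disc \<Longrightarrow> 0 \<le> w z"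
  shows "disc_integral w < \<infinity> \<longleftrightarrow> (\<integral>\<^sup>+ z. indicator unit_disc z * ennreal (w z) \<partial>lborel) < \<infinity>"
proof -
  have "disc_integral w = (\<integral>\<^sup>+ z. ennreal (1 / pi) * (indicator unit_disc z * ennreal (w z)) \<partial>lborel)"
    unfolding disc_integral_def using assms(2)
    by (intro nn_integral_cong) (auto simp: ennreal_mult[symmetric] split: split_indicator)
  also have "\<dots> = ennreal (1 / pi) * (\<integral>\<^sup>+ z. indicator unit_disc z * ennreal (w z) \<partial>lborel)"
    by (rule nn_integral_cmult) (use measurable_indicator_continuous_on[OF _ assms(1)] in auto)
  finally show ?thesis by (auto simp: ennreal_mult_less_top)
qed

lemma continuous_on_weighted_deriv:
  assumes "f holomorphic_on unit_disc" "q > 0"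
  shows "continuous_on unit_disc (\<lambda>z. (1 - norm z) powr r * norm (deriv f z) powr q)"
proof -
  have "deriv f holomorphic_on unit_disc" using assms by (intro holomorphic_deriv) auto
  then show ?thesis using assms
    by (intro continuous_intros continuous_on_norm_powr holomorphic_on_imp_continuous_on) auto
qed

lemma Dp_space_iff:
  assumes "p > 0"
  shows "f \<in> Dp_space p \<longleftrightarrow> f holomorphic_on unit_disc \<and>
    (\<integral>\<^sup>+ z. indicator unit_disc z * ennreal ((1 - norm z) powr (p - 1) * norm (deriv f z) powr p) \<partial>lborel) < \<infinity>"
proof (cases "f holomorphic_on unit_disc")
  case True
  from disc_integral_less_top_iff[OF continuous_on_weighted_deriv[OF True assms, of "p - 1"]]
  show ?thesis using True by (simp add: Dp_space_def analytic_on_open)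
qed (simp add: Dp_space_def analytic_on_open)

section \<open>Bloch functions: logarithmic growth and inclusion between weighted Dirichlet
  spaces\<close>

lemma Bloch_holomorphic: "f \<in> Bloch \<Longrightarrow> f holomorphic_on unit_disc"
  by (simp add: Bloch_def analytic_on_open)

lemma one_minus_norm_sq_bounds:
  fixes z :: complex
  assumes "z \<in> unit_disc"
  shows "0 < 1 - (norm z)\<^sup>2" "1 - norm z \<le> 1 - (norm z)\<^sup>2" "1 - (norm z)\<^sup>2 \<le> 2 * (1 - norm z)"
proof -
  have z: "0 \<le> norm z" "norm z < 1" using assms by auto
  then have "norm z * norm z \<le> norm z * 1" by (intro mult_left_mono) auto
  then show "1 - norm z \<le> 1 - (norm z)\<^sup>2" by (simp add: power2_eq_square)
  with z show "0 < 1 - (norm z)\<^sup>2" by linarith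
  have "0 \<le> (1 - norm z)\<^sup>2" by simp
  then show "1 - (norm z)\<^sup>2 \<le> 2 * (1 - norm z)" by (simp add: power2_eq_square algebra_simps)
qed

text \<open>Since q - 1 <= 0, the estimate 1 - |z|^2 <= 2 (1 - |z|) reverses under the power and
  loses the factor 2^(1-q), which is at most 2.\<close>

lemma one_minus_norm_powr_le:
  fixes z :: complex
  assumes z: "z \<in> unit_disc" and q: "0 < q" "q \<le> 1"
  shows "(1 - norm z) powr (q - 1) \<le> 2 * (1 - (norm z)\<^sup>2) powr (q - 1)"
proof -
  note b = one_minus_norm_sq_bounds[OF z]
  have "(2 * (1 - norm z)) powr (q - 1) \<le> (1 - (norm z)\<^sup>2) powr (q - 1)"
    using b q by (intro powr_mono2') auto
  moreover have "(2::real) powr (-1) \<le> 2 powr (q - 1)" using q by (intro powr_mono) auto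
  then have "1/2 * (1 - norm z) powr (q - 1) \<le> 2 powr (q - 1) * (1 - norm z) powr (q - 1)"
    by (intro mult_right_mono) (auto simp: powr_minus)
  moreover have "(2 * (1 - norm z)) powr (q - 1) = 2 powr (q - 1) * (1 - norm z) powr (q - 1)"
    using z by (intro powr_mult)
  ultimately show ?thesis by linarith
qed

lemma log_weight_ge_1:
  assumes "z \<in> unit_disc"
  shows "1 \<le> ln (exp 1 / (1 - (norm z)\<^sup>2))"
proof -
  have "exp 1 \<le> exp 1 / (1 - (norm z)\<^sup>2)"
    using one_minus_norm_sq_bounds[OF assms] by (simp add: field_simps)
  then have "ln (exp 1) \<le> ln (exp 1 / (1 - (norm z)\<^sup>2))"
    using one_minus_norm_sq_bounds[OF assms] by (subst ln_le_cancel_iff) auto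
  then show ?thesis by simp
qed

lemma Bloch_bound:
  assumes "f \<in> Bloch"
  obtains C where "C \<ge> 0" "\<And>z. z \<in> unit_disc \<Longrightarrow> (1 - (norm z)\<^sup>2) * norm (deriv f z) \<le> C"
proof -
  obtain C where C: "\<And>z. z \<in> unit_disc \<Longrightarrow> (1 - (norm z)\<^sup>2) * norm (deriv f z) \<le> C"
    using assms unfolding Bloch_def by blast
  have "0 \<le> C" by (rule order_trans[OF _ C[of 0]]) auto
  with C show ?thesis using that by blast
qed

text \<open>Integrating |f'(tz)| |z| <= C |z| / (1 - t|z|) over 0 <= t <= 1 gives C ln (1/(1 -
  |z|)). The numerator e in the logarithm does two things: as ln 2 < 1 it covers the passage to 1 -
  |z|^2, and it keeps the logarithm at least 1, so that |f(0)| can be absorbed.\<close>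

lemma Bloch_growth:
  assumes "f \<in> Bloch"
  obtains C where "C \<ge> 0" "\<And>z. z \<in> unit_disc \<Longrightarrow> norm (f z) \<le> C * ln (exp 1 / (1 - (norm z)\<^sup>2))"
proof -
  obtain C where C: "C \<ge> 0" "\<And>z. z \<in> unit_disc \<Longrightarrow> (1 - (norm z)\<^sup>2) * norm (deriv f z) \<le> C"
    using Bloch_bound[OF assms] by blast
  have f: "f holomorphic_on unit_disc" by (rule Bloch_holomorphic[OF assms])
  have "norm (f z) \<le> (norm (f 0) + C) * ln (exp 1 / (1 - (norm z)\<^sup>2))" if z: "z \<in> unit_disc" for z
  proof -
    define x where "x = norm z"
    have x: "0 \<le> x" "x < 1" using z by (auto simp: x_def)
    have tz: "of_real t * z \<in> unit_disc" "t * x < 1" if "0 \<le> t" "t \<le> 1" for t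
      using that x mult_right_mono[OF that(2) x(1)] by (auto simp: norm_mult x_def[symmetric])
    have "norm (f (of_real 1 * z) - f (of_real 0 * z)) \<le> (- C * ln (1 - 1 * x)) - (- C * ln (1 - 0 * x))"
    proof (rule differentiable_bound_general[where f' = "\<lambda>t. z * deriv f (of_real t * z)"
          and \<phi>' = "\<lambda>t. C * x / (1 - t * x)"])
      show "continuous_on {0..1} (\<lambda>t. f (complex_of_real t * z))"
        by (rule continuous_on_compose2[OF holomorphic_on_imp_continuous_on[OF f]])
           (use tz in \<open>auto intro!: continuous_intros\<close>)
      show "continuous_on {0..1} (\<lambda>t. - C * ln (1 - t * x))"
      proof -
        have "1 - t * x \<noteq> 0" if "t \<in> {0..1}" for t using tz(2)[of t] that by auto
        then show ?thesis by (intro continuous_intros) blast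
      qed
      fix t :: real assume t: "0 < t" "t < 1"
      show "((\<lambda>t. f (complex_of_real t * z)) has_vector_derivative z * deriv f (complex_of_real t * z)) (at t)"
      proof -
        have "(f has_field_derivative deriv f (of_real t * z)) (at (of_real t * z))"
          using tz[of t] t by (intro holomorphic_derivI[OF f]) auto
        then have "((\<lambda>w. f (w * z)) has_field_derivative deriv f (of_real t * z) * z) (at (of_real t))"
          by (rule DERIV_chain2) (auto intro!: derivative_eq_intros)
        from has_vector_derivative_real_field[OF this] show ?thesis by (simp add: mult.commute)
      qed
      show "((\<lambda>t. - C * ln (1 - t * x)) has_vector_derivative C * x / (1 - t * x)) (at t)"
        unfolding has_real_derivative_iff_has_vector_derivative[symmetric]
        using tz(2)[of t] t by (auto intro!: derivative_eq_intros simp: field_simps)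
      show "norm (z * deriv f (complex_of_real t * z)) \<le> C * x / (1 - t * x)"
      proof -
        have tx: "0 < 1 - t * x" using tz(2)[of t] t by simp
        have n: "norm (of_real t * z) = t * x" using t by (simp add: norm_mult x_def)
        have "(1 - t * x) * norm (deriv f (of_real t * z))
            \<le> (1 - (norm (of_real t * z))\<^sup>2) * norm (deriv f (of_real t * z))"
          using one_minus_norm_sq_bounds(2)[OF tz(1)[of t]] t unfolding n by (intro mult_right_mono) auto
        also have "\<dots> \<le> C" using tz(1)[of t] t by (intro C) auto
        finally have "norm (deriv f (of_real t * z)) \<le> C / (1 - t * x)"
          using tx by (simp add: field_simps)
        then have "x * norm (deriv f (of_real t * z)) \<le> x * (C / (1 - t * x))"
          using x by (intro mult_left_mono)
        then show ?thesis by (simp add: norm_mult x_def[symmetric] mult_ac)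
      qed
    qed simp
    then have 1: "norm (f z - f 0) \<le> C * (- ln (1 - x))" by simp
    have b: "0 < 1 - x\<^sup>2" "1 - x\<^sup>2 \<le> 2 * (1 - x)"
      using one_minus_norm_sq_bounds[OF z] by (auto simp: x_def)
    have "- ln (1 - x) \<le> ln 2 - ln (1 - x\<^sup>2)"
    proof -
      have "ln (1 - x\<^sup>2) \<le> ln (2 * (1 - x))" using b x by (subst ln_le_cancel_iff) auto
      also have "\<dots> = ln 2 + ln (1 - x)" using x by (intro ln_mult_pos) auto
      finally show ?thesis by simp
    qed
    also have "\<dots> \<le> ln (exp 1 / (1 - x\<^sup>2))"
      using b ln_2_less_1 by (simp add: ln_div)
    finally have 2: "- ln (1 - x) \<le> ln (exp 1 / (1 - x\<^sup>2))" .
    have "norm (f z) \<le> norm (f 0) + norm (f z - f 0)" by (rule norm_triangle_sub)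
    also have "norm (f z - f 0) \<le> C * ln (exp 1 / (1 - x\<^sup>2))"
      using 1 mult_left_mono[OF 2 C(1)] by linarith
    also have "norm (f 0) \<le> norm (f 0) * ln (exp 1 / (1 - x\<^sup>2))"
      using log_weight_ge_1[OF z] by (intro mult_le_cancel_left1[THEN iffD2]) (auto simp: x_def)
    finally show ?thesis by (simp add: x_def algebra_simps)
  qed
  with C(1) show ?thesis using that[of "norm (f 0) + C"] by auto
qed

text \<open>The integrand for q is the integrand for p times ((1 - |z|) |f'|)^(q-p), and the Bloch
  condition bounds the latter factor.\<close>

lemma Dp_Bloch_subset_Dq:
  assumes "0 < p" "p \<le> q" and f: "f \<in> Dp_space p \<inter> Bloch"
  shows "f \<in> Dp_space q"
proof -
  have q: "0 < q" using assms by simp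
  have hol: "f holomorphic_on unit_disc" using f Bloch_holomorphic by blast
  obtain C where C: "C \<ge> 0" "\<And>z. z \<in> unit_disc \<Longrightarrow> (1 - (norm z)\<^sup>2) * norm (deriv f z) \<le> C"
    using Bloch_bound f by blast
  have "(\<integral>\<^sup>+ z. indicator unit_disc z * ennreal ((1 - norm z) powr (q - 1) * norm (deriv f z) powr q) \<partial>lborel)
     \<le> (\<integral>\<^sup>+ z. ennreal (C powr (q - p)) *
        (indicator unit_disc z * ennreal ((1 - norm z) powr (p - 1) * norm (deriv f z) powr p)) \<partial>lborel)"
  proof (rule nn_integral_mono)
    fix z :: complex
    show "indicator unit_disc z * ennreal ((1 - norm z) powr (q - 1) * norm (deriv f z) powr q)
      \<le> ennreal (C powr (q - p)) *
        (indicator unit_disc z * ennreal ((1 - norm z) powr (p - 1) * norm (deriv f z) powr p))"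
    proof (cases "z \<in> unit_disc")
      case True
      define d where "d = 1 - norm z"
      define D where "D = norm (deriv f z)"
      have d: "d > 0" using True by (simp add: d_def)
      have D: "D \<ge> 0" by (simp add: D_def)
      have "d * D \<le> (1 - (norm z)\<^sup>2) * D"
        unfolding d_def by (intro mult_right_mono one_minus_norm_sq_bounds True D)
      also have "\<dots> \<le> C" using C(2)[OF True] by (simp add: D_def)
      finally have "(d * D) powr (q - p) \<le> C powr (q - p)"
        using assms d D by (intro powr_mono2) auto
      then have "(d * D) powr (q - p) * (d powr (p - 1) * D powr p) \<le> C powr (q - p) * (d powr (p - 1) * D powr p)"
        by (rule mult_right_mono) simp
      moreover have "(d * D) powr (q - p) * (d powr (p - 1) * D powr p)
         = (d powr (q - p) * d powr (p - 1)) * (D powr (q - p) * D powr p)"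
        using d D by (simp add: powr_mult)
      moreover have "\<dots> = d powr (q - 1) * D powr q"
        by (simp only: powr_add[symmetric]) simp
      ultimately have "d powr (q - 1) * D powr q \<le> C powr (q - p) * (d powr (p - 1) * D powr p)"
        by linarith
      from ennreal_leI[OF this] show ?thesis using True
        by (simp add: D_def d_def ennreal_mult)
    qed simp
  qed
  also have "\<dots> = ennreal (C powr (q - p)) * (\<integral>\<^sup>+ z.
        indicator unit_disc z * ennreal ((1 - norm z) powr (p - 1) * norm (deriv f z) powr p) \<partial>lborel)"
    by (rule nn_integral_cmult)
       (use measurable_indicator_continuous_on[OF _ continuous_on_weighted_deriv[OF hol assms(1)]] in auto)
  also have "\<dots> < \<infinity>" using f assms(1) by (auto simp: Dp_space_iff ennreal_mult_less_top)
  finally show ?thesis using q hol by (simp add: Dp_space_iff)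
qed

lemma mu_gq_eq:
  "mu_gq g q = density lborel (\<lambda>z. indicator unit_disc z *
     ennreal (norm (deriv g z) powr q * (1 - (norm z)\<^sup>2) powr (q - 1) / pi))"
  unfolding mu_gq_def by (intro arg_cong[where f = "density lborel"]) (auto split: split_indicator)

lemma measurable_mu_gq_density:
  assumes "g holomorphic_on unit_disc" "q > 0"
  shows "(\<lambda>z. indicator unit_disc z *
     ennreal (norm (deriv g z) powr q * (1 - (norm z)\<^sup>2) powr (q - 1) / pi)) \<in> borel_measurable borel"
proof -
  have "deriv g holomorphic_on unit_disc" using assms by (intro holomorphic_deriv) auto
  then show ?thesis using assms
    by (intro measurable_indicator_continuous_on continuous_intros continuous_on_norm_powr
        holomorphic_on_imp_continuous_on) (auto dest: one_minus_norm_sq_bounds(1))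
qed

lemma multiplier_sufficient:
  assumes p: "0 < p" "p \<le> q" and q: "q \<le> 1"
    and g: "g \<in> H_inf \<inter> Bloch_log" and car: "carleson_measure (mu_gq g q)"
  shows "g \<in> multipliers (Dp_space p \<inter> Bloch) (Dp_space q \<inter> Bloch)"
proof -
  have q0: "0 < q" using p by simp
  have gh: "g holomorphic_on unit_disc" using g by (auto simp: H_inf_def analytic_on_open)
  obtain A where A: "A > 0" "\<And>z. z \<in> unit_disc \<Longrightarrow> norm (g z) \<le> A"
    using g by (auto simp: H_inf_def bounded_pos)
  obtain B where B: "\<And>z. z \<in> unit_disc \<Longrightarrow>
      (1 - (norm z)\<^sup>2) * norm (deriv g z) * ln (exp 1 / (1 - (norm z)\<^sup>2)) \<le> B"
    using g unfolding Bloch_log_def by blast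
  define \<rho> where "\<rho> = (\<lambda>z. indicator unit_disc z *
     ennreal (norm (deriv g z) powr q * (1 - (norm z)\<^sup>2) powr (q - 1) / pi))"
  have [measurable]: "\<rho> \<in> borel_measurable borel"
    unfolding \<rho>_def by (rule measurable_mu_gq_density[OF gh q0])
  have mu: "mu_gq g q = density lborel \<rho>" by (simp add: mu_gq_eq \<rho>_def)
  obtain C0 where C0: "\<And>\<theta> l. 0 < l \<Longrightarrow> l \<le> 2 * pi \<Longrightarrow> emeasure (mu_gq g q) (carleson_box \<theta> l) \<le> ennreal (C0 * l)"
    using car by (auto simp: carleson_measure_def)
  \<comment> \<open>\<open>carleson_measure\<close> does not fix the sign of its constant, while the
    embedding wants it nonnegative.\<close>
  define C where "C = max C0 0"
  have C: "C \<ge> 0" "\<And>\<theta> l. 0 < l \<Longrightarrow> l \<le> 2 * pi \<Longrightarrow> emeasure (mu_gq g q) (carleson_box \<theta> l) \<le> ennreal (C * l)"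
  proof -
    show "C \<ge> 0" by (simp add: C_def)
    fix \<theta> l :: real assume l: "0 < l" "l \<le> 2 * pi"
    have "C0 * l \<le> C * l" using l by (intro mult_right_mono) (auto simp: C_def)
    then show "emeasure (mu_gq g q) (carleson_box \<theta> l) \<le> ennreal (C * l)"
      using C0[OF l] by (meson ennreal_leI order_trans)
  qed
  have sets: "sets (mu_gq g q) = sets borel" by (simp add: mu)
  have fin: "emeasure (mu_gq g q) UNIV < \<infinity>"
  proof -
    have "emeasure (mu_gq g q) UNIV = (\<integral>\<^sup>+ z. \<rho> z * indicator UNIV z \<partial>lborel)"
      unfolding mu by (subst emeasure_density) auto
    also have "\<dots> \<le> (\<integral>\<^sup>+ z. \<rho> z * indicator (carleson_box 0 (2 * pi)) z \<partial>lborel)"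
      using unit_disc_subset_carleson_box[of 0]
      by (intro nn_integral_mono) (auto simp: \<rho>_def split: split_indicator)
    also have "\<dots> = emeasure (mu_gq g q) (carleson_box 0 (2 * pi))"
      unfolding mu by (subst emeasure_density) auto
    also have "\<dots> \<le> ennreal (C * (2 * pi))" by (rule C) auto
    also have "\<dots> < \<infinity>" by simp
    finally show ?thesis .
  qed
  have "(\<lambda>z. f z * g z) \<in> Dp_space q \<inter> Bloch" if f: "f \<in> Dp_space p \<inter> Bloch" for f
  proof -
    have fh: "f holomorphic_on unit_disc" using f Bloch_holomorphic by blast
    have fgh: "(\<lambda>z. f z * g z) holomorphic_on unit_disc" by (intro holomorphic_intros fh gh)
    have D: "deriv (\<lambda>z. f z * g z) z = f z * deriv g z + deriv f z * g z" if "z \<in> unit_disc" for z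
      using fh gh that by (intro deriv_mult) (auto simp: holomorphic_on_imp_differentiable_at)
    have fq: "(\<integral>\<^sup>+ z. indicator unit_disc z * ennreal ((1 - norm z) powr (q - 1) * norm (deriv f z) powr q) \<partial>lborel) < \<infinity>"
      using Dp_Bloch_subset_Dq[OF p f] q0 by (simp add: Dp_space_iff)
    have emb: "(\<integral>\<^sup>+ z. indicator unit_disc z * ennreal (norm (f z) powr q) \<partial>mu_gq g q) < \<infinity>"
      by (rule carleson_embedding[OF fh q0 q fq sets fin C])
    have [measurable]: "(\<lambda>z. indicator unit_disc z * ennreal (norm (f z) powr q)) \<in> borel_measurable borel"
      using fh q0 by (intro measurable_indicator_continuous_on continuous_on_norm_powr holomorphic_on_imp_continuous_on) auto
    have [measurable]: "(\<lambda>z. indicator unit_disc z * ennreal ((1 - norm z) powr (q - 1) * norm (deriv f z) powr q))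
        \<in> borel_measurable borel"
      using measurable_indicator_continuous_on[OF open_ball continuous_on_weighted_deriv[OF fh q0]] .
    \<comment> \<open>In the factor 2 * pi, the pi removes the normalisation inside
      \<open>\<rho>\<close> and the 2 comes from exchanging 1 - |z| for 1 - |z|^2 in the
      weight.\<close>
    have pt: "indicator unit_disc z * ennreal ((1 - norm z) powr (q - 1) * norm (deriv (\<lambda>z. f z * g z) z) powr q)
       \<le> ennreal (2 * pi) * (\<rho> z * (indicator unit_disc z * ennreal (norm (f z) powr q)))
         + ennreal (A powr q) * (indicator unit_disc z * ennreal ((1 - norm z) powr (q - 1) * norm (deriv f z) powr q))" for z
    proof (cases "z \<in> unit_disc")
      case True
      let ?w = "(1 - norm z) powr (q - 1)"
      have w: "?w \<le> 2 * (1 - (norm z)\<^sup>2) powr (q - 1)"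
        by (rule one_minus_norm_powr_le[OF True q0 q])
      have "norm (deriv (\<lambda>z. f z * g z) z) powr q
          \<le> norm (f z * deriv g z) powr q + norm (deriv f z * g z) powr q"
        unfolding D[OF True] by (rule norm_add_powr_le[OF q0 q])
      from mult_left_mono[OF this, of ?w] have "?w * norm (deriv (\<lambda>z. f z * g z) z) powr q
          \<le> ?w * (norm (f z) powr q * norm (deriv g z) powr q) + ?w * (norm (deriv f z) powr q * norm (g z) powr q)"
        by (simp add: norm_mult powr_mult distrib_left)
      also have "?w * (norm (f z) powr q * norm (deriv g z) powr q)
          \<le> (2 * (1 - (norm z)\<^sup>2) powr (q - 1)) * (norm (f z) powr q * norm (deriv g z) powr q)"
        by (rule mult_right_mono[OF w]) simp
      also have "?w * (norm (deriv f z) powr q * norm (g z) powr q) \<le> ?w * (norm (deriv f z) powr q * A powr q)"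
        using A True q0 by (intro mult_left_mono powr_mono2) auto
      finally have "?w * norm (deriv (\<lambda>z. f z * g z) z) powr q
         \<le> (2 * pi) * ((norm (deriv g z) powr q * (1 - (norm z)\<^sup>2) powr (q - 1) / pi) * norm (f z) powr q)
           + A powr q * (?w * norm (deriv f z) powr q)"
        by (simp add: mult_ac)
      from ennreal_leI[OF this] show ?thesis using True
        by (simp add: \<rho>_def ennreal_plus ennreal_mult del: times_divide_eq_left)
    qed simp
    have "(\<integral>\<^sup>+ z. indicator unit_disc z * ennreal ((1 - norm z) powr (q - 1) * norm (deriv (\<lambda>z. f z * g z) z) powr q) \<partial>lborel)
      \<le> (\<integral>\<^sup>+ z. ennreal (2 * pi) * (\<rho> z * (indicator unit_disc z * ennreal (norm (f z) powr q)))
         + ennreal (A powr q) * (indicator unit_disc z * ennreal ((1 - norm z) powr (q - 1) * norm (deriv f z) powr q)) \<partial>lborel)"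
      by (rule nn_integral_mono[OF pt])
    also have "\<dots> = ennreal (2 * pi) * (\<integral>\<^sup>+ z. indicator unit_disc z * ennreal (norm (f z) powr q) \<partial>mu_gq g q)
        + ennreal (A powr q) * (\<integral>\<^sup>+ z. indicator unit_disc z * ennreal ((1 - norm z) powr (q - 1) * norm (deriv f z) powr q) \<partial>lborel)"
      unfolding mu by (simp add: nn_integral_add nn_integral_cmult nn_integral_density)
    also have "\<dots> < \<infinity>" using emb fq by (simp add: ennreal_mult_less_top)
    finally have 1: "(\<lambda>z. f z * g z) \<in> Dp_space q" using fgh q0 by (simp add: Dp_space_iff)
    obtain E where E: "E \<ge> 0" "\<And>z. z \<in> unit_disc \<Longrightarrow> norm (f z) \<le> E * ln (exp 1 / (1 - (norm z)\<^sup>2))"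
      using Bloch_growth f by blast
    obtain F where F: "F \<ge> 0" "\<And>z. z \<in> unit_disc \<Longrightarrow> (1 - (norm z)\<^sup>2) * norm (deriv f z) \<le> F"
      using Bloch_bound f by blast
    have "(1 - (norm z)\<^sup>2) * norm (deriv (\<lambda>z. f z * g z) z) \<le> E * B + F * A" if z: "z \<in> unit_disc" for z
    proof -
      let ?d = "1 - (norm z)\<^sup>2"
      have d: "?d > 0" using one_minus_norm_sq_bounds[OF z] by simp
      have L: "0 \<le> E * ln (exp 1 / ?d)"
        using log_weight_ge_1[OF z] by (intro mult_nonneg_nonneg E) linarith
      have "?d * norm (deriv (\<lambda>z. f z * g z) z) \<le> ?d * (norm (f z) * norm (deriv g z) + norm (deriv f z) * norm (g z))"
        unfolding D[OF z] using d norm_triangle_ineq[of "f z * deriv g z" "deriv f z * g z"]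
        by (intro mult_left_mono) (auto simp: norm_mult)
      also have "\<dots> = norm (f z) * (?d * norm (deriv g z)) + (?d * norm (deriv f z)) * norm (g z)"
        by (simp add: algebra_simps)
      \<comment> \<open>The growth of f costs exactly the logarithm that \<open>Bloch_log\<close>
        grants to g'; the other product needs only a bound for each factor.\<close>
      also have "\<dots> \<le> (E * ln (exp 1 / ?d)) * (?d * norm (deriv g z)) + F * A"
        using A d by (intro add_mono mult_mono E(2) F A z L F(1)) auto
      also have "(E * ln (exp 1 / ?d)) * (?d * norm (deriv g z)) \<le> E * B"
        using mult_left_mono[OF B[OF z] E(1)] by (simp add: mult_ac)
      finally show ?thesis by simp
    qed
    then have 2: "(\<lambda>z. f z * g z) \<in> Bloch" using fgh unfolding Bloch_def analytic_on_open[OF open_ball] by blast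
    show ?thesis using 1 2 by simp
  qed
  then show ?thesis by (simp add: multipliers_def)
qed

section \<open>Lacunary series\<close>

text \<open>Filling the gaps with zero coefficients produces an ordinary power series, to which the
  usual theorems apply. The scalar field is general because the real series with coefficients |a_k|
  is needed as well.\<close>

lemma gap_powser:
  fixes a :: "nat \<Rightarrow> 'a::{real_normed_field, banach}"
  assumes n: "strict_mono n" and sm: "\<And>z. norm z < 1 \<Longrightarrow> summable (\<lambda>k. a k * z ^ n k)"
    and z: "norm z < 1"
  shows summable_norm_gap_powser: "summable (\<lambda>k. norm (a k * z ^ n k))"
    and summable_gap_termdiff: "summable (\<lambda>k. of_nat (n k) * a k * z ^ (n k - 1))"
    and DERIV_gap_powser: "((\<lambda>z. \<Sum>k. a k * z ^ n k) has_field_derivative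
          (\<Sum>k. of_nat (n k) * a k * z ^ (n k - 1))) (at z)"
proof -
  have inj: "inj n" using n by (rule strict_mono_imp_inj_on)
  define c where "c = (\<lambda>m. if m \<in> range n then a (inv n m) else 0)"
  have cn: "c (n k) = a k" for k using inj by (simp add: c_def)
  have c0: "c m = 0" if "m \<notin> range n" for m using that by (simp add: c_def)
  have reindex: "(\<lambda>k. F (n k) (a k)) sums s \<longleftrightarrow> (\<lambda>m. F m (c m)) sums s"
    if "\<And>m. F m 0 = 0" for F :: "nat \<Rightarrow> 'a \<Rightarrow> 'b::real_normed_vector" and s
    using sums_mono_reindex[OF n, of "\<lambda>m. F m (c m)" s] that by (simp add: cn c0)
  then have sm_iff: "summable (\<lambda>k. F (n k) (a k)) \<longleftrightarrow> summable (\<lambda>m. F m (c m))"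
      and sum_eq: "(\<Sum>k. F (n k) (a k)) = (\<Sum>m. F m (c m))"
    if "\<And>m. F m 0 = 0" for F :: "nat \<Rightarrow> 'a \<Rightarrow> 'b::real_normed_vector"
  proof -
    have "(sums) (\<lambda>k. F (n k) (a k)) = (sums) (\<lambda>m. F m (c m))"
      by (rule ext) (rule reindex, rule that)
    then show "summable (\<lambda>k. F (n k) (a k)) \<longleftrightarrow> summable (\<lambda>m. F m (c m))"
      and "(\<Sum>k. F (n k) (a k)) = (\<Sum>m. F m (c m))"
      by (simp_all add: summable_def suminf_def)
  qed
  have smc: "summable (\<lambda>m. c m * w ^ m)" if "norm w < 1" for w
    using sm[OF that] sm_iff[of "\<lambda>m x. x * w ^ m"] by simp
  obtain s where s: "norm z < s" "s < 1" using z dense by auto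
  have s': "norm (of_real s :: 'a) = s" using s order.strict_trans1[OF norm_ge_zero s(1)] by simp
  have "summable (\<lambda>m. norm (c m * z ^ m))"
    by (rule powser_insidea[of _ "of_real s"]) (use smc[of "of_real s"] s s' in auto)
  then show "summable (\<lambda>k. norm (a k * z ^ n k))"
    using sm_iff[of "\<lambda>m x. norm (x * z ^ m)"] by simp
  have "summable (\<lambda>m. diffs c m * z ^ m)" by (rule termdiff_converges[OF z smc])
  then have d: "(\<lambda>m. of_nat m * c m * z ^ (m - Suc 0)) sums (\<Sum>m. diffs c m * z ^ m)"
    by (rule diffs_equiv)
  then show "summable (\<lambda>k. of_nat (n k) * a k * z ^ (n k - 1))"
    using sm_iff[of "\<lambda>m x. of_nat m * x * z ^ (m - 1)"] by (simp add: sums_iff)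
  have "((\<lambda>z. \<Sum>m. c m * z ^ m) has_field_derivative (\<Sum>m. diffs c m * z ^ m)) (at z)"
    by (rule termdiffs_strong[of _ "of_real s"]) (use smc[of "of_real s"] s s' in auto)
  moreover have "(\<lambda>z. \<Sum>m. c m * z ^ m) = (\<lambda>z. \<Sum>k. a k * z ^ n k)"
    using sum_eq[of "\<lambda>m x. x * _ ^ m"] by (auto simp: fun_eq_iff)
  moreover have "(\<Sum>m. diffs c m * z ^ m) = (\<Sum>k. of_nat (n k) * a k * z ^ (n k - 1))"
    using d sum_eq[of "\<lambda>m x. of_nat m * x * z ^ (m - 1)"] by (simp add: sums_iff)
  ultimately show "((\<lambda>z. \<Sum>k. a k * z ^ n k) has_field_derivative
          (\<Sum>k. of_nat (n k) * a k * z ^ (n k - 1))) (at z)" by simp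
qed

text \<open>Orthogonality, with coinciding frequencies allowed: in the application to the square of
  a polynomial the indices are pairs, and different pairs may have the same sum.\<close>

lemma integral_circ_trig_poly_norm_sq:
  fixes B :: "'i \<Rightarrow> complex" and \<nu> :: "'i \<Rightarrow> int"
  assumes "finite I"
  shows "(LINT t|circ. (norm (\<Sum>i\<in>I. B i * cis (of_int (\<nu> i) * t)))\<^sup>2)
     = (\<Sum>i\<in>I. \<Sum>j\<in>I. if \<nu> i = \<nu> j then Re (B i * cnj (B j)) else 0)"
proof -
  let ?P = "\<lambda>t. \<Sum>i\<in>I. B i * cis (of_int (\<nu> i) * t)"
  have eq: "complex_of_real ((norm (?P t))\<^sup>2)
      = (\<Sum>i\<in>I. \<Sum>j\<in>I. (B i * cnj (B j)) * cis (of_int (\<nu> i - \<nu> j) * t))" for t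
  proof -
    have "complex_of_real ((norm (?P t))\<^sup>2) = ?P t * cnj (?P t)"
      by (rule complex_norm_square)
    also have "\<dots> = (\<Sum>i\<in>I. \<Sum>j\<in>I. (B i * cis (of_int (\<nu> i) * t)) * (cnj (B j) * cis (- (of_int (\<nu> j) * t))))"
      by (simp add: sum_product cis_cnj)
    also have "\<dots> = (\<Sum>i\<in>I. \<Sum>j\<in>I. (B i * cnj (B j)) * cis (of_int (\<nu> i - \<nu> j) * t))"
    proof (intro sum.cong refl)
      fix i j
      have "cis (of_int (\<nu> i) * t) * cis (- (of_int (\<nu> j) * t)) = cis (of_int (\<nu> i - \<nu> j) * t)"
        by (simp add: cis_mult algebra_simps)
      then show "(B i * cis (of_int (\<nu> i) * t)) * (cnj (B j) * cis (- (of_int (\<nu> j) * t)))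
         = (B i * cnj (B j)) * cis (of_int (\<nu> i - \<nu> j) * t)" by (metis mult.assoc mult.left_commute)
    qed
    finally show ?thesis .
  qed
  have int: "integrable circ (\<lambda>t. b * cis (of_int m * t))" for b :: complex and m :: int
    by (rule integrable_circ_bounded[of _ "norm b"]) (auto simp: norm_mult)
  have "complex_of_real (LINT t|circ. (norm (?P t))\<^sup>2) = (LINT t|circ. complex_of_real ((norm (?P t))\<^sup>2))"
  proof (rule integral_of_real[symmetric], rule integrable_circ_bounded[of _ "(\<Sum>i\<in>I. norm (B i))\<^sup>2"])
    show "norm ((norm (?P t))\<^sup>2) \<le> (\<Sum>i\<in>I. norm (B i))\<^sup>2" for t
      using norm_sum[of "\<lambda>i. B i * cis (of_int (\<nu> i) * t)" I] by (simp add: norm_mult power_mono)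
  qed measurable
  also have "\<dots> = (\<Sum>i\<in>I. \<Sum>j\<in>I. LINT t|circ. (B i * cnj (B j)) * cis (of_int (\<nu> i - \<nu> j) * t))"
  proof -
    have "(LINT t|circ. complex_of_real ((norm (?P t))\<^sup>2))
        = (LINT t|circ. (\<Sum>i\<in>I. \<Sum>j\<in>I. (B i * cnj (B j)) * cis (of_int (\<nu> i - \<nu> j) * t)))"
      by (rule Bochner_Integration.integral_cong[OF refl eq])
    also have "\<dots> = (\<Sum>i\<in>I. LINT t|circ. (\<Sum>j\<in>I. (B i * cnj (B j)) * cis (of_int (\<nu> i - \<nu> j) * t)))"
      by (rule Bochner_Integration.integral_sum) (intro Bochner_Integration.integrable_sum int)
    also have "\<dots> = (\<Sum>i\<in>I. \<Sum>j\<in>I. LINT t|circ. (B i * cnj (B j)) * cis (of_int (\<nu> i - \<nu> j) * t))"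
      by (intro sum.cong refl Bochner_Integration.integral_sum int)
    finally show ?thesis .
  qed
  also have "\<dots> = (\<Sum>i\<in>I. \<Sum>j\<in>I. if \<nu> i = \<nu> j then B i * cnj (B j) else 0)"
    by (intro sum.cong refl) (simp add: integral_circ_cis del: of_int_diff)
  finally have "(LINT t|circ. (norm (?P t))\<^sup>2) = Re (\<Sum>i\<in>I. \<Sum>j\<in>I. if \<nu> i = \<nu> j then B i * cnj (B j) else 0)"
    by (metis Re_complex_of_real)
  also have "\<dots> = (\<Sum>i\<in>I. \<Sum>j\<in>I. if \<nu> i = \<nu> j then Re (B i * cnj (B j)) else 0)"
    unfolding Re_sum by (intro sum.cong refl) auto
  finally show ?thesis .
qed

text \<open>By the arithmetic-geometric inequality two indices of equal frequency contribute at most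
  the half sum of their squares, and each index has at most R partners, itself included.\<close>

lemma integral_circ_trig_poly_norm_sq_le:
  fixes B :: "'i \<Rightarrow> complex" and \<nu> :: "'i \<Rightarrow> int"
  assumes I: "finite I" and R: "\<And>i. i \<in> I \<Longrightarrow> card {j \<in> I. \<nu> j = \<nu> i} \<le> R"
  shows "(LINT t|circ. (norm (\<Sum>i\<in>I. B i * cis (of_int (\<nu> i) * t)))\<^sup>2) \<le> real R * (\<Sum>i\<in>I. (norm (B i))\<^sup>2)"
proof -
  let ?S = "\<lambda>F. \<Sum>i\<in>I. \<Sum>j\<in>I. if \<nu> i = \<nu> j then (F i j :: real) else 0"
  have cnt: "?S (\<lambda>i j. (norm (B i))\<^sup>2) \<le> real R * (\<Sum>i\<in>I. (norm (B i))\<^sup>2)"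
  proof -
    have "(\<Sum>j\<in>I. if \<nu> i = \<nu> j then (norm (B i))\<^sup>2 else 0) \<le> real R * (norm (B i))\<^sup>2" if "i \<in> I" for i
    proof -
      have "(\<Sum>j\<in>I. if \<nu> i = \<nu> j then (norm (B i))\<^sup>2 else 0) = (\<Sum>j\<in>{j \<in> I. \<nu> j = \<nu> i}. (norm (B i))\<^sup>2)"
        using I by (intro sum.mono_neutral_cong_right) auto
      also have "\<dots> = real (card {j \<in> I. \<nu> j = \<nu> i}) * (norm (B i))\<^sup>2" by simp
      also have "\<dots> \<le> real R * (norm (B i))\<^sup>2" using R[OF that] by (intro mult_right_mono) auto
      finally show ?thesis .
    qed
    then show ?thesis unfolding sum_distrib_left by (rule sum_mono)
  qed
  have swap: "?S (\<lambda>i j. (norm (B j))\<^sup>2) = ?S (\<lambda>i j. (norm (B i))\<^sup>2)"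
    by (subst sum.swap) (intro sum.cong refl, auto)
  have "(LINT t|circ. (norm (\<Sum>i\<in>I. B i * cis (of_int (\<nu> i) * t)))\<^sup>2) = ?S (\<lambda>i j. Re (B i * cnj (B j)))"
    by (rule integral_circ_trig_poly_norm_sq[OF I])
  also have "\<dots> \<le> ?S (\<lambda>i j. (norm (B i))\<^sup>2 / 2 + (norm (B j))\<^sup>2 / 2)"
  proof (intro sum_mono)
    fix i j
    have "Re (B i * cnj (B j)) \<le> norm (B i * cnj (B j))" by (rule complex_Re_le_cmod)
    also have "\<dots> = norm (B i) * norm (B j)" by (simp add: norm_mult)
    also have "\<dots> \<le> (norm (B i))\<^sup>2 / 2 + (norm (B j))\<^sup>2 / 2"
      using sum_squares_bound[of "norm (B i)" "norm (B j)"] by simp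
    finally show "(if \<nu> i = \<nu> j then Re (B i * cnj (B j)) else 0)
       \<le> (if \<nu> i = \<nu> j then (norm (B i))\<^sup>2 / 2 + (norm (B j))\<^sup>2 / 2 else 0)" by simp
  qed
  also have "\<dots> = ?S (\<lambda>i j. (norm (B i))\<^sup>2) / 2 + ?S (\<lambda>i j. (norm (B j))\<^sup>2) / 2"
    unfolding sum_divide_distrib sum.distrib[symmetric] by (intro sum.cong refl) auto
  also have "\<dots> = ?S (\<lambda>i j. (norm (B i))\<^sup>2)" unfolding swap by simp
  finally show ?thesis using cnt by linarith
qed

text \<open>Below the threshold l, x^(2-q) is at most l^(2-q); above it, x^2 <= x^4 / l^2. With l
  chosen afterwards, this pointwise form replaces Hoelder's inequality between the exponents q and
  4.\<close>

lemma power2_le_powr_power4: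
  fixes x l q :: real
  assumes "0 \<le> x" "0 < l" "q \<le> 2"
  shows "x\<^sup>2 \<le> l powr (2 - q) * x powr q + x ^ 4 / l\<^sup>2"
proof (cases "x \<le> l")
  case True
  show ?thesis
  proof (cases "x = 0")
    case False
    then have "x\<^sup>2 = x powr (2 - q) * x powr q" using assms by (simp add: powr_add[symmetric] powr_numeral)
    also have "\<dots> \<le> l powr (2 - q) * x powr q"
      using True assms by (intro mult_right_mono powr_mono2) auto
    also have "\<dots> \<le> \<dots> + x ^ 4 / l\<^sup>2" by simp
    finally show ?thesis .
  qed simp
next
  case False
  then have "l\<^sup>2 \<le> x\<^sup>2" using assms by (intro power_mono) auto
  then have "x\<^sup>2 * l\<^sup>2 \<le> x\<^sup>2 * x\<^sup>2" by (intro mult_left_mono) auto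
  then have "x\<^sup>2 \<le> x ^ 4 / l\<^sup>2" using assms by (simp add: field_simps power2_eq_square power4_eq_xxxx)
  then show ?thesis using assms by (intro add_increasing) auto
qed

section \<open>Lacunary exponents: counting and lower bounds for means of order q\<close>

locale lacunary =
  fixes n :: "nat \<Rightarrow> nat" and lam :: real
  assumes lam: "lam > 1" and mono: "strict_mono n"
    and gap: "lam * real (n k) \<le> real (n (Suc k))"
begin

lemma n_inj: "inj n"
  using mono by (rule strict_mono_imp_inj_on)

lemma n_growth: "lam ^ d * real (n k) \<le> real (n (k + d))"
proof (induction d)
  case (Suc d)
  have "lam ^ Suc d * real (n k) = lam * (lam ^ d * real (n k))" by simp
  also have "\<dots> \<le> lam * real (n (k + d))" using Suc lam by (intro mult_left_mono) auto
  also have "\<dots> \<le> real (n (k + Suc d))" using gap[of "k + d"] by simp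
  finally show ?case .
qed simp

text \<open>Once lam^L > 2, L steps multiply a positive exponent by more than 2, so a window from
  m/2 to m holds at most L exponents. The window is chosen because the larger of two exponents with
  sum m lies in it.\<close>

lemma ex_count_bound:
  obtains L :: nat where "L > 0" "\<And>m. card {k. m \<le> 2 * n k \<and> n k \<le> m} \<le> L"
     "\<And>m. finite {k. m \<le> 2 * n k \<and> n k \<le> m}"
proof -
  obtain L where L: "2 < lam ^ L" using real_arch_pow[OF lam] by blast
  have "{k. m \<le> 2 * n k \<and> n k \<le> m} \<subseteq> {i..<i+L}"
     if i: "i = (LEAST k. m \<le> 2 * n k \<and> n k \<le> m)" for m i
  proof
    fix j assume j: "j \<in> {k. m \<le> 2 * n k \<and> n k \<le> m}"
    then have "i \<le> j" unfolding i by (intro Least_le) auto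
    have iP: "m \<le> 2 * n i \<and> n i \<le> m" unfolding i by (rule LeastI[of _ j]) (use j in auto)
    have "j < i + L"
    proof (rule ccontr)
      assume "\<not> j < i + L"
      then have ij: "i + L \<le> j" by simp
      have ni: "n i > 0"
      proof (rule ccontr)
        assume "\<not> n i > 0"
        then have "n i = n j" using iP j by simp
        then have "i = j" using mono by (simp add: strict_mono_eq)
        then have "L = 0" using ij by simp
        then show False using L by simp
      qed
      have "2 * real (n i) < lam ^ L * real (n i)" using L ni by simp
      also have "\<dots> \<le> real (n (i + L))" by (rule n_growth)
      also have "\<dots> \<le> real (n j)" using ij mono by (simp add: strict_mono_less_eq)
      also have "\<dots> \<le> 2 * real (n i)" using iP j by simp
      finally show False by simp
    qed
    with \<open>i \<le> j\<close> show "j \<in> {i..<i+L}" by simp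
  qed
  note sub = this[OF refl]
  have "L > 0" using L by (cases L) auto
  moreover have "card {k. m \<le> 2 * n k \<and> n k \<le> m} \<le> L" for m
    using card_mono[OF _ sub[of m]] by simp
  moreover have "finite {k. m \<le> 2 * n k \<and> n k \<le> m}" for m
    using finite_subset[OF sub[of m]] by simp
  ultimately show ?thesis using that by blast
qed

end

context lacunary
begin

text \<open>One entry of a pair with sum m lies in the window and determines the other. Each of the
  two positions for that entry contributes at most L pairs.\<close>

lemma card_pairs_le:
  assumes L: "\<And>m. card {k. m \<le> 2 * n k \<and> n k \<le> m} \<le> L" "\<And>m. finite {k. m \<le> 2 * n k \<and> n k \<le> m}"
    and I: "finite I"
  shows "card {x \<in> I \<times> I. n (fst x) + n (snd x) = m} \<le> 2 * L"
proof -
  let ?A = "{k. m \<le> 2 * n k \<and> n k \<le> m}" and ?S = "{x \<in> I \<times> I. n (fst x) + n (snd x) = m}"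
  have fS: "finite ?S" using I by simp
  have inj: "inj_on fst ?S" "inj_on snd ?S"
    by (auto simp: inj_on_def prod_eq_iff intro: injD[OF n_inj])
  have "card {x \<in> ?S. fst x \<in> ?A} \<le> L"
  proof -
    have "card (fst ` {x \<in> ?S. fst x \<in> ?A}) \<le> card ?A" by (rule card_mono[OF L(2)]) auto
    moreover have "inj_on fst {x \<in> ?S. fst x \<in> ?A}" using inj(1) by (rule inj_on_subset) auto
    ultimately show ?thesis using L(1)[of m] by (simp add: card_image)
  qed
  moreover have "card {x \<in> ?S. snd x \<in> ?A} \<le> L"
  proof -
    have "card (snd ` {x \<in> ?S. snd x \<in> ?A}) \<le> card ?A" by (rule card_mono[OF L(2)]) auto
    moreover have "inj_on snd {x \<in> ?S. snd x \<in> ?A}" using inj(2) by (rule inj_on_subset) auto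
    ultimately show ?thesis using L(1)[of m] by (simp add: card_image)
  qed
  moreover have "?S \<subseteq> {x \<in> ?S. fst x \<in> ?A} \<union> {x \<in> ?S. snd x \<in> ?A}" by auto
  then have "card ?S \<le> card ({x \<in> ?S. fst x \<in> ?A} \<union> {x \<in> ?S. snd x \<in> ?A})"
    by (intro card_mono finite_UnI finite_subset[OF _ fS]) auto
  moreover have "card ({x \<in> ?S. fst x \<in> ?A} \<union> {x \<in> ?S. snd x \<in> ?A})
      \<le> card {x \<in> ?S. fst x \<in> ?A} + card {x \<in> ?S. snd x \<in> ?A}" by (rule card_Un_le)
  ultimately show ?thesis by linarith
qed

text \<open>A sum of two frequencies determines them up to boundedly many choices, so the fourth moment
  is controlled by the square of the second; interpolating the second moment between the
  \<open>q\<close>-th and the fourth bounds the \<open>q\<close>-th from below.\<close>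
lemma ex_trig_poly_powr_ge:
  assumes q: "0 < q" "q \<le> 1"
  obtains c0 where "c0 > 0" "\<And>(b :: nat \<Rightarrow> complex) N k. k < N \<Longrightarrow> c0 * norm (b k) powr q
     \<le> (LINT t|circ. norm (\<Sum>j<N. b j * cis (of_int (int (n j)) * t)) powr q)"
proof -
  obtain L where L: "L > 0" "\<And>m. card {k. m \<le> 2 * n k \<and> n k \<le> m} \<le> L"
     "\<And>m. finite {k. m \<le> 2 * n k \<and> n k \<le> m}" using ex_count_bound by blast
  define K where "K = 2 * real L"
  have K: "K > 0" using L by (simp add: K_def)
  \<comment> \<open>The factor free of S that is left when S/2 <= (2 K S)^(1 - q/2) A, proved below,
    is solved for A.\<close>
  define c0 where "c0 = 1/2 * (2 * K) powr (q / 2 - 1)"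
  have c0: "c0 > 0" using K by (simp add: c0_def)
  have "c0 * norm (b k) powr q \<le> (LINT t|circ. norm (\<Sum>j<N. b j * cis (of_int (int (n j)) * t)) powr q)"
    if k: "k < N" for b :: "nat \<Rightarrow> complex" and N k
  proof -
    define P where "P = (\<lambda>t. \<Sum>j<N. b j * cis (of_int (int (n j)) * t))"
    have [measurable]: "P \<in> borel_measurable borel" unfolding P_def by measurable
    define S where "S = (\<Sum>j<N. (norm (b j))\<^sup>2)"
    define M where "M = (\<Sum>j<N. norm (b j))"
    have PM: "norm (P t) \<le> M" for t
      using norm_sum[of "\<lambda>j. b j * cis (of_int (int (n j)) * t)" "{..<N}"] by (simp add: P_def M_def norm_mult)
    have M0: "M \<ge> 0" by (auto simp: M_def intro: sum_nonneg)
    have bS: "(norm (b k))\<^sup>2 \<le> S"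
      unfolding S_def using k by (intro member_le_sum) auto
    show ?thesis
    proof (cases "b k = 0")
      case True
      then show ?thesis by (auto intro: Bochner_Integration.integral_nonneg)
    next
      case False
      then have S: "S > 0" using bS by (smt (verit) zero_less_norm_iff zero_less_power)
      have S_eq: "(LINT t|circ. (norm (P t))\<^sup>2) = S"
      proof -
        have "(LINT t|circ. (norm (P t))\<^sup>2)
           = (\<Sum>i<N. \<Sum>j<N. if int (n i) = int (n j) then Re (b i * cnj (b j)) else 0)"
          unfolding P_def by (rule integral_circ_trig_poly_norm_sq) simp
        also have "\<dots> = (\<Sum>i<N. \<Sum>j<N. if j = i then (norm (b i))\<^sup>2 else 0)"
        proof (intro sum.cong refl)
          fix i j
          have "int (n i) = int (n j) \<longleftrightarrow> j = i" using injD[OF n_inj, of i j] by auto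
          moreover have "Re (b i * cnj (b i)) = (norm (b i))\<^sup>2"
            by (simp only: cmod_power2) (simp add: power2_eq_square)
          ultimately show "(if int (n i) = int (n j) then Re (b i * cnj (b j)) else 0)
              = (if j = i then (norm (b i))\<^sup>2 else 0)" by simp
        qed
        also have "\<dots> = S" by (simp add: S_def)
        finally show ?thesis .
      qed
      have M4: "(LINT t|circ. norm (P t) ^ 4) \<le> K * S\<^sup>2"
      proof -
        let ?I = "{..<N} \<times> {..<N}"
        let ?B = "\<lambda>x. b (fst x) * b (snd x)" and ?\<nu> = "\<lambda>x. int (n (fst x) + n (snd x))"
        have P2: "(P t)\<^sup>2 = (\<Sum>x\<in>?I. ?B x * cis (of_int (?\<nu> x) * t))" for t
        proof -
          have "(P t)\<^sup>2 = (\<Sum>i<N. \<Sum>j<N. (b i * cis (of_int (int (n i)) * t)) * (b j * cis (of_int (int (n j)) * t)))"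
            by (simp add: P_def power2_eq_square sum_product)
          also have "\<dots> = (\<Sum>x\<in>?I. (b (fst x) * cis (of_int (int (n (fst x))) * t)) * (b (snd x) * cis (of_int (int (n (snd x))) * t)))"
            by (simp add: sum.cartesian_product split_def)
          also have "\<dots> = (\<Sum>x\<in>?I. ?B x * cis (of_int (?\<nu> x) * t))"
            by (intro sum.cong refl) (simp add: distrib_left distrib_right cis_mult[symmetric] mult_ac)
          finally show ?thesis .
        qed
        have "(LINT t|circ. norm (P t) ^ 4) = (LINT t|circ. (norm ((P t)\<^sup>2))\<^sup>2)"
          by (simp add: norm_power flip: power_mult)
        also have "\<dots> \<le> real (2 * L) * (\<Sum>x\<in>?I. (norm (?B x))\<^sup>2)"
          unfolding P2
        proof (rule integral_circ_trig_poly_norm_sq_le)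
          fix i
          show "card {j \<in> ?I. ?\<nu> j = ?\<nu> i} \<le> 2 * L"
            using card_pairs_le[OF L(2,3), of "{..<N}" "n (fst i) + n (snd i)"] by (simp only: of_nat_eq_iff finite_lessThan)
        qed simp
        also have "(\<Sum>x\<in>?I. (norm (?B x))\<^sup>2) = S\<^sup>2"
          by (simp add: S_def power2_eq_square sum_product sum.cartesian_product split_def norm_mult mult_ac)
        finally show ?thesis by (simp add: K_def)
      qed
      define A where "A = (LINT t|circ. norm (P t) powr q)"
      \<comment> \<open>This threshold makes the fourth-moment term K S^2 / l^2 equal to S/2, half
        of the second moment, so that it can be moved to the left-hand side.\<close>
      define l where "l = sqrt (2 * K * S)"
      have l: "l > 0" "l\<^sup>2 = 2 * K * S" using K S by (auto simp: l_def)
      have iq: "integrable circ (\<lambda>t. norm (P t) powr q)"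
        by (rule integrable_circ_bounded[of _ "M powr q"]) (use PM q in \<open>auto intro: powr_mono2\<close>)
      have ip: "integrable circ (\<lambda>t. norm (P t) ^ i)" for i
        by (rule integrable_circ_bounded[of _ "M ^ i"]) (use PM in \<open>auto intro: power_mono\<close>)
      have "S \<le> (LINT t|circ. l powr (2 - q) * norm (P t) powr q + norm (P t) ^ 4 / l\<^sup>2)"
        unfolding S_eq[symmetric]
      proof (rule integral_mono)
        show "(norm (P t))\<^sup>2 \<le> l powr (2 - q) * norm (P t) powr q + norm (P t) ^ 4 / l\<^sup>2" for t
          using q by (intro power2_le_powr_power4 l) auto
      qed (use iq ip in auto)
      also have "\<dots> = l powr (2 - q) * A + (LINT t|circ. norm (P t) ^ 4) / l\<^sup>2"
        using iq ip[of 4] by (simp add: A_def)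
      also have "\<dots> \<le> l powr (2 - q) * A + K * S\<^sup>2 / l\<^sup>2"
        using M4 by (intro add_left_mono divide_right_mono) auto
      also have "K * S\<^sup>2 / l\<^sup>2 = S / 2" unfolding l(2) using K S by (simp add: power2_eq_square)
      finally have A: "S / 2 \<le> l powr (2 - q) * A" by simp
      have "l = (2 * K * S) powr (1/2)" using K S by (simp add: l_def powr_half_sqrt)
      then have "l powr (2 - q) = (2 * K * S) powr (1/2 * (2 - q))" by (simp only: powr_powr)
      also have "1/2 * (2 - q) = 1 - q / 2" by simp
      finally have "l powr (2 - q) = (2 * K * S) powr (1 - q / 2)" .
      then have "S / 2 * (2 * K * S) powr (q / 2 - 1)
          \<le> (2 * K * S) powr (1 - q / 2) * A * (2 * K * S) powr (q / 2 - 1)"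
        using A by (intro mult_right_mono) auto
      also have "\<dots> = A * ((2 * K * S) powr (1 - q / 2) * (2 * K * S) powr (q / 2 - 1))" by simp
      also have "\<dots> = A" using K S by (simp only: powr_add[symmetric]) simp
      also have "S / 2 * (2 * K * S) powr (q / 2 - 1) = c0 * (S powr 1 * S powr (q / 2 - 1))"
        using K S by (simp add: c0_def powr_mult)
      also have "S powr 1 * S powr (q / 2 - 1) = S powr (q / 2)"
        by (simp only: powr_add[symmetric]) simp
      finally have "c0 * S powr (q / 2) \<le> A" .
      moreover have "norm (b k) powr q \<le> S powr (q / 2)"
      proof -
        have "(norm (b k))\<^sup>2 = norm (b k) powr 2" using False by simp
        then have "norm (b k) powr q = ((norm (b k))\<^sup>2) powr (q / 2)"
          by (simp only: powr_powr) simp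
        also have "\<dots> \<le> S powr (q / 2)" using bS q by (intro powr_mono2) auto
        finally show ?thesis .
      qed
      then have "c0 * norm (b k) powr q \<le> c0 * S powr (q / 2)" using c0 by (intro mult_left_mono) auto
      ultimately show ?thesis by (simp add: A_def P_def)
    qed
  qed
  with c0 show ?thesis using that by blast
qed

text \<open>The constant for polynomials does not depend on their length, so dominated convergence
  of the partial sums carries it over.\<close>

lemma ex_series_powr_ge:
  assumes q: "0 < q" "q \<le> 1"
  obtains c0 where "c0 > 0" "\<And>(b :: nat \<Rightarrow> complex) k. summable (\<lambda>j. norm (b j)) \<Longrightarrow> c0 * norm (b k) powr q
     \<le> (LINT t|circ. norm (\<Sum>j. b j * cis (of_int (int (n j)) * t)) powr q)"
proof -
  obtain c0 where c0: "c0 > 0" "\<And>(b :: nat \<Rightarrow> complex) N k. k < N \<Longrightarrow> c0 * norm (b k) powr q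
     \<le> (LINT t|circ. norm (\<Sum>j<N. b j * cis (of_int (int (n j)) * t)) powr q)"
    using ex_trig_poly_powr_ge[OF q] by blast
  have "c0 * norm (b k) powr q \<le> (LINT t|circ. norm (\<Sum>j. b j * cis (of_int (int (n j)) * t)) powr q)"
    if b: "summable (\<lambda>j. norm (b j))" for b :: "nat \<Rightarrow> complex" and k
  proof -
    define M where "M = (\<Sum>j. norm (b j))"
    have "(\<lambda>N. LINT t|circ. norm (\<Sum>j<N. b j * cis (of_int (int (n j)) * t)) powr q)
        \<longlonglongrightarrow> (LINT t|circ. norm (\<Sum>j. b j * cis (of_int (int (n j)) * t)) powr q)"
    proof (rule integral_dominated_convergence[where w = "\<lambda>_. M powr q"])
      show "integrable circ (\<lambda>_. M powr q)" by simp
      show "AE t in circ. (\<lambda>N. norm (\<Sum>j<N. b j * cis (of_int (int (n j)) * t)) powr q)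
          \<longlonglongrightarrow> norm (\<Sum>j. b j * cis (of_int (int (n j)) * t)) powr q"
      proof (rule AE_I2)
        fix t
        have "summable (\<lambda>j. b j * cis (of_int (int (n j)) * t))"
          by (rule summable_norm_cancel) (simp add: norm_mult b)
        then have "(\<lambda>N. \<Sum>j<N. b j * cis (of_int (int (n j)) * t)) \<longlonglongrightarrow> (\<Sum>j. b j * cis (of_int (int (n j)) * t))"
          by (rule summable_LIMSEQ)
        then show "(\<lambda>N. norm (\<Sum>j<N. b j * cis (of_int (int (n j)) * t)) powr q)
          \<longlonglongrightarrow> norm (\<Sum>j. b j * cis (of_int (int (n j)) * t)) powr q"
          using q by (intro tendsto_powr2 tendsto_norm tendsto_const) auto
      qed
      show "AE t in circ. norm (norm (\<Sum>j<N. b j * cis (of_int (int (n j)) * t)) powr q) \<le> M powr q" for N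
      proof (rule AE_I2)
        fix t
        have "norm (\<Sum>j<N. b j * cis (of_int (int (n j)) * t)) \<le> (\<Sum>j<N. norm (b j))"
          using norm_sum[of "\<lambda>j. b j * cis (of_int (int (n j)) * t)" "{..<N}"] by (simp add: norm_mult)
        also have "\<dots> \<le> M" unfolding M_def by (rule sum_le_suminf[OF b]) auto
        finally show "norm (norm (\<Sum>j<N. b j * cis (of_int (int (n j)) * t)) powr q) \<le> M powr q"
          using q by (auto intro: powr_mono2)
      qed
    qed auto
    then show ?thesis
      by (rule Lim_bounded2[where N = "Suc k"]) (use c0(2) in auto)
  qed
  with c0(1) show ?thesis using that by blast
qed

end

section \<open>Lacunary functions in the disc\<close>

text \<open>With j = m - 1 the right-hand side is the reciprocal of (1 + 1/j)^j <= e; for m = 1 it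
  is 0 ^ 0 = 1. On |z| = 1 - 1/n_k the power in the k-th term of g' therefore costs only a
  constant.\<close>

lemma one_minus_inverse_power_ge:
  assumes "m \<ge> 1"
  shows "exp (-1) \<le> (1 - 1 / real m) ^ (m - 1)"
proof (cases "m = 1")
  case False
  define j where "j = m - 1"
  have j: "j > 0" "m = Suc j" using assms False by (auto simp: j_def)
  have "(1 + 1 / real j) ^ j \<le> exp (1 / real j) ^ j"
    by (intro power_mono exp_ge_add_one_self) auto
  also have "\<dots> = exp 1" using j by (simp add: exp_of_nat_mult[symmetric])
  finally have "1 / exp 1 \<le> 1 / (1 + 1 / real j) ^ j"
    using j by (intro divide_left_mono) (auto intro!: mult_pos_pos zero_less_power add_pos_pos)
  also have "\<dots> = (1 - 1 / real m) ^ j"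
    using j by (simp add: power_one_over[symmetric] field_simps)
  finally show ?thesis by (simp add: exp_minus inverse_eq_divide j_def)
qed simp

locale lacunary_function = lacunary +
  fixes a :: "nat \<Rightarrow> complex" and g :: "complex \<Rightarrow> complex"
  assumes g_sums: "z \<in> unit_disc \<Longrightarrow> (\<lambda>k. a k * z ^ n k) sums g z"
begin

lemma summable_g: "norm z < 1 \<Longrightarrow> summable (\<lambda>k. a k * z ^ n k)"
  using g_sums[of z] by (auto simp: sums_iff)

text \<open>The termwise derivative of the gap series with coefficients |a_k| over the reals; it
  supplies absolute convergence for g'.\<close>

lemma summable_deriv_real:
  assumes "0 \<le> x" "x < 1"
  shows "summable (\<lambda>k. real (n k) * norm (a k) * x ^ (n k - 1))"
proof (rule summable_gap_termdiff[OF mono])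
  show "summable (\<lambda>k. norm (a k) * y ^ n k)" if "norm y < 1" for y :: real
  proof (rule summable_norm_cancel)
    have "summable (\<lambda>k. norm (a k * of_real y ^ n k))"
      by (rule summable_norm_gap_powser[OF mono summable_g]) (use that in auto)
    then show "summable (\<lambda>k. norm (norm (a k) * y ^ n k))" by (simp add: norm_mult norm_power abs_mult power_abs)
  qed
qed (use assms in auto)

lemma summable_deriv_norm:
  "norm z < 1 \<Longrightarrow> summable (\<lambda>k. norm (of_nat (n k) * a k * z ^ (n k - 1)))"
  using summable_deriv_real[of "norm z"] by (simp add: norm_mult norm_power)

lemma g_has_field_derivative:
  assumes z: "z \<in> unit_disc"
  shows "(g has_field_derivative (\<Sum>k. of_nat (n k) * a k * z ^ (n k - 1))) (at z)"
proof -
  have "((\<lambda>z. \<Sum>k. a k * z ^ n k) has_field_derivative (\<Sum>k. of_nat (n k) * a k * z ^ (n k - 1))) (at z)"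
    by (rule DERIV_gap_powser[OF mono summable_g]) (use z in auto)
  then show ?thesis
    by (rule has_field_derivative_transform_within_open[where S = unit_disc])
       (use z g_sums in \<open>auto simp: sums_iff\<close>)
qed

lemma deriv_g: "z \<in> unit_disc \<Longrightarrow> deriv g z = (\<Sum>k. of_nat (n k) * a k * z ^ (n k - 1))"
  by (rule DERIV_imp_deriv[OF g_has_field_derivative])

lemma g_holomorphic: "g holomorphic_on unit_disc"
  using g_has_field_derivative unfolding holomorphic_on_open[OF open_ball] by blast

text \<open>The factor \<open>cis t\<close> lifts the frequencies from n_k - 1 to the lacunary n_k.
  When n_k = 0 the truncated subtraction does no harm because the coefficient vanishes.\<close>

lemma deriv_g_rotate:
  assumes z: "z \<in> unit_disc"
  shows "cis t * deriv g (cis t * z)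
    = (\<Sum>k. (of_nat (n k) * a k * z ^ (n k - 1)) * cis (of_int (int (n k)) * t))"
proof -
  have "cis t * z \<in> unit_disc" using z by (simp add: norm_mult)
  then have "cis t * deriv g (cis t * z) = cis t * (\<Sum>k. of_nat (n k) * a k * (cis t * z) ^ (n k - 1))"
    by (simp add: deriv_g)
  also have "\<dots> = (\<Sum>k. cis t * (of_nat (n k) * a k * (cis t * z) ^ (n k - 1)))"
    by (rule suminf_mult[symmetric], rule summable_norm_cancel, rule summable_deriv_norm)
       (use z in \<open>simp add: norm_mult\<close>)
  also have "\<dots> = (\<Sum>k. (of_nat (n k) * a k * z ^ (n k - 1)) * cis (of_int (int (n k)) * t))"
  proof (rule suminf_cong)
    fix k
    show "cis t * (of_nat (n k) * a k * (cis t * z) ^ (n k - 1))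
        = (of_nat (n k) * a k * z ^ (n k - 1)) * cis (of_int (int (n k)) * t)"
    proof (cases "n k")
      case (Suc m)
      have "cis t * cis t ^ m = cis (of_int (int (n k)) * t)"
        unfolding power_Suc[symmetric] Complex.DeMoivre by (simp add: Suc cis_mult algebra_simps)
      then show ?thesis by (simp add: Suc power_mult_distrib mult_ac)
    qed simp
  qed
  finally show ?thesis .
qed

lemma rotation_average_powr_ge:
  assumes q: "0 < q" "q \<le> 1"
  obtains c0 where "c0 > 0" "\<And>z k. z \<in> unit_disc \<Longrightarrow>
    ennreal (c0 * (real (n k) * norm (a k) * norm z ^ (n k - 1)) powr q)
      \<le> (\<integral>\<^sup>+ t. ennreal (norm (deriv g (cis t * z)) powr q) \<partial>circ)"
proof -
  obtain c0 where c0: "c0 > 0" "\<And>(b :: nat \<Rightarrow> complex) k. summable (\<lambda>j. norm (b j)) \<Longrightarrow> c0 * norm (b k) powr q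
     \<le> (LINT t|circ. norm (\<Sum>j. b j * cis (of_int (int (n j)) * t)) powr q)"
    using ex_series_powr_ge[OF q] by blast
  have "ennreal (c0 * (real (n k) * norm (a k) * norm z ^ (n k - 1)) powr q)
      \<le> (\<integral>\<^sup>+ t. ennreal (norm (deriv g (cis t * z)) powr q) \<partial>circ)" if z: "z \<in> unit_disc" for z k
  proof -
    let ?b = "\<lambda>k. of_nat (n k) * a k * z ^ (n k - 1)"
    have b: "summable (\<lambda>k. norm (?b k))" using z by (intro summable_deriv_norm) auto
    have eq: "norm (\<Sum>j. ?b j * cis (of_int (int (n j)) * t)) powr q = norm (deriv g (cis t * z)) powr q" for t
      unfolding deriv_g_rotate[OF z, symmetric] by (simp add: norm_mult)
    have int: "integrable circ (\<lambda>t. norm (\<Sum>j. ?b j * cis (of_int (int (n j)) * t)) powr q)"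
    proof (rule integrable_circ_bounded[of _ "(\<Sum>j. norm (?b j)) powr q"])
      have [measurable]: "(\<lambda>t. \<Sum>j. ?b j * cis (of_int (int (n j)) * t)) \<in> borel_measurable borel"
        by (rule borel_measurable_cis_series)
      show "(\<lambda>t. norm (\<Sum>j. ?b j * cis (of_int (int (n j)) * t)) powr q) \<in> borel_measurable borel"
        by measurable
      show "norm (norm (\<Sum>j. ?b j * cis (of_int (int (n j)) * t)) powr q) \<le> (\<Sum>j. norm (?b j)) powr q" for t
        using norm_cis_series_le[OF b, of "\<lambda>j. int (n j)" t] q by (auto intro: powr_mono2)
    qed
    have "ennreal (c0 * norm (?b k) powr q)
        \<le> ennreal (LINT t|circ. norm (\<Sum>j. ?b j * cis (of_int (int (n j)) * t)) powr q)"
      by (intro ennreal_leI c0 b)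
    also have "\<dots> = (\<integral>\<^sup>+ t. ennreal (norm (\<Sum>j. ?b j * cis (of_int (int (n j)) * t)) powr q) \<partial>circ)"
      by (rule nn_integral_eq_integral[symmetric, OF int]) auto
    finally show ?thesis unfolding eq by (simp add: norm_mult norm_power)
  qed
  with c0(1) show ?thesis using that by blast
qed

text \<open>With m the exponent of index \<open>Suc k\<close>, 1 - |z| is here comparable to 1/m, so
  |z|^(m-1) is bounded below. The outer radius is tied to lam so that the gap condition keeps
  different annuli disjoint. The index is shifted because \<open>n 0\<close> may be 0.\<close>

definition annulus :: "nat \<Rightarrow> complex set" where
  "annulus k = ball 0 (1 - 1 / (lam * real (n (Suc k)))) - ball 0 (1 - 1 / real (n (Suc k)))"

lemma n_Suc_ge_1: "n (Suc k) \<ge> 1"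
  using strict_mono_less[OF mono, of 0 "Suc k"] by simp

text \<open>The area is pi (R - r)(R + r) with width R - r = (1 - 1/lam)/m. Bounding R + r through
  the outer radius, R >= 1 - 1/lam, covers m = 1 too, where the inner radius is 0.\<close>

lemma emeasure_annulus_ge: "ennreal (pi * (1 - 1 / lam)\<^sup>2 / real (n (Suc k))) \<le> emeasure lborel (annulus k)"
proof -
  define m where "m = real (n (Suc k))"
  define R where "R = 1 - 1 / (lam * m)"
  define r where "r = 1 - 1 / m"
  define \<delta> where "\<delta> = 1 - 1 / lam"
  have m: "m \<ge> 1" using n_Suc_ge_1[of k] by (simp add: m_def)
  have \<delta>: "\<delta> > 0" using lam by (simp add: \<delta>_def)
  have r0: "0 \<le> r" using m by (simp add: r_def)
  have Rr: "R - r = \<delta> / m" using lam m by (simp add: R_def r_def \<delta>_def field_simps)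
  have R\<delta>: "\<delta> \<le> R"
  proof -
    have "1 / (lam * m) \<le> 1 / lam" using lam m by (intro divide_left_mono) auto
    then show ?thesis by (simp add: R_def \<delta>_def)
  qed
  have rR: "r \<le> R" using Rr \<delta> m by (smt (verit) divide_nonneg_nonneg)
  have ball: "emeasure lborel (ball (0::complex) s) = ennreal (pi * s\<^sup>2)" if "s \<ge> 0" for s
    using that by (simp add: emeasure_ball unit_ball_vol_2)
  have "emeasure lborel (annulus k) = emeasure lborel (ball (0::complex) R) - emeasure lborel (ball (0::complex) r)"
    unfolding annulus_def R_def[symmetric, unfolded m_def] r_def[symmetric, unfolded m_def]
    by (intro emeasure_Diff) (use rR r0 ball in \<open>auto intro: subset_ball\<close>)
  also have "\<dots> = ennreal (pi * R\<^sup>2 - pi * r\<^sup>2)"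
    using rR r0 by (simp add: ball ennreal_minus)
  also have "ennreal (pi * \<delta>\<^sup>2 / m) \<le> ennreal (pi * R\<^sup>2 - pi * r\<^sup>2)"
  proof (rule ennreal_leI)
    have "pi * R\<^sup>2 - pi * r\<^sup>2 = pi * ((R - r) * (R + r))" by (simp add: power2_eq_square algebra_simps)
    also have "(R - r) * (R + r) \<ge> \<delta> / m * \<delta>"
      unfolding Rr using R\<delta> r0 \<delta> m by (intro mult_left_mono) auto
    then have "pi * ((R - r) * (R + r)) \<ge> pi * (\<delta> / m * \<delta>)" by (intro mult_left_mono) auto
    finally show "pi * \<delta>\<^sup>2 / m \<le> pi * R\<^sup>2 - pi * r\<^sup>2" by (simp add: power2_eq_square)
  qed
  finally show ?thesis by (simp add: m_def \<delta>_def)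
qed

lemma annulus_disjoint: "disjoint_family_on annulus I"
proof -
  have "annulus i \<inter> annulus j = {}" if "i < j" for i j
  proof -
    have "lam * real (n (Suc i)) \<le> real (n (Suc (Suc i)))" by (rule gap)
    also have "\<dots> \<le> real (n (Suc j))" using that mono by (simp add: strict_mono_less_eq)
    finally have "1 / real (n (Suc j)) \<le> 1 / (lam * real (n (Suc i)))"
      using lam n_Suc_ge_1[of i] n_Suc_ge_1[of j] by (intro divide_left_mono) auto
    then have "1 - 1 / (lam * real (n (Suc i))) \<le> 1 - 1 / real (n (Suc j))" by simp
    then show ?thesis unfolding annulus_def by auto
  qed
  then show ?thesis unfolding disjoint_family_on_def by (metis Int_commute linorder_neqE_nat)
qed

text \<open>On the annulus for m the weight gives m^(1-q) and the mean of |g'|^q gives m^q |a|^q up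
  to constants. The product m |a|^q meets an area of order 1/m, so each annulus contributes at least
  a constant times |a|^q, and disjointness lets these contributions be added.\<close>

lemma summable_coeff_powr:
  assumes q: "0 < q" "q \<le> 1" and g: "g \<in> Dp_space q"
  shows "summable (\<lambda>k. norm (a k) powr q)"
proof -
  obtain c0 where c0: "c0 > 0" "\<And>z k. z \<in> unit_disc \<Longrightarrow>
    ennreal (c0 * (real (n k) * norm (a k) * norm z ^ (n k - 1)) powr q)
      \<le> (\<integral>\<^sup>+ t. ennreal (norm (deriv g (cis t * z)) powr q) \<partial>circ)"
    using rotation_average_powr_ge[OF q] by blast
  define w where "w = (\<lambda>z. indicator unit_disc z * ennreal ((1 - norm z) powr (q - 1) * norm (deriv g z) powr q))"
  have [measurable]: "w \<in> borel_measurable borel"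
    unfolding w_def using measurable_indicator_continuous_on[OF open_ball continuous_on_weighted_deriv[OF g_holomorphic q(1)]] .
  define H where "H = (\<lambda>z. \<integral>\<^sup>+ t. w (cis t * z) \<partial>circ)"
  have fin: "(\<integral>\<^sup>+ z. w z \<partial>lborel) < \<infinity>" using g q by (simp add: Dp_space_iff w_def)
  have H: "(\<integral>\<^sup>+ z. H z \<partial>lborel) = (\<integral>\<^sup>+ z. w z \<partial>lborel)"
    unfolding H_def by (rule nn_integral_rotation_average[symmetric]) measurable
  have mH [measurable]: "H \<in> borel_measurable borel"
    unfolding H_def by measurable
  define c1 where "c1 = c0 * exp (-1) powr q * (pi * (1 - 1 / lam)\<^sup>2)"
  have c1: "c1 > 0" using c0 lam by (simp add: c1_def)
  have [measurable]: "annulus k \<in> sets borel" for k unfolding annulus_def by measurable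
  have lower: "ennreal (c1 * norm (a (Suc k)) powr q) \<le> (\<integral>\<^sup>+ z. indicator (annulus k) z * H z \<partial>lborel)" for k
  proof -
    define m where "m = real (n (Suc k))"
    define A where "A = norm (a (Suc k))"
    have m: "m \<ge> 1" using n_Suc_ge_1[of k] by (simp add: m_def)
    define B where "B = c0 * exp (-1) powr q * (m * A powr q)"
    have "ennreal B * indicator (annulus k) z \<le> indicator (annulus k) z * H z" for z
    proof (cases "z \<in> annulus k")
      case True
      then have z: "1 - 1 / m \<le> norm z" "norm z < 1 - 1 / (lam * m)" by (auto simp: annulus_def m_def)
      have "0 < 1 / (lam * m)" using lam m by auto
      with z have zd: "norm z < 1" by linarith
      have "exp (-1) \<le> (1 - 1 / m) ^ (n (Suc k) - 1)"
        unfolding m_def by (rule one_minus_inverse_power_ge[OF n_Suc_ge_1])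
      also have "\<dots> \<le> norm z ^ (n (Suc k) - 1)" using z m by (intro power_mono) auto
      finally have e: "exp (-1) \<le> norm z ^ (n (Suc k) - 1)" .
      have "exp (-1) powr q * (m powr q * A powr q) = (m * A * exp (-1)) powr q"
        using m by (simp add: powr_mult A_def mult_ac)
      also have "\<dots> \<le> (m * A * norm z ^ (n (Suc k) - 1)) powr q"
        using e m q by (intro powr_mono2 mult_left_mono) (auto simp: A_def)
      finally have 1: "c0 * (exp (-1) powr q * (m powr q * A powr q)) \<le> c0 * (m * A * norm z ^ (n (Suc k) - 1)) powr q"
        using c0 by (intro mult_left_mono) auto
      have 2: "(1 / m) powr (q - 1) \<le> (1 - norm z) powr (q - 1)"
        using z zd q by (intro powr_mono2') auto
      have "B = (1 / m) powr (q - 1) * (c0 * (exp (-1) powr q * (m powr q * A powr q)))"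
      proof -
        have "(1 / m) powr (q - 1) * m powr q = m powr (1 - q) * m powr q"
          using m powr_minus[of m "1 - q"] by (simp add: powr_divide divide_simps mult.commute)
        also have "\<dots> = m" using m by (simp add: powr_add[symmetric])
        finally show ?thesis by (simp add: B_def mult_ac)
      qed
      also have "\<dots> \<le> (1 - norm z) powr (q - 1) * (c0 * (m * A * norm z ^ (n (Suc k) - 1)) powr q)"
        using c0 by (intro mult_mono 1 2) auto
      finally have "ennreal B \<le> ennreal ((1 - norm z) powr (q - 1)) * ennreal (c0 * (m * A * norm z ^ (n (Suc k) - 1)) powr q)"
        using c0 by (subst ennreal_mult[symmetric]) (auto intro: ennreal_leI)
      also have "\<dots> \<le> ennreal ((1 - norm z) powr (q - 1)) * (\<integral>\<^sup>+ t. ennreal (norm (deriv g (cis t * z)) powr q) \<partial>circ)"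
        using c0(2)[of z "Suc k"] zd by (intro mult_left_mono) (auto simp: m_def A_def)
      also have "\<dots> = H z"
      proof -
        have "w (cis t * z) = ennreal ((1 - norm z) powr (q - 1)) * ennreal (norm (deriv g (cis t * z)) powr q)" for t
          using zd by (simp add: w_def norm_mult ennreal_mult)
        moreover have "(\<lambda>t. ennreal (norm (deriv g (cis t * z)) powr q)) \<in> borel_measurable borel"
        proof -
          have "continuous_on unit_disc (deriv g)"
            by (intro holomorphic_on_imp_continuous_on holomorphic_deriv g_holomorphic) auto
          then have "continuous_on UNIV (\<lambda>t. deriv g (cis t * z))"
            by (rule continuous_on_compose2) (use zd in \<open>auto intro!: continuous_intros simp: norm_mult cis_conv_exp\<close>)
          then have [measurable]: "(\<lambda>t. deriv g (cis t * z)) \<in> borel_measurable borel"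
            by (rule borel_measurable_continuous_onI)
          show ?thesis by measurable
        qed
        ultimately show ?thesis by (simp add: H_def nn_integral_cmult)
      qed
      finally show ?thesis using True by simp
    qed simp
    then have "(\<integral>\<^sup>+ z. ennreal B * indicator (annulus k) z \<partial>lborel) \<le> (\<integral>\<^sup>+ z. indicator (annulus k) z * H z \<partial>lborel)"
      by (rule nn_integral_mono)
    moreover have "(\<integral>\<^sup>+ z. ennreal B * indicator (annulus k) z \<partial>lborel) = ennreal B * emeasure lborel (annulus k)"
      by (rule nn_integral_cmult_indicator) auto
    moreover have "ennreal B * ennreal (pi * (1 - 1 / lam)\<^sup>2 / m) \<le> ennreal B * emeasure lborel (annulus k)"
      unfolding m_def by (rule mult_left_mono[OF emeasure_annulus_ge]) simp
    moreover have "ennreal B * ennreal (pi * (1 - 1 / lam)\<^sup>2 / m) = ennreal (c1 * A powr q)"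
      using m c0 by (subst ennreal_mult[symmetric]) (auto simp: B_def c1_def)
    ultimately show ?thesis by (simp add: A_def)
  qed
  define X where "X = enn2real (\<integral>\<^sup>+ z. w z \<partial>lborel)"
  have X: "(\<integral>\<^sup>+ z. w z \<partial>lborel) = ennreal X" using fin by (simp add: X_def)
  have bound: "(\<Sum>k<N. c1 * norm (a (Suc k)) powr q) \<le> X" for N
  proof -
    have "ennreal (\<Sum>k<N. c1 * norm (a (Suc k)) powr q) = (\<Sum>k<N. ennreal (c1 * norm (a (Suc k)) powr q))"
      using c1 by (subst sum_ennreal) auto
    also have "\<dots> \<le> (\<Sum>k<N. \<integral>\<^sup>+ z. indicator (annulus k) z * H z \<partial>lborel)"
      by (intro sum_mono lower)
    also have "\<dots> = (\<integral>\<^sup>+ z. (\<Sum>k<N. indicator (annulus k) z * H z) \<partial>lborel)"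
      by (rule nn_integral_sum[symmetric]) measurable
    also have "\<dots> \<le> (\<integral>\<^sup>+ z. H z \<partial>lborel)"
    proof (rule nn_integral_mono)
      fix z
      have "(\<Sum>k<N. indicator (annulus k) z * H z) = (\<Sum>k<N. indicator (annulus k) z) * H z"
        by (simp add: sum_distrib_right)
      also have "(\<Sum>k<N. indicator (annulus k) z :: ennreal) = indicator (\<Union>k<N. annulus k) z"
        by (rule indicator_UN_disjoint[symmetric]) (auto intro: annulus_disjoint)
      also have "\<dots> * H z \<le> 1 * H z" by (intro mult_right_mono) (auto split: split_indicator)
      finally show "(\<Sum>k<N. indicator (annulus k) z * H z) \<le> H z" by simp
    qed
    also have "\<dots> = ennreal X" unfolding H X ..
    finally show ?thesis by (simp add: X_def)
  qed
  have "summable (\<lambda>k. c1 * norm (a (Suc k)) powr q)"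
    by (rule bounded_imp_summable[of _ X])
       (use c1 bound[of "Suc _"] in \<open>auto simp: lessThan_Suc_atMost\<close>)
  then have "summable (\<lambda>k. norm (a (Suc k)) powr q)" using c1 by (simp add: summable_cmult_iff)
  then show ?thesis by (rule summable_Suc_iff[THEN iffD1])
qed

end

section \<open>Boundedness and the Carleson condition\<close>

lemma nn_integral_powr_Icc:
  fixes \<alpha> c :: real
  assumes "\<alpha> > -1" "c \<ge> 0"
  shows "(\<integral>\<^sup>+ x. indicator {0..c} x * ennreal (x powr \<alpha>) \<partial>lborel) = ennreal (c powr (\<alpha> + 1) / (\<alpha> + 1))"
proof -
  have "((\<lambda>x. indicator {0..c} x * x powr \<alpha>) has_integral (c powr (\<alpha> + 1) / (\<alpha> + 1))) UNIV"
    using has_integral_powr_from_0[OF assms]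
    by (subst (asm) has_integral_restrict_UNIV[symmetric])
       (auto elim!: has_integral_eq[rotated] simp: indicator_def)
  then have "(\<integral>\<^sup>+ x. ennreal (indicator {0..c} x * x powr \<alpha>) \<partial>lborel) = ennreal (c powr (\<alpha> + 1) / (\<alpha> + 1))"
    by (intro nn_integral_has_integral_lborel) auto
  moreover have "ennreal (indicator {0..c} x * x powr \<alpha>) = indicator {0..c} x * ennreal (x powr \<alpha>)" for x :: real
    by (auto split: split_indicator)
  ultimately show ?thesis by simp
qed

lemma nn_integral_one_minus_powr_Icc:
  fixes \<alpha> c :: real
  assumes "\<alpha> > -1" "c \<ge> 0"
  shows "(\<integral>\<^sup>+ x. indicator {1 - c..1} x * ennreal ((1 - x) powr \<alpha>) \<partial>lborel) = ennreal (c powr (\<alpha> + 1) / (\<alpha> + 1))"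
proof -
  have "(\<integral>\<^sup>+ x. indicator {1 - c..1} x * ennreal ((1 - x) powr \<alpha>) \<partial>lborel)
      = (\<integral>\<^sup>+ x. indicator {1 - c..1} (1 - x) * ennreal (x powr \<alpha>) \<partial>lborel)"
    by (subst nn_integral_real_affine[where c = "-1" and t = 1]) auto
  also have "\<dots> = (\<integral>\<^sup>+ x. indicator {0..c} x * ennreal (x powr \<alpha>) \<partial>lborel)"
    by (intro nn_integral_cong) (auto split: split_indicator)
  finally show ?thesis using nn_integral_powr_Icc[OF assms] by simp
qed

text \<open>Finite subadditivity passes to the limit; the right-hand side is taken in
  \<open>ennreal\<close> since it may be infinite.\<close>

lemma suminf_powr_le:
  fixes x :: "nat \<Rightarrow> real"
  assumes x: "\<And>k. 0 \<le> x k" "summable x" and q: "0 < q" "q \<le> 1"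
  shows "ennreal ((\<Sum>k. x k) powr q) \<le> (\<Sum>k. ennreal (x k powr q))"
proof (rule LIMSEQ_le_const2)
  show "(\<lambda>N. ennreal ((\<Sum>k<N. x k) powr q)) \<longlonglongrightarrow> ennreal ((\<Sum>k. x k) powr q)"
    using q x by (intro tendsto_ennrealI tendsto_powr2 summable_LIMSEQ tendsto_const) (auto intro!: always_eventually sum_nonneg)
  have fin: "(\<Sum>k<N. x k) powr q \<le> (\<Sum>k<N. x k powr q)" for N
  proof (induction N)
    case (Suc N)
    have "(\<Sum>k<Suc N. x k) powr q \<le> (\<Sum>k<N. x k) powr q + x N powr q"
      using x q by (auto intro!: powr_add_le sum_nonneg)
    then show ?case using Suc by simp
  qed simp
  have "ennreal ((\<Sum>k<N. x k) powr q) \<le> (\<Sum>k. ennreal (x k powr q))" for N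
  proof -
    have "ennreal ((\<Sum>k<N. x k) powr q) \<le> (\<Sum>k<N. ennreal (x k powr q))"
      using fin[of N] by (subst sum_ennreal) (auto intro: ennreal_leI)
    also have "\<dots> \<le> (\<Sum>k. ennreal (x k powr q))" by (rule sum_le_suminf) auto
    finally show ?thesis .
  qed
  then show "\<exists>N. \<forall>n\<ge>N. ennreal ((\<Sum>k<n. x k) powr q) \<le> (\<Sum>k. ennreal (x k powr q))" by blast
qed

text \<open>The angles that carry a fixed z != 0 into the box lie, modulo 2 pi, in one interval of
  length l, and three translates of it cover those in [-pi, pi]. The bound is the same for all z,
  which is why a finite measure with radial density is Carleson.\<close>

lemma rotation_average_carleson_box_le:
  assumes l: "0 < l" "l \<le> 2 * pi"
  shows "(\<integral>\<^sup>+ t. indicator (carleson_box \<theta> l) (cis t * z) \<partial>circ) \<le> ennreal (3 * l / (2 * pi))"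
proof (cases "z = 0")
  \<comment> \<open>The origin has no argument. It lies in the box only at depth 1, that is for l =
    2 pi, where the claimed bound exceeds 1.\<close>
  case True
  show ?thesis
  proof (cases "l = 2 * pi")
    case l2: True
    have "(\<integral>\<^sup>+ t. indicator (carleson_box \<theta> l) (cis t * z) \<partial>circ) \<le> (\<integral>\<^sup>+ t. 1 \<partial>circ)"
      by (intro nn_integral_mono) (auto split: split_indicator)
    also have "\<dots> = ennreal 1" by simp
    also have "\<dots> \<le> ennreal (3 * l / (2 * pi))" by (rule ennreal_leI) (simp add: l2)
    finally show ?thesis .
  next
    case False
    have "0 < 1 - l / (2 * pi)" using False l by (simp add: field_simps)
    then have "z \<notin> carleson_box \<theta> l" using True by (auto simp: carleson_box_def)
    then show ?thesis using True by simp
  qed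
next
  case False
  define s where "s = Arg (z * cis (- \<theta>))"
  have s: "\<bar>s\<bar> \<le> pi" using Arg_bounded[of "z * cis (- \<theta>)"] by (auto simp: s_def)
  have z: "z = of_real (norm z) * cis (\<theta> + s)"
  proof -
    have "z * cis (-\<theta>) = of_real (norm z) * cis s"
      using Arg_eq[of "z * cis (- \<theta>)"] False by (auto simp: s_def norm_mult cis_conv_exp)
    then have "z * cis (-\<theta>) * cis \<theta> = of_real (norm z) * cis (\<theta> + s)"
      by (simp add: cis_mult[symmetric] mult_ac)
    then show ?thesis by (simp add: mult.assoc cis_mult)
  qed
  define J where "J = (\<lambda>m::int. {2 * pi * m - s - l / 2 .. 2 * pi * m - s + l / 2})"
  have sub: "\<exists>m\<in>{-1, 0, 1}. t \<in> J m" if t: "\<bar>t\<bar> \<le> pi" and box: "cis t * z \<in> carleson_box \<theta> l" for t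
  proof -
    obtain r t' where rt: "cis t * z = of_real r * cis t'" "\<bar>t' - \<theta>\<bar> \<le> l / 2" "1 - l / (2 * pi) \<le> r"
      using box by (auto simp: carleson_box_def)
    have "l / (2 * pi) \<le> 1" using l by (simp add: field_simps)
    then have r0: "r \<ge> 0" using rt by linarith
    have "norm z = r" using arg_cong[OF rt(1), of norm] r0 by (simp add: norm_mult)
    moreover have "cis t * z = of_real (norm z) * cis (t + (\<theta> + s))"
      by (subst z) (simp add: cis_mult[symmetric] mult_ac)
    ultimately have "cis (t + (\<theta> + s)) = cis t'" using rt(1) False by auto
    then have "cis (t + (\<theta> + s)) / cis t' = 1" by simp
    then have "cis (t + (\<theta> + s) - t') = 1" by (simp add: cis_divide)
    then have "cos (t + (\<theta> + s) - t') = 1" by (simp add: complex_eq_iff)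
    then obtain m :: int where m: "t + (\<theta> + s) - t' = 2 * pi * m"
      using cos_one_2pi_int[of "t + (\<theta> + s) - t'"] by (auto simp: mult_ac)
    have tJ: "t \<in> J m" using m rt(2) unfolding J_def atLeastAtMost_iff abs_le_iff by linarith
    \<comment> \<open>The angles t, s and t' - \<theta> are each at most pi in absolute value, hence
      |m| <= 3/2.\<close>
    have "\<bar>2 * pi * m\<bar> \<le> 3 * pi"
      using m rt(2) s t l unfolding abs_le_iff by linarith
    then have "\<bar>real_of_int m\<bar> \<le> 3 / 2" by (simp add: abs_mult)
    then have "\<bar>m\<bar> \<le> 1" by linarith
    then have "m \<in> {-1, 0, 1}" by auto
    with tJ show ?thesis by blast
  qed
  have "(\<integral>\<^sup>+ t. indicator (carleson_box \<theta> l) (cis t * z) \<partial>circ)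
     = (\<integral>\<^sup>+ t. ennreal (indicator {-pi..pi} t / (2 * pi)) * indicator (carleson_box \<theta> l) (cis t * z) \<partial>lborel)"
    by (rule nn_integral_circ) measurable
  also have "\<dots> \<le> (\<integral>\<^sup>+ t. ennreal (1 / (2 * pi)) * (\<Sum>m\<in>{-1, 0, 1}. indicator (J m) t) \<partial>lborel)"
  proof (rule nn_integral_mono)
    fix t
    show "ennreal (indicator {-pi..pi} t / (2 * pi)) * indicator (carleson_box \<theta> l) (cis t * z)
       \<le> ennreal (1 / (2 * pi)) * (\<Sum>m\<in>{-1, 0, 1}. indicator (J m) t)"
    proof (cases "\<bar>t\<bar> \<le> pi \<and> cis t * z \<in> carleson_box \<theta> l")
      case True
      then obtain m where m: "m \<in> {-1, 0, 1}" "t \<in> J m" using sub by blast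
      have "(indicator (J m) t :: ennreal) \<le> (\<Sum>m\<in>{-1, 0, 1}. indicator (J m) t)"
        by (rule member_le_sum[OF m(1)]) auto
      then have "ennreal (1 / (2 * pi)) * 1 \<le> ennreal (1 / (2 * pi)) * (\<Sum>m\<in>{-1, 0, 1}. indicator (J m) t)"
        using m(2) by (intro mult_left_mono) auto
      then show ?thesis using True by (simp add: abs_le_iff)
    next
      case False
      then have "t \<notin> {-pi..pi} \<or> cis t * z \<notin> carleson_box \<theta> l" by (auto simp: abs_le_iff)
      then have "ennreal (indicator {-pi..pi} t / (2 * pi)) * indicator (carleson_box \<theta> l) (cis t * z) = 0" by auto
      then show ?thesis by (simp only: zero_le)
    qed
  qed
  also have "\<dots> = ennreal (1 / (2 * pi)) * (\<Sum>m\<in>{-1, 0, 1::int}. \<integral>\<^sup>+ t. indicator (J m) t \<partial>lborel)"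
    by (subst nn_integral_cmult) (auto simp: J_def nn_integral_add)
  also have "\<dots> = ennreal (1 / (2 * pi)) * ennreal (3 * l)"
  proof -
    have "(\<integral>\<^sup>+ t. indicator (J m) t \<partial>lborel) = ennreal l" for m
      using l by (simp add: J_def)
    then have "(\<Sum>m\<in>{-1, 0, 1::int}. \<integral>\<^sup>+ t. indicator (J m) t \<partial>lborel) = 3 * ennreal l"
      by simp
    also have "\<dots> = ennreal (3 * l)" using l by (simp add: ennreal_mult)
    finally show ?thesis by simp
  qed
  also have "\<dots> = ennreal (3 * l / (2 * pi))" using l by (subst ennreal_mult[symmetric]) auto
  finally show ?thesis .
qed

text \<open>A Beta integral, estimated by a split at s = 1 - 1/N. Below it (1-s)^(q-1) is at most
  N^(1-q), and the remaining power of s integrates to a quantity of order 1/N; above it the power of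
  s is at most 1 and (1-s)^(q-1) integrates to N^(-q)/q. The pieces give 2/q and 1/q, with no
  dependence on N.\<close>

lemma nn_integral_beta_le:
  fixes A q :: real
  assumes q: "0 < q" "q \<le> 1" and A: "A \<ge> 0"
  shows "(\<integral>\<^sup>+ s. indicator {0..1} s * ennreal ((real N * A * sqrt s ^ (N - 1)) powr q * (1 - s) powr (q - 1)) \<partial>lborel)
    \<le> ennreal (3 / q * A powr q)"
proof (cases "N = 0")
  case False
  define m where "m = real N"
  have m: "m \<ge> 1" using False by (simp add: m_def)
  define e where "e = (m - 1) * q / 2"
  have e: "e \<ge> 0" using m q by (simp add: e_def)
  have pt: "indicator {0..1} s * ennreal ((real N * A * sqrt s ^ (N - 1)) powr q * (1 - s) powr (q - 1))
     \<le> ennreal (A powr q * m) * (indicator {0..1} s * ennreal (s powr e))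
       + ennreal (A powr q * m powr q) * (indicator {1 - 1 / m..1} s * ennreal ((1 - s) powr (q - 1)))" for s
  proof (cases "0 \<le> s \<and> s \<le> 1")
    case True
    show ?thesis
    proof (cases "s < 1 - 1 / m")
      case False
      have "sqrt s ^ (N - 1) \<le> 1" using True by (intro power_le_one) auto
      then have "m * A * sqrt s ^ (N - 1) \<le> m * A * 1" using m A by (intro mult_left_mono) auto
      then have "(m * A * sqrt s ^ (N - 1)) powr q \<le> (m * A) powr q"
        using True m A q by (intro powr_mono2) auto
      also have "\<dots> = A powr q * m powr q" using m A by (simp add: powr_mult)
      finally have "(m * A * sqrt s ^ (N - 1)) powr q * (1 - s) powr (q - 1)
          \<le> (A powr q * m powr q) * (1 - s) powr (q - 1)" by (rule mult_right_mono) simp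
      from ennreal_leI[OF this] show ?thesis using True False
        by (simp add: m_def ennreal_mult add_increasing)
    next
      case s1: True
      \<comment> \<open>For N = 1 the identity below would fail at s = 0, where 0 ^ 0 = 1 but
        \<open>0 powr e\<close> is 0; the condition s < 1 - 1/m excludes this case.\<close>
      have N2: "N \<ge> 2"
      proof (rule ccontr)
        assume "\<not> N \<ge> 2" then have "N = 1" using False by simp
        then show False using s1 True by (simp add: m_def)
      qed
      have "(sqrt s ^ (N - 1)) powr q = s powr e"
      proof (cases "s = 0")
        case True
        then show ?thesis using N2 by simp
      next
        case False
        then have s0: "s > 0" using True by simp
        then have "sqrt s ^ (N - 1) = s powr (1/2 * real (N - 1))"
          by (simp add: powr_half_sqrt[symmetric] powr_realpow[symmetric] powr_powr)
        then have "(sqrt s ^ (N - 1)) powr q = s powr (1/2 * real (N - 1) * q)" by (simp add: powr_powr)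
        also have "1/2 * real (N - 1) * q = e" using N2 by (simp add: e_def m_def of_nat_diff)
        finally show ?thesis .
      qed
      then have 1: "(m * A * sqrt s ^ (N - 1)) powr q = A powr q * m powr q * s powr e"
        using m A True by (simp add: powr_mult mult_ac)
      have "(1 - s) powr (q - 1) \<le> (1 / m) powr (q - 1)"
        using s1 m q by (intro powr_mono2') auto
      also have "\<dots> = m powr (1 - q)" using m powr_minus[of m "q - 1"] by (simp add: powr_divide inverse_eq_divide)
      finally have "(m * A * sqrt s ^ (N - 1)) powr q * (1 - s) powr (q - 1)
         \<le> (A powr q * m powr q * s powr e) * m powr (1 - q)"
        unfolding 1 by (rule mult_left_mono) simp
      also have "\<dots> = A powr q * (m powr q * m powr (1 - q)) * s powr e" by (simp add: mult_ac)
      also have "m powr q * m powr (1 - q) = m" using m by (simp add: powr_add[symmetric])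
      finally have "(m * A * sqrt s ^ (N - 1)) powr q * (1 - s) powr (q - 1) \<le> (A powr q * m) * s powr e" .
      from ennreal_leI[OF this] show ?thesis using True m
        by (simp add: m_def[symmetric] ennreal_mult add_increasing2)
    qed
  qed (auto split: split_indicator)
  have "(\<integral>\<^sup>+ s. indicator {0..1} s * ennreal ((real N * A * sqrt s ^ (N - 1)) powr q * (1 - s) powr (q - 1)) \<partial>lborel)
    \<le> (\<integral>\<^sup>+ s. ennreal (A powr q * m) * (indicator {0..1} s * ennreal (s powr e))
       + ennreal (A powr q * m powr q) * (indicator {1 - 1 / m..1} s * ennreal ((1 - s) powr (q - 1))) \<partial>lborel)"
    by (rule nn_integral_mono[OF pt])
  also have "\<dots> = ennreal (A powr q * m) * (\<integral>\<^sup>+ s. indicator {0..1} s * ennreal (s powr e) \<partial>lborel)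
     + ennreal (A powr q * m powr q) * (\<integral>\<^sup>+ s. indicator {1 - 1 / m..1} s * ennreal ((1 - s) powr (q - 1)) \<partial>lborel)"
    by (simp add: nn_integral_add nn_integral_cmult)
  also have "\<dots> = ennreal (A powr q * m) * ennreal (1 / (e + 1))
     + ennreal (A powr q * m powr q) * ennreal ((1 / m) powr q / q)"
    using e q m by (simp add: nn_integral_powr_Icc nn_integral_one_minus_powr_Icc)
  also have "\<dots> = ennreal (A powr q * (m / (e + 1)) + A powr q * (1 / q))"
  proof -
    have "m powr q * (1 / m) powr q = 1" using m by (simp flip: powr_mult)
    then have "A powr q * m powr q * ((1 / m) powr q / q) = A powr q * (1 / q)" by (simp add: mult_ac)
    moreover have "ennreal (A powr q * m) * ennreal (1 / (e + 1)) = ennreal (A powr q * (m / (e + 1)))"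
      using m e by (subst ennreal_mult[symmetric]) auto
    moreover have "ennreal (A powr q * m powr q) * ennreal ((1 / m) powr q / q) = ennreal (A powr q * m powr q * ((1 / m) powr q / q))"
      using m q by (subst ennreal_mult[symmetric]) auto
    ultimately show ?thesis using m e q by (subst ennreal_plus) auto
  qed
  also have "\<dots> \<le> ennreal (3 / q * A powr q)"
  proof (rule ennreal_leI)
    have "2 * (e + 1) = m * q - q + 2" by (simp add: e_def left_diff_distrib)
    then have "m * q \<le> 2 * (e + 1)" using q by linarith
    then have "m / (e + 1) \<le> 2 / q" using e q by (simp add: field_simps)
    then have "A powr q * (m / (e + 1)) \<le> A powr q * (2 / q)" by (rule mult_left_mono) simp
    then show "A powr q * (m / (e + 1)) + A powr q * (1 / q) \<le> 3 / q * A powr q"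
      by (simp add: field_simps)
  qed
  finally show ?thesis .
qed simp

section \<open>From summable coefficients to boundedness and the Carleson condition\<close>

context lacunary_function
begin

text \<open>The terms tend to 0, so eventually |a_k| <= 1, and there |a_k| <= |a_k|^q.\<close>

lemma summable_coeff_of_powr:
  assumes q: "0 < q" "q \<le> 1" and s: "summable (\<lambda>k. norm (a k) powr q)"
  shows "summable (\<lambda>k. norm (a k))"
proof (rule summable_comparison_test_ev[OF _ s])
  have "eventually (\<lambda>k. norm (a k) powr q < 1) sequentially"
    using order_tendstoD(2)[OF summable_LIMSEQ_zero[OF s]] by simp
  then show "eventually (\<lambda>k. norm (norm (a k)) \<le> norm (a k) powr q) sequentially"
  proof eventually_elim
    case (elim k)
    show ?case
    proof (cases "a k = 0")
      case False
      have "norm (a k) \<le> 1"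
      proof (rule ccontr)
        assume "\<not> norm (a k) \<le> 1"
        then have "1 \<le> norm (a k) powr q" using q by (intro ge_one_powr_ge_zero) auto
        then show False using elim by simp
      qed
      then have "norm (a k) powr 1 \<le> norm (a k) powr q" using q by (intro powr_mono') auto
      then show ?thesis using False by simp
    qed simp
  qed
qed

lemma H_inf_of_summable:
  assumes s: "summable (\<lambda>k. norm (a k))"
  shows "g \<in> H_inf"
proof -
  have "norm (g z) \<le> (\<Sum>k. norm (a k))" if z: "z \<in> unit_disc" for z
  proof -
    have le: "norm (a k * z ^ n k) \<le> norm (a k)" for k
      using z mult_left_mono[OF power_le_one[of "norm z" "n k"], of "norm (a k)"]
      by (simp add: norm_mult norm_power)
    have sn: "summable (\<lambda>k. norm (a k * z ^ n k))"
      by (rule summable_comparison_test'[OF s, of 0]) (use le in simp)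
    have "norm (g z) \<le> (\<Sum>k. norm (a k * z ^ n k))"
      using g_sums[OF z] summable_norm[OF sn] by (simp add: sums_iff)
    also have "\<dots> \<le> (\<Sum>k. norm (a k))" by (rule suminf_le[OF le sn s])
    finally show ?thesis .
  qed
  then have "bounded (g ` unit_disc)" by (intro boundedI) auto
  then show ?thesis using g_holomorphic by (simp add: H_inf_def analytic_on_open)
qed

lemma carleson_of_summable:
  assumes q: "0 < q" "q \<le> 1" and s: "summable (\<lambda>k. norm (a k) powr q)"
  shows "carleson_measure (mu_gq g q)"
proof -
  have [measurable]: "unit_disc \<in> sets borel" by simp
  define v where "v = (\<lambda>k s. (real (n k) * norm (a k) * sqrt s ^ (n k - 1)) powr q * (1 - s) powr (q - 1))"
  have [measurable]: "v k \<in> borel_measurable borel" for k unfolding v_def by measurable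
  define \<rho> where "\<rho> = (\<lambda>z. indicator unit_disc z *
     ennreal (norm (deriv g z) powr q * (1 - (norm z)\<^sup>2) powr (q - 1) / pi))"
  have [measurable]: "\<rho> \<in> borel_measurable borel"
    unfolding \<rho>_def by (rule measurable_mu_gq_density[OF g_holomorphic q(1)])
  have mu: "mu_gq g q = density lborel \<rho>" by (simp add: mu_gq_eq \<rho>_def)
  have pt: "\<rho> z \<le> (\<Sum>k. indicator unit_disc z * ennreal (v k ((norm z)\<^sup>2)))" for z
  proof (cases "z \<in> unit_disc")
    case True
    let ?x = "\<lambda>k. real (n k) * norm (a k) * norm z ^ (n k - 1)"
    have sx: "summable ?x" using True by (intro summable_deriv_real) auto
    have "norm (deriv g z) \<le> (\<Sum>k. ?x k)"
      unfolding deriv_g[OF True]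
      using summable_norm[OF summable_deriv_norm[of z]] True by (simp add: norm_mult norm_power)
    then have "ennreal (norm (deriv g z) powr q) \<le> ennreal ((\<Sum>k. ?x k) powr q)"
      using q by (intro ennreal_leI powr_mono2) auto
    also have "\<dots> \<le> (\<Sum>k. ennreal (?x k powr q))"
      by (rule suminf_powr_le[OF _ sx q]) simp
    finally have 1: "ennreal (norm (deriv g z) powr q) \<le> (\<Sum>k. ennreal (?x k powr q))" .
    have "\<rho> z \<le> ennreal (norm (deriv g z) powr q * (1 - (norm z)\<^sup>2) powr (q - 1))"
    proof -
      have "x / pi \<le> x" if "x \<ge> 0" for x using that pi_gt3 by (simp add: divide_le_eq mult_le_cancel_left1)
      then show ?thesis using True by (auto simp: \<rho>_def intro!: ennreal_leI)
    qed
    also have "\<dots> = ennreal ((1 - (norm z)\<^sup>2) powr (q - 1)) * ennreal (norm (deriv g z) powr q)"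
      by (simp add: ennreal_mult mult.commute)
    also have "\<dots> \<le> ennreal ((1 - (norm z)\<^sup>2) powr (q - 1)) * (\<Sum>k. ennreal (?x k powr q))"
      by (rule mult_left_mono[OF 1]) simp
    also have "\<dots> = (\<Sum>k. indicator unit_disc z * ennreal (v k ((norm z)\<^sup>2)))"
      unfolding ennreal_suminf_cmult[symmetric] using True
      by (intro suminf_cong) (simp add: v_def ennreal_mult mult.commute)
    finally show ?thesis .
  qed (simp add: \<rho>_def)
  \<comment> \<open>The constant is 3/(2 pi) from the rotation average of the box, times pi from the
    radial integral, times 3/q from \<open>nn_integral_beta_le\<close>.\<close>
  define C where "C = 9 / (2 * q) * (\<Sum>k. norm (a k) powr q)"
  have "emeasure (mu_gq g q) (carleson_box \<theta> l) \<le> ennreal (C * l)" if l: "0 < l" "l \<le> 2 * pi" for \<theta> l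
  proof -
    have each: "(\<integral>\<^sup>+ z. indicator unit_disc z * ennreal (v k ((norm z)\<^sup>2)) * indicator (carleson_box \<theta> l) z \<partial>lborel)
        \<le> ennreal (9 / (2 * q) * l * norm (a k) powr q)" for k
    proof -
      have "(\<integral>\<^sup>+ z. indicator unit_disc z * ennreal (v k ((norm z)\<^sup>2)) * indicator (carleson_box \<theta> l) z \<partial>lborel)
        = (\<integral>\<^sup>+ z. \<integral>\<^sup>+ t. indicator unit_disc (cis t * z) * ennreal (v k ((norm (cis t * z))\<^sup>2))
             * indicator (carleson_box \<theta> l) (cis t * z) \<partial>circ \<partial>lborel)"
        by (rule nn_integral_rotation_average) measurable
      also have "\<dots> = (\<integral>\<^sup>+ z. indicator unit_disc z * ennreal (v k ((norm z)\<^sup>2))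
             * (\<integral>\<^sup>+ t. indicator (carleson_box \<theta> l) (cis t * z) \<partial>circ) \<partial>lborel)"
      \<comment> \<open>The modulus is invariant under rotation, so only the indicator of the box
        depends on t.\<close>
      proof (rule nn_integral_cong)
        fix z
        have "indicator unit_disc (cis t * z) * ennreal (v k ((norm (cis t * z))\<^sup>2)) * indicator (carleson_box \<theta> l) (cis t * z)
          = (indicator unit_disc z * ennreal (v k ((norm z)\<^sup>2))) * (indicator (carleson_box \<theta> l) (cis t * z) :: ennreal)" for t
          by (simp add: norm_mult indicator_def)
        then show "(\<integral>\<^sup>+ t. indicator unit_disc (cis t * z) * ennreal (v k ((norm (cis t * z))\<^sup>2))
             * indicator (carleson_box \<theta> l) (cis t * z) \<partial>circ)
           = indicator unit_disc z * ennreal (v k ((norm z)\<^sup>2))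
             * (\<integral>\<^sup>+ t. indicator (carleson_box \<theta> l) (cis t * z) \<partial>circ)"
          by (simp only:, intro nn_integral_cmult) measurable
      qed
      also have "\<dots> \<le> (\<integral>\<^sup>+ z. ennreal (3 * l / (2 * pi)) * (indicator unit_disc z * ennreal (v k ((norm z)\<^sup>2))) \<partial>lborel)"
        by (intro nn_integral_mono)
           (subst mult.commute, intro mult_right_mono rotation_average_carleson_box_le l zero_le)
      also have "\<dots> = ennreal (3 * l / (2 * pi)) * (\<integral>\<^sup>+ z. indicator unit_disc z * ennreal (v k ((norm z)\<^sup>2)) \<partial>lborel)"
        by (rule nn_integral_cmult) measurable
      also have "(\<integral>\<^sup>+ z. indicator unit_disc z * ennreal (v k ((norm z)\<^sup>2)) \<partial>lborel)
          = ennreal pi * (\<integral>\<^sup>+ s. indicator {0..1} s * ennreal (v k s) \<partial>lborel)"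
        by (rule nn_integral_radial) measurable
      also have "ennreal (3 * l / (2 * pi)) * \<dots> \<le> ennreal (3 * l / (2 * pi)) * (ennreal pi * ennreal (3 / q * norm (a k) powr q))"
        unfolding v_def by (intro mult_left_mono nn_integral_beta_le q) auto
      also have "\<dots> = ennreal (9 / (2 * q) * l * norm (a k) powr q)"
        using l q by (simp add: ennreal_mult[symmetric])
      finally show ?thesis .
    qed
    have "emeasure (mu_gq g q) (carleson_box \<theta> l) = (\<integral>\<^sup>+ z. \<rho> z * indicator (carleson_box \<theta> l) z \<partial>lborel)"
      unfolding mu by (subst emeasure_density) auto
    also have "\<dots> \<le> (\<integral>\<^sup>+ z. (\<Sum>k. indicator unit_disc z * ennreal (v k ((norm z)\<^sup>2)) * indicator (carleson_box \<theta> l) z) \<partial>lborel)"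
      unfolding ennreal_suminf_multc by (intro nn_integral_mono mult_right_mono pt) auto
    also have "\<dots> = (\<Sum>k. \<integral>\<^sup>+ z. indicator unit_disc z * ennreal (v k ((norm z)\<^sup>2)) * indicator (carleson_box \<theta> l) z \<partial>lborel)"
      by (rule nn_integral_suminf) measurable
    also have "\<dots> \<le> (\<Sum>k. ennreal (9 / (2 * q) * l * norm (a k) powr q))"
      by (rule suminf_le[OF each]) auto
    also have "\<dots> = ennreal (\<Sum>k. 9 / (2 * q) * l * norm (a k) powr q)"
      using l q by (intro suminf_ennreal2 summable_mult s) auto
    also have "(\<Sum>k. 9 / (2 * q) * l * norm (a k) powr q) = C * l"
      by (subst suminf_mult[OF s]) (simp add: C_def)
    finally show ?thesis .
  qed
  then show ?thesis unfolding carleson_measure_def by blast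
qed

end

section \<open>The logarithmic test function and the Fejer kernel\<close>

lemma Re_one_minus_pos: "z \<in> unit_disc \<Longrightarrow> 0 < Re (1 - z)"
  using complex_Re_le_cmod[of z] by simp

definition log_test :: "complex \<Rightarrow> complex" where
  "log_test z = - Ln (1 - z)"

lemma log_test_has_derivative:
  assumes "z \<in> unit_disc"
  shows "(log_test has_field_derivative 1 / (1 - z)) (at z)"
proof -
  have "1 - z \<notin> \<real>\<^sub>\<le>\<^sub>0" using Re_one_minus_pos[OF assms] by (auto simp: complex_nonpos_Reals_iff)
  then show ?thesis unfolding log_test_def
    by (auto intro!: derivative_eq_intros simp: divide_simps)
qed

lemma log_test_holomorphic: "log_test holomorphic_on unit_disc"
  using log_test_has_derivative unfolding holomorphic_on_open[OF open_ball] by blast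

lemma deriv_log_test: "z \<in> unit_disc \<Longrightarrow> deriv log_test z = 1 / (1 - z)"
  by (rule DERIV_imp_deriv[OF log_test_has_derivative])

lemma log_test_Bloch: "log_test \<in> Bloch"
proof -
  have "(1 - (norm z)\<^sup>2) * norm (deriv log_test z) \<le> 2" if z: "z \<in> unit_disc" for z
  proof -
    have "1 - norm z \<le> norm (1 - z)" using norm_triangle_ineq2[of 1 z] by simp
    then have "2 * (1 - norm z) \<le> 2 * norm (1 - z)" by (intro mult_left_mono) auto
    with one_minus_norm_sq_bounds(3)[OF z] have "1 - (norm z)\<^sup>2 \<le> 2 * norm (1 - z)"
      by (rule order_trans)
    moreover have "norm (1 - z) > 0" using Re_one_minus_pos[OF z] by auto
    ultimately show ?thesis by (simp add: deriv_log_test[OF z] norm_divide field_simps)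
  qed
  then show ?thesis using log_test_holomorphic unfolding Bloch_def analytic_on_open[OF open_ball] by blast
qed

text \<open>The integrand times 1 - |z|^2 is the Poisson kernel 2 Re (1/(1-w)) - 1 at w = e^(it) z,
  and the geometric series 1/(1-w) has mean 1.\<close>

lemma nn_integral_circ_poisson:
  assumes z: "z \<in> unit_disc"
  shows "(\<integral>\<^sup>+ t. ennreal ((norm (1 / (1 - cis t * z)))\<^sup>2) \<partial>circ) = ennreal (1 / (1 - (norm z)\<^sup>2))"
proof -
  define d where "d = 1 - (norm z)\<^sup>2"
  have d: "d > 0" using one_minus_norm_sq_bounds[OF z] by (simp add: d_def)
  have sm: "summable (\<lambda>k. norm (z ^ k))" using z by (simp add: norm_power)
  define G where "G = (\<lambda>t. \<Sum>k. z ^ k * cis (of_int (int k) * t))"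
  have G: "G t = 1 / (1 - cis t * z)" for t
  proof -
    have "z ^ k * cis (of_int (int k) * t) = (cis t * z) ^ k" for k
      by (simp add: power_mult_distrib Complex.DeMoivre mult_ac)
    then show ?thesis using suminf_geometric[of "cis t * z"] z by (simp add: G_def norm_mult)
  qed
  have mG [measurable]: "G \<in> borel_measurable borel"
    unfolding G_def by (rule borel_measurable_cis_series)
  have bG: "norm (G t) \<le> (\<Sum>k. norm (z ^ k))" for t
    unfolding G_def by (rule norm_cis_series_le[OF sm])
  have iG: "integrable circ G" by (rule integrable_circ_bounded[OF mG bG])
  have "(LINT t|circ. G t) = (\<Sum>k. if int k = 0 then z ^ k else 0)"
    unfolding G_def by (rule circ_integral_series[OF sm])
  also have "\<dots> = (\<Sum>k\<in>{0}. if int k = 0 then z ^ k else 0)" by (rule suminf_finite) auto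
  finally have int1: "(LINT t|circ. G t) = 1" by simp
  have P: "(norm (G t))\<^sup>2 = (2 * Re (G t) - 1) / d" for t
  proof -
    define w where "w = cis t * z"
    have w: "w \<in> unit_disc" "d = 1 - (norm w)\<^sup>2" using z by (auto simp: w_def d_def norm_mult)
    have n0: "norm (1 - w) > 0" using Re_one_minus_pos[OF w(1)] by auto
    have 1: "Re (1 / (1 - w)) = (1 - Re w) / (norm (1 - w))\<^sup>2"
      by (simp add: Re_divide cmod_power2)
    have "d = 2 * (1 - Re w) - (norm (1 - w))\<^sup>2"
      unfolding w(2) cmod_power2 by (simp add: power2_eq_square algebra_simps)
    then have "d * (1 / (norm (1 - w))\<^sup>2) = 2 * Re (1 / (1 - w)) - 1"
      using n0 unfolding 1 by (simp add: divide_simps)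
    then show ?thesis using d unfolding G w_def[symmetric] by (simp add: norm_divide power_divide field_simps)
  qed
  have iP: "integrable circ (\<lambda>t. (norm (G t))\<^sup>2)"
    by (rule integrable_circ_bounded[of _ "(\<Sum>k. norm (z ^ k))\<^sup>2"]) (use bG in \<open>auto intro: power_mono\<close>)
  have "(LINT t|circ. (norm (G t))\<^sup>2) = (LINT t|circ. (2 * Re (G t) - 1) / d)"
    by (rule Bochner_Integration.integral_cong[OF refl P])
  also have "\<dots> = (2 * Re (LINT t|circ. G t) - 1) / d"
    using iG by (simp add: measure_def)
  also have "\<dots> = 1 / d" unfolding int1 by simp
  finally show ?thesis
    using nn_integral_eq_integral[OF iP] by (simp add: G d_def)
qed

text \<open>With d = 1 - |z|^2, the circle mean of |1 - z|^(-p) is estimated from the second moment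
  1/d by splitting at the size d^(-1/2). The resulting d^(-p/2) is far from sharp for small p but
  sufficient: with the weight d^(p-1) it gives d^(p/2 - 1), which is integrable.\<close>

lemma log_test_Dp:
  assumes p: "0 < p" "p \<le> 1"
  shows "log_test \<in> Dp_space p"
proof -
  define w where "w = (\<lambda>z. indicator unit_disc z * ennreal ((1 - norm z) powr (p - 1) * norm (deriv log_test z) powr p))"
  have [measurable]: "w \<in> borel_measurable borel"
    unfolding w_def using measurable_indicator_continuous_on[OF open_ball continuous_on_weighted_deriv[OF log_test_holomorphic p(1)]] .
  have avg: "(\<integral>\<^sup>+ t. w (cis t * z) \<partial>circ)
      \<le> indicator unit_disc z * ennreal (4 * (1 - (norm z)\<^sup>2) powr (p / 2 - 1))" for z
  proof (cases "z \<in> unit_disc")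
    case True
    define d where "d = 1 - (norm z)\<^sup>2"
    have d: "d > 0" using one_minus_norm_sq_bounds[OF True] by (simp add: d_def)
    let ?x = "\<lambda>t. norm (1 / (1 - cis t * z))"
    have elem: "x powr p \<le> d powr (- p / 2) + d powr (1 - p / 2) * x\<^sup>2" if x: "x \<ge> 0" for x :: real
    proof (cases "x \<le> d powr (- 1 / 2)")
      case True
      then have "x powr p \<le> (d powr (- 1 / 2)) powr p" using x p by (intro powr_mono2) auto
      also have "\<dots> = d powr (- p / 2)" by (simp add: powr_powr)
      finally show ?thesis by (simp add: add_increasing2)
    next
      case False
      have dp: "d powr (- 1 / 2) > 0" using d by simp
      then have x0: "x > 0" using False by linarith
      have "x powr (p - 2) \<le> (d powr (- 1 / 2)) powr (p - 2)"
        using dp False p by (intro powr_mono2') auto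
      also have "\<dots> = d powr (- 1 / 2 * (p - 2))" by (rule powr_powr)
      also have "- 1 / 2 * (p - 2) = 1 - p / 2" by (simp add: field_simps)
      finally have "x powr (p - 2) * x\<^sup>2 \<le> d powr (1 - p / 2) * x\<^sup>2" by (rule mult_right_mono) simp
      moreover have "x powr (p - 2) * x\<^sup>2 = x powr p" using x0 by (simp add: powr_diff)
      ultimately show ?thesis by (simp add: add_increasing)
    qed
    have mx [measurable]: "?x \<in> borel_measurable borel" by measurable
    have "(\<integral>\<^sup>+ t. w (cis t * z) \<partial>circ)
       = (\<integral>\<^sup>+ t. ennreal ((1 - norm z) powr (p - 1)) * ennreal (?x t powr p) \<partial>circ)"
      using True by (intro nn_integral_cong) (simp add: w_def deriv_log_test norm_mult ennreal_mult)
    also have "\<dots> \<le> (\<integral>\<^sup>+ t. ennreal (2 * d powr (p - 1)) *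
        (ennreal (d powr (- p / 2)) + ennreal (d powr (1 - p / 2)) * ennreal ((?x t)\<^sup>2)) \<partial>circ)"
    proof (intro nn_integral_mono mult_mono)
      show "ennreal ((1 - norm z) powr (p - 1)) \<le> ennreal (2 * d powr (p - 1))"
        unfolding d_def by (intro ennreal_leI one_minus_norm_powr_le True p)
      fix t
      have "ennreal (?x t powr p) \<le> ennreal (d powr (- p / 2) + d powr (1 - p / 2) * (?x t)\<^sup>2)"
        by (intro ennreal_leI elem) simp
      then show "ennreal (?x t powr p) \<le> ennreal (d powr (- p / 2)) + ennreal (d powr (1 - p / 2)) * ennreal ((?x t)\<^sup>2)"
        by (simp add: ennreal_mult)
    qed auto
    also have "\<dots> = ennreal (2 * d powr (p - 1)) *
        (ennreal (d powr (- p / 2)) + ennreal (d powr (1 - p / 2)) * (\<integral>\<^sup>+ t. ennreal ((?x t)\<^sup>2) \<partial>circ))"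
      by (simp add: nn_integral_cmult nn_integral_add)
    also have "\<dots> = ennreal (2 * d powr (p - 1) * (d powr (- p / 2) + d powr (1 - p / 2) * (1 / d)))"
    proof -
      have "ennreal A * (ennreal B + ennreal C * ennreal E) = ennreal (A * (B + C * E))"
        if "0 \<le> A" "0 \<le> B" "0 \<le> C" "0 \<le> E" for A B C E :: real
        using that by (simp add: ennreal_mult)
      then show ?thesis unfolding nn_integral_circ_poisson[OF True] d_def[symmetric] using d by simp
    qed
    also have "2 * d powr (p - 1) * (d powr (- p / 2) + d powr (1 - p / 2) * (1 / d)) = 4 * d powr (p / 2 - 1)"
    proof -
      have "d powr (- 1) = 1 / d" using d by (simp add: powr_minus inverse_eq_divide)
      then have "d powr (1 - p / 2) * (1 / d) = d powr (1 - p / 2) * d powr (- 1)" by simp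
      also have "\<dots> = d powr (- p / 2)" by (simp only: powr_add[symmetric]) simp
      finally have "2 * d powr (p - 1) * (d powr (- p / 2) + d powr (1 - p / 2) * (1 / d))
         = 4 * (d powr (p - 1) * d powr (- p / 2))" by simp
      also have "d powr (p - 1) * d powr (- p / 2) = d powr (p / 2 - 1)"
        by (simp only: powr_add[symmetric]) (simp add: algebra_simps)
      finally show ?thesis .
    qed
    finally show ?thesis using True by (simp add: d_def)
  next
    case False
    then show ?thesis by (simp add: w_def norm_mult)
  qed
  have "(\<integral>\<^sup>+ z. w z \<partial>lborel) = (\<integral>\<^sup>+ z. \<integral>\<^sup>+ t. w (cis t * z) \<partial>circ \<partial>lborel)"
    by (rule nn_integral_rotation_average) measurable
  also have "\<dots> \<le> (\<integral>\<^sup>+ z. indicator unit_disc z * ennreal (4 * (1 - (norm z)\<^sup>2) powr (p / 2 - 1)) \<partial>lborel)"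
    by (rule nn_integral_mono[OF avg])
  also have "\<dots> = ennreal pi * (\<integral>\<^sup>+ s. indicator {0..1} s * ennreal (4 * (1 - s) powr (p / 2 - 1)) \<partial>lborel)"
    by (rule nn_integral_radial) measurable
  also have "(\<integral>\<^sup>+ s. indicator {0..1} s * ennreal (4 * (1 - s) powr (p / 2 - 1)) \<partial>lborel)
      = (\<integral>\<^sup>+ s. ennreal 4 * (indicator {1 - 1..1} s * ennreal ((1 - s) powr (p / 2 - 1))) \<partial>lborel)"
    by (intro nn_integral_cong) (auto simp: ennreal_mult split: split_indicator)
  also have "\<dots> = ennreal 4 * (\<integral>\<^sup>+ s. indicator {1 - 1..1} s * ennreal ((1 - s) powr (p / 2 - 1)) \<partial>lborel)"
    by (rule nn_integral_cmult) measurable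
  also have "(\<integral>\<^sup>+ s. indicator {1 - 1..1} s * ennreal ((1 - s) powr (p / 2 - 1)) \<partial>lborel)
      = ennreal (1 powr (p / 2 - 1 + 1) / (p / 2 - 1 + 1))"
    using p by (intro nn_integral_one_minus_powr_Icc) auto
  finally have "(\<integral>\<^sup>+ z. w z \<partial>lborel) < \<infinity>"
    by (rule order.strict_trans1) (simp add: ennreal_mult_less_top)
  then show ?thesis using p log_test_holomorphic by (simp add: Dp_space_iff w_def)
qed

text \<open>On this arc |1 - z| <= |t| + 1/m <= 2 m^(-1/4), so -ln |1 - z| is at least (ln m)/4 - ln
  2. The bound 256 = 2^8 is where ln 2 <= (ln m)/8.\<close>

lemma norm_log_test_ge:
  fixes m :: real
  assumes m: "m \<ge> 256" and t: "\<bar>t\<bar> \<le> m powr (- 1/4)"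
  shows "ln m / 8 \<le> norm (log_test (of_real (1 - 1 / m) * cis t))"
proof -
  let ?z = "of_real (1 - 1 / m) * cis t"
  have zd: "?z \<in> unit_disc" using m by (simp add: norm_mult del: of_real_diff)
  have nz: "1 - ?z \<noteq> 0" using Re_one_minus_pos[OF zd] by (metis less_irrefl zero_complex.sel(1))
  have "norm (1 - ?z) \<le> norm (1 - cis t) + norm (cis t - ?z)"
    using norm_triangle_ineq[of "1 - cis t" "cis t - ?z"] by simp
  also have "norm (1 - cis t) \<le> \<bar>t\<bar>"
  proof -
    have "norm (1 - cis t) = 2 * \<bar>sin (t / 2)\<bar>"
      by (subst norm_minus_commute) (simp add: dist_exp_i_1 cis_conv_exp)
    also have "\<dots> \<le> \<bar>t\<bar>" using abs_sin_x_le_abs_x[of "t / 2"] by simp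
    finally show ?thesis .
  qed
  also have "norm (cis t - ?z) = 1 / m"
  proof -
    have "cis t - ?z = of_real (1 / m) * cis t" by (simp add: algebra_simps)
    then show ?thesis using m by (simp add: norm_mult norm_divide)
  qed
  also have "1 / m \<le> m powr (- 1/4)"
    using m powr_mono[of "-1" "-1/4" m] by (simp add: powr_minus divide_simps)
  finally have le: "norm (1 - ?z) \<le> 2 * m powr (- 1/4)" using t by simp
  have "ln (norm (1 - ?z)) \<le> ln (2 * m powr (- 1/4))"
    using le nz m by (subst ln_le_cancel_iff) auto
  also have "\<dots> = ln 2 - ln m / 4" using m by (simp add: ln_mult ln_powr)
  also have "\<dots> \<le> - (ln m / 8)"
  proof -
    have "8 * ln 2 = ln ((2::real) ^ 8)" by (subst ln_realpow) auto
    also have "\<dots> \<le> ln m" using m by (subst ln_le_cancel_iff) auto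
    finally show ?thesis by simp
  qed
  finally have "ln m / 8 \<le> Re (log_test ?z)"
    using nz by (simp add: log_test_def del: of_real_diff)
  also have "\<dots> \<le> norm (log_test ?z)" by (rule complex_Re_le_cmod)
  finally show ?thesis .
qed

text \<open>The square form gives positivity and, by orthogonality, mean value 1. Expanded, the
  kernel has only frequencies i - j of absolute value below N, hence below a spectral gap of size
  N.\<close>

definition fejer :: "nat \<Rightarrow> real \<Rightarrow> real" where
  "fejer N t = (norm (\<Sum>j<N. cis (of_int (int j) * t)))\<^sup>2 / real N"

lemma fejer_nonneg: "0 \<le> fejer N t"
  by (simp add: fejer_def)

lemma borel_measurable_fejer [measurable]: "fejer N \<in> borel_measurable borel"
  unfolding fejer_def by measurable

lemma fejer_le_const: "fejer N t \<le> (real N)\<^sup>2 / real N"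
  unfolding fejer_def using norm_sum[of "\<lambda>j. cis (of_int (int j) * t)" "{..<N}"]
  by (intro divide_right_mono power_mono) auto

lemma fejer_eq:
  "complex_of_real (fejer N t) = (\<Sum>i<N. \<Sum>j<N. cis (of_int (int i - int j) * t)) / of_nat N"
proof -
  let ?D = "\<Sum>j<N. cis (of_int (int j) * t)"
  have "complex_of_real ((norm ?D)\<^sup>2) = ?D * cnj ?D" by (rule complex_norm_square)
  also have "\<dots> = (\<Sum>i<N. \<Sum>j<N. cis (of_int (int i) * t) * cis (- (of_int (int j) * t)))"
    by (simp add: sum_product cis_cnj)
  also have "\<dots> = (\<Sum>i<N. \<Sum>j<N. cis (of_int (int i - int j) * t))"
    by (intro sum.cong refl) (simp add: cis_mult algebra_simps)
  finally show ?thesis by (simp add: fejer_def)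
qed

text \<open>The sum is geometric; its numerator is at most 2 in modulus and its denominator at least
  2 |t| / pi.\<close>

lemma fejer_le:
  assumes t: "0 < \<bar>t\<bar>" "\<bar>t\<bar> \<le> pi"
  shows "fejer N t \<le> pi\<^sup>2 / (real N * t\<^sup>2)"
proof (cases "N = 0")
  case False
  have c1: "2 * \<bar>t\<bar> / pi \<le> norm (cis t - 1)" by (rule norm_cis_minus_one_ge[OF t(2)])
  moreover have "0 < 2 * \<bar>t\<bar> / pi" using t by simp
  ultimately have pos: "norm (cis t - 1) > 0" by linarith
  have "(\<Sum>j<N. cis (of_int (int j) * t)) = (\<Sum>j<N. cis t ^ j)"
    by (simp add: Complex.DeMoivre)
  also have "\<dots> = (cis t ^ N - 1) / (cis t - 1)" using pos by (intro geometric_sum) auto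
  finally have "norm (\<Sum>j<N. cis (of_int (int j) * t)) = norm (cis t ^ N - 1) / norm (cis t - 1)"
    by (simp add: norm_divide)
  also have "\<dots> \<le> 2 / (2 * \<bar>t\<bar> / pi)"
  proof (rule frac_le)
    show "norm (cis t ^ N - 1) \<le> 2"
      using norm_triangle_ineq4[of "cis t ^ N" 1] by (simp add: norm_power)
  qed (use c1 t in auto)
  also have "\<dots> = pi / \<bar>t\<bar>" by simp
  finally have "(norm (\<Sum>j<N. cis (of_int (int j) * t)))\<^sup>2 \<le> (pi / \<bar>t\<bar>)\<^sup>2" by (intro power_mono) auto
  then have "fejer N t \<le> (pi / \<bar>t\<bar>)\<^sup>2 / real N" unfolding fejer_def by (rule divide_right_mono) simp
  then show ?thesis by (simp add: power_divide mult.commute)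
qed (simp add: fejer_def)

lemma integrable_fejer: "integrable circ (fejer N)"
  by (rule integrable_circ_bounded[of _ "(real N)\<^sup>2 / real N"]) (use fejer_le_const fejer_nonneg in auto)

lemma integral_fejer:
  assumes "N > 0"
  shows "(LINT t|circ. fejer N t) = 1"
proof -
  have "(LINT t|circ. (norm (\<Sum>j<N. 1 * cis (of_int (int j) * t)))\<^sup>2)
     = (\<Sum>i<N. \<Sum>j<N. if int i = int j then Re (1 * cnj 1) else 0)"
    by (rule integral_circ_trig_poly_norm_sq) simp
  also have "\<dots> = real N" by simp
  finally show ?thesis using assms unfolding fejer_def by simp
qed

text \<open>Fejer's kernel of order below the spectral gap isolates one coefficient of a gap series and is
  concentrated near \<open>0\<close>, so smallness of the series near \<open>0\<close> makes the coefficient small.\<close>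
lemma gap_coefficient_le:
  fixes b :: "nat \<Rightarrow> complex" and m :: "nat \<Rightarrow> nat"
  assumes b: "summable (\<lambda>j. norm (b j))" and N: "N > 0"
    and gap: "\<And>j. j \<noteq> k \<Longrightarrow> int N \<le> \<bar>int (m j) - int (m k)\<bar>"
    and \<eta>: "\<eta> > 0" and M: "M1 \<ge> 0" "M2 \<ge> 0"
    and near: "\<And>t. \<bar>t\<bar> \<le> \<eta> \<Longrightarrow> norm (\<Sum>j. b j * cis (of_int (int (m j)) * t)) \<le> M1"
    and far: "\<And>t. norm (\<Sum>j. b j * cis (of_int (int (m j)) * t)) \<le> M2"
  shows "norm (b k) \<le> M1 + M2 * (pi\<^sup>2 / (real N * \<eta>\<^sup>2))"
proof -
  define G where "G = (\<lambda>t. \<Sum>j. b j * cis (of_int (int (m j)) * t))"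
  have [measurable]: "G \<in> borel_measurable borel"
    unfolding G_def by (rule borel_measurable_cis_series)
  have sm: "summable (\<lambda>j. b j * cis (of_int (int (m j)) * t))" for t
    by (rule summable_norm_cancel) (simp add: norm_mult b)
  have shift: "G t * cis (of_int i * t) = (\<Sum>j. b j * cis (of_int (int (m j) + i) * t))" for i t
    unfolding G_def suminf_mult2[OF sm]
    by (intro suminf_cong) (simp add: cis_mult algebra_simps)
  have ish: "integrable circ (\<lambda>t. G t * cis (of_int i * t))" for i
    by (rule integrable_circ_bounded[of _ M2]) (use far in \<open>auto simp: norm_mult G_def\<close>)
  \<comment> \<open>As |i - j| < N is below the distance from m k to every other frequency,
    frequency 0 occurs only for l = k and i = j. Averaging the N diagonal terms returns
    \<open>b k\<close>.\<close>
  have coeff: "(LINT t|circ. G t * cis (of_int (int i - int j - int (m k)) * t)) = (if i = j then b k else 0)"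
    if ij: "i < N" "j < N" for i j
  proof -
    let ?d = "\<lambda>l. int (m l) + (int i - int j - int (m k))"
    have z: "?d l \<noteq> 0" if "l \<noteq> k" for l
      using gap[OF that] ij by auto
    have "(LINT t|circ. G t * cis (of_int (int i - int j - int (m k)) * t)) = (\<Sum>l. if ?d l = 0 then b l else 0)"
      unfolding shift by (rule circ_integral_series[OF b])
    also have "\<dots> = (\<Sum>l\<in>{k}. if ?d l = 0 then b l else 0)"
      by (rule suminf_finite) (use z in auto)
    also have "\<dots> = (if i = j then b k else 0)" by simp
    finally show ?thesis .
  qed
  have eq: "G t * cis (of_int (- int (m k)) * t) * of_real (fejer N t)
     = (\<Sum>i<N. \<Sum>j<N. G t * cis (of_int (int i - int j - int (m k)) * t)) / of_nat N" for t
  proof -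
    have "cis (of_int (int i - int j - int (m k)) * t) = cis (of_int (- int (m k)) * t) * cis (of_int (int i - int j) * t)" for i j
      by (simp add: cis_mult algebra_simps)
    then show ?thesis unfolding fejer_eq by (simp add: sum_distrib_left mult.assoc)
  qed
  have "(LINT t|circ. G t * cis (of_int (- int (m k)) * t) * of_real (fejer N t))
     = (\<Sum>i<N. \<Sum>j<N. LINT t|circ. G t * cis (of_int (int i - int j - int (m k)) * t)) / of_nat N"
    unfolding eq by (simp add: Bochner_Integration.integral_sum Bochner_Integration.integrable_sum ish del: of_int_diff)
  also have "\<dots> = (\<Sum>i<N. \<Sum>j<N. if i = j then b k else 0) / of_nat N"
    by (intro arg_cong[where f = "\<lambda>x. x / of_nat N"] sum.cong refl coeff) auto
  also have "\<dots> = b k" using N by simp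
  finally have bk: "b k = (LINT t|circ. G t * cis (of_int (- int (m k)) * t) * of_real (fejer N t))" ..
  let ?c = "pi\<^sup>2 / (real N * \<eta>\<^sup>2)"
  have iGK: "integrable circ (\<lambda>t. norm (G t) * fejer N t)"
  proof (rule integrable_circ_bounded[of _ "M2 * ((real N)\<^sup>2 / real N)"])
    fix t
    have "norm (G t) * fejer N t \<le> M2 * ((real N)\<^sup>2 / real N)"
      using far fejer_nonneg M fejer_le_const unfolding G_def by (intro mult_mono)
    then show "norm (norm (G t) * fejer N t) \<le> M2 * ((real N)\<^sup>2 / real N)"
      using fejer_nonneg[of N t] by (simp add: abs_mult)
  qed measurable
  have "norm (b k) \<le> (LINT t|circ. norm (G t * cis (of_int (- int (m k)) * t) * of_real (fejer N t)))"
    unfolding bk by (rule integral_norm_bound)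
  also have "\<dots> = (LINT t|circ. norm (G t) * fejer N t)"
    using fejer_nonneg by (simp add: norm_mult)
  also have "\<dots> \<le> (LINT t|circ. M1 * fejer N t + M2 * ?c)"
  proof (rule integral_mono_AE)
    show "integrable circ (\<lambda>t. M1 * fejer N t + M2 * ?c)" using integrable_fejer by simp
    \<comment> \<open>The measure lives on [-pi, pi], which is where \<open>fejer_le\<close>
      holds.\<close>
    have "AE t in circ. \<bar>t\<bar> \<le> pi"
      unfolding circ_def by (subst AE_density) (auto split: split_indicator)
    then show "AE t in circ. norm (G t) * fejer N t \<le> M1 * fejer N t + M2 * ?c"
    proof eventually_elim
      case (elim t)
      show ?case
      proof (cases "\<bar>t\<bar> \<le> \<eta>")
        case True
        have "norm (G t) * fejer N t \<le> M1 * fejer N t"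
          using near[OF True] fejer_nonneg by (intro mult_right_mono) (auto simp: G_def)
        then show ?thesis using M by (simp add: add_increasing2)
      next
        case False
        then have "\<eta>\<^sup>2 \<le> t\<^sup>2" using \<eta> by (simp add: abs_le_square_iff[symmetric])
        have "fejer N t \<le> pi\<^sup>2 / (real N * t\<^sup>2)" using elim False \<eta> by (intro fejer_le) auto
        also have "\<dots> \<le> ?c" using N \<eta> \<open>\<eta>\<^sup>2 \<le> t\<^sup>2\<close> False
          by (intro divide_left_mono mult_left_mono) auto
        finally have "norm (G t) * fejer N t \<le> M2 * ?c"
          using far[of t] fejer_nonneg M by (intro mult_mono) (auto simp: G_def)
        then show ?thesis using M fejer_nonneg[of N t] by (simp add: add_increasing)
      qed
    qed
  qed (rule iGK)
  also have "\<dots> = M1 + M2 * ?c"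
    using integrable_fejer by (simp add: integral_fejer[OF N] measure_def)
  finally show ?thesis .
qed

section \<open>The logarithmic Bloch condition\<close>

text \<open>With w the square root of y m, ln (1/y) = ln m + 2 ln (1/w): the decay of \<alpha>
  absorbs ln m, and ln (1/w) <= 1/w. The square root is essential. The product
  \<open>w\<^sup>2 * (1 + 2 / w)\<close> still vanishes at w = 0, as summation over k requires,
  whereas the same estimate in the variable y m would leave a constant.\<close>

lemma log_weighted_term_le:
  fixes y \<alpha> A C :: real
  assumes y: "0 < y" "y \<le> 1" and m: "m \<ge> 1" and \<alpha>: "0 \<le> \<alpha>" "\<alpha> \<le> A" "\<alpha> * ln (real m) \<le> C"
    and C: "C \<ge> 0"
  defines "w \<equiv> sqrt (y * real m)"
  shows "y * (real m * \<alpha> * (1 - y) ^ (m - 1)) * (1 + ln (1 / y)) \<le> 2 * exp 4 * (A + C) * (w / (1 + w)\<^sup>2)"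
proof -
  have m0: "real m > 0" using m by simp
  have w: "w > 0" "w\<^sup>2 = y * real m" using y m0 by (auto simp: w_def)
  have A: "A \<ge> 0" using \<alpha> by simp
  have "1 + ln (1 / y) = 1 + ln (real m) + 2 * ln (1 / w)"
  proof -
    have "ln (w\<^sup>2) = ln y + ln (real m)" unfolding w(2) using y m0 by (intro ln_mult_pos)
    moreover have "ln (w\<^sup>2) = 2 * ln w" using w(1) by (subst ln_realpow) auto
    ultimately show ?thesis using y w by (simp add: ln_div)
  qed
  also have "ln (1 / w) \<le> 1 / w - 1" using w by (intro ln_le_minus_one) auto
  finally have 1: "1 + ln (1 / y) \<le> 1 + ln (real m) + 2 / w" by simp
  have "\<alpha> * (1 + ln (1 / y)) \<le> \<alpha> * (1 + ln (real m) + 2 / w)"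
    using \<alpha> by (intro mult_left_mono 1)
  also have "\<dots> = \<alpha> + \<alpha> * ln (real m) + \<alpha> * (2 / w)" by (simp add: distrib_left)
  also have "\<dots> \<le> A + C + A * (2 / w)"
    using \<alpha> w by (intro add_mono mult_right_mono) auto
  also have "\<dots> \<le> A + C + (A + C) * (2 / w)"
    using C w by (intro add_left_mono mult_right_mono) auto
  also have "A + C + (A + C) * (2 / w) = (A + C) * (1 + 2 / w)" by (simp only: distrib_left mult_1_right)
  finally have 2: "\<alpha> * (1 + ln (1 / y)) \<le> (A + C) * (1 + 2 / w)" .
  \<comment> \<open>The exponent m - 1 instead of m costs a factor e^y, at most e.\<close>
  have "(1 - y) ^ (m - 1) \<le> exp (- y) ^ (m - 1)"
    using y exp_ge_add_one_self[of "- y"] by (intro power_mono) auto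
  also have "\<dots> = exp (- (y * real (m - 1)))" by (simp add: exp_of_nat_mult[symmetric] mult.commute)
  also have "\<dots> \<le> exp (1 - w\<^sup>2)"
    using m y by (simp add: w(2) of_nat_diff algebra_simps)
  finally have 3: "(1 - y) ^ (m - 1) \<le> exp (1 - w\<^sup>2)" .
  \<comment> \<open>The polynomial (w+2)(1+w)^2 is at most 2 (1+w)^3 <= 2 e^(3w), and 3w + 1 - w^2 =
    13/4 - (w - 3/2)^2 is below 4.\<close>
  have 4: "w * (w + 2) * exp (1 - w\<^sup>2) \<le> 2 * exp 4 * (w / (1 + w)\<^sup>2)"
  proof -
    have "(w + 2) * (1 + w)\<^sup>2 \<le> 2 * (1 + w) * (1 + w)\<^sup>2"
      using w by (intro mult_right_mono) auto
    also have "\<dots> = 2 * (1 + w) ^ 3" by (simp add: power2_eq_square power3_eq_cube)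
    also have "\<dots> \<le> 2 * exp w ^ 3"
      using w exp_ge_add_one_self[of w] by (intro mult_left_mono power_mono) auto
    also have "\<dots> = 2 * exp (3 * w)" by (simp add: exp_of_nat_mult[symmetric])
    finally have "(w + 2) * (1 + w)\<^sup>2 * exp (1 - w\<^sup>2) \<le> 2 * exp (3 * w) * exp (1 - w\<^sup>2)"
      by (rule mult_right_mono) simp
    also have "\<dots> = 2 * exp (3 * w + (1 - w\<^sup>2))" by (simp only: exp_add mult.assoc)
    also have "\<dots> \<le> 2 * exp 4"
    proof -
      have "0 \<le> (w - 3/2)\<^sup>2" by simp
      then have "3 * w + (1 - w\<^sup>2) \<le> 4" by (simp add: power2_eq_square algebra_simps)
      then show ?thesis by simp
    qed
    finally have "(w + 2) * (1 + w)\<^sup>2 * exp (1 - w\<^sup>2) \<le> 2 * exp 4" .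
    then have "w * ((w + 2) * (1 + w)\<^sup>2 * exp (1 - w\<^sup>2)) \<le> w * (2 * exp 4)"
      using w by (intro mult_left_mono) auto
    moreover have "(1 + w)\<^sup>2 > 0" using w by simp
    ultimately show ?thesis by (simp add: pos_le_divide_eq mult_ac)
  qed
  have "y * (real m * \<alpha> * (1 - y) ^ (m - 1)) * (1 + ln (1 / y))
      = w\<^sup>2 * (1 - y) ^ (m - 1) * (\<alpha> * (1 + ln (1 / y)))"
    unfolding w(2) by (simp only: mult_ac)
  also have "\<dots> \<le> w\<^sup>2 * (1 - y) ^ (m - 1) * ((A + C) * (1 + 2 / w))"
    using y by (intro mult_left_mono 2) auto
  also have "\<dots> \<le> w\<^sup>2 * exp (1 - w\<^sup>2) * ((A + C) * (1 + 2 / w))"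
    using A C w(1) by (intro mult_right_mono mult_left_mono 3) auto
  also have "\<dots> = (A + C) * (w * (w + 2) * exp (1 - w\<^sup>2))"
    using w(1) by (simp add: field_simps power2_eq_square)
  also have "\<dots> \<le> (A + C) * (2 * exp 4 * (w / (1 + w)\<^sup>2))"
    using A C by (intro mult_left_mono 4) auto
  finally show ?thesis by (simp add: mult_ac)
qed

lemma ln_le_2_sqrt:
  fixes x :: real
  assumes "x > 0"
  shows "ln x \<le> 2 * sqrt x"
proof -
  have "ln x = 2 * ln (sqrt x)" using assms by (simp add: ln_sqrt)
  also have "ln (sqrt x) \<le> sqrt x" using assms ln_le_minus_one[of "sqrt x"] by simp
  finally show ?thesis by simp
qed

section \<open>Logarithmic decay of the coefficients and its equivalence with the growth of
  g'\<close>

context lacunary_function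
begin

text \<open>Below n_k the ratio 1/lam leaves at least the fraction 1 - 1/lam of n_k; above it the
  gap is at least (lam - 1) n_k, which is larger.\<close>

lemma relative_gap:
  assumes "j \<noteq> k"
  shows "(1 - 1 / lam) * real (n k) \<le> \<bar>real (n j) - real (n k)\<bar>"
proof (cases "k < j")
  case True
  have "lam * real (n k) \<le> real (n (Suc k))" by (rule gap)
  also have "\<dots> \<le> real (n j)" using True mono by (simp add: strict_mono_less_eq)
  finally have 1: "(lam - 1) * real (n k) \<le> real (n j) - real (n k)" by (simp add: algebra_simps)
  have "1 - 1 / lam \<le> lam - 1"
  proof -
    have "0 \<le> (lam - 1)\<^sup>2 / lam" using lam by simp
    also have "\<dots> = (lam - 1) - (1 - 1 / lam)" using lam by (simp add: field_simps power2_eq_square)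
    finally show ?thesis by simp
  qed
  then have "(1 - 1 / lam) * real (n k) \<le> (lam - 1) * real (n k)" by (rule mult_right_mono) simp
  with 1 show ?thesis by linarith
next
  case False
  then have jk: "j < k" using assms by simp
  have "lam * real (n j) \<le> real (n (Suc j))" by (rule gap)
  also have "\<dots> \<le> real (n k)" using jk mono by (simp add: strict_mono_less_eq)
  finally have "real (n j) \<le> real (n k) / lam" using lam by (simp add: field_simps)
  then have "(1 - 1 / lam) * real (n k) \<le> real (n k) - real (n j)" by (simp add: left_diff_distrib)
  then show ?thesis by linarith
qed

lemma coeff_log_bound:
  assumes E: "\<And>z. z \<in> unit_disc \<Longrightarrow> (1 - (norm z)\<^sup>2) * (norm (log_test z) * norm (deriv g z)) \<le> E"
    and B: "\<And>z. z \<in> unit_disc \<Longrightarrow> (1 - (norm z)\<^sup>2) * norm (deriv g z) \<le> B"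
    and A: "\<And>k. norm (a k) \<le> A"
  obtains C where "C \<ge> 0" "\<And>k. norm (a k) * ln (real (n k)) \<le> C"
proof -
  define \<delta> where "\<delta> = 1 - 1 / lam"
  have \<delta>: "\<delta> > 0" using lam by (simp add: \<delta>_def)
  have E0: "E \<ge> 0" using E[of 0] by (rule order_trans[rotated]) auto
  have B0: "B \<ge> 0" using B[of 0] by (rule order_trans[rotated]) auto
  have A0: "A \<ge> 0" by (rule order_trans[OF norm_ge_zero A])
  define C where "C = A * ln 256 + exp 1 * (8 * E + 2 * B * pi\<^sup>2 / \<delta>)"
  have C1: "0 \<le> A * ln 256" using A0 by simp
  have C2: "0 \<le> exp 1 * (8 * E + 2 * B * pi\<^sup>2 / \<delta>)" using E0 B0 \<delta> by (intro mult_nonneg_nonneg add_nonneg_nonneg) auto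
  have "norm (a k) * ln (real (n k)) \<le> C" for k
  proof (cases "n k \<ge> 256")
    case False
    have "ln (real (n k)) \<le> ln 256"
      using False by (cases "n k = 0") (auto intro: ln_mono)
    then have "norm (a k) * ln (real (n k)) \<le> norm (a k) * ln 256" by (rule mult_left_mono) simp
    also have "\<dots> \<le> A * ln 256" by (intro mult_right_mono A) simp
    finally show ?thesis using C2 by (simp add: C_def)
  next
    case True
    define m where "m = real (n k)"
    have m: "m \<ge> 256" using True by (simp add: m_def)
    have lnm: "ln m > 0" using m by simp
    define r where "r = 1 - 1 / m"
    have r: "0 < r" "r < 1" using m by (auto simp: r_def)
    define b where "b = (\<lambda>j. of_nat (n j) * a j * (of_real r :: complex) ^ (n j - 1))"
    have b: "summable (\<lambda>j. norm (b j))" unfolding b_def using r by (intro summable_deriv_norm) auto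
    define G where "G = (\<lambda>t. \<Sum>j. b j * cis (of_int (int (n j)) * t))"
    define z where "z = (\<lambda>t. complex_of_real r * cis t)"
    have zd: "z t \<in> unit_disc" and nz: "norm (z t) = r" for t using r by (auto simp: z_def norm_mult)
    have nG: "norm (G t) = norm (deriv g (z t))" for t
    proof -
      have "G t = cis t * deriv g (cis t * of_real r)"
        unfolding G_def b_def by (rule deriv_g_rotate[symmetric]) (use r in auto)
      then show ?thesis by (simp add: norm_mult z_def mult.commute)
    qed
    have w: "1 / m \<le> 1 - r\<^sup>2"
      using one_minus_norm_sq_bounds(2)[OF zd[of 0]] by (simp add: nz r_def)
    \<comment> \<open>Rounding \<delta> m up still leaves N no larger than any of the gaps, since
      these are integers that are at least \<delta> m.\<close>
    define N where "N = nat \<lceil>\<delta> * m\<rceil>"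
    have N: "N > 0" "\<delta> * m \<le> real N" using \<delta> m by (auto simp: N_def)
    have gapN: "int N \<le> \<bar>int (n j) - int (n k)\<bar>" if "j \<noteq> k" for j
    proof -
      have "\<delta> * m \<le> real_of_int \<bar>int (n j) - int (n k)\<bar>"
        using relative_gap[OF that] by (simp add: \<delta>_def m_def)
      then have "\<lceil>\<delta> * m\<rceil> \<le> \<bar>int (n j) - int (n k)\<bar>" by (simp add: ceiling_le_iff)
      then show ?thesis using \<delta> m by (simp add: N_def)
    qed
    define \<eta> where "\<eta> = m powr (- 1/4)"
    have \<eta>: "\<eta> > 0" "\<eta>\<^sup>2 = m powr (- 1/2)"
      using m by (auto simp: \<eta>_def power2_eq_square powr_add[symmetric])
    have far: "norm (G t) \<le> B * m" for t
    proof -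
      have "1 / m * norm (deriv g (z t)) \<le> (1 - r\<^sup>2) * norm (deriv g (z t))"
        by (rule mult_right_mono[OF w]) simp
      also have "\<dots> \<le> B" using B[OF zd[of t]] by (simp add: nz)
      finally show ?thesis using m by (simp add: nG field_simps)
    qed
    have near: "norm (G t) \<le> 8 * E / ln m * m" if t: "\<bar>t\<bar> \<le> \<eta>" for t
    proof -
      have lt: "ln m / 8 \<le> norm (log_test (z t))"
        using norm_log_test_ge[OF m, of t] t unfolding z_def r_def \<eta>_def by simp
      have "1 / m * (ln m / 8 * norm (deriv g (z t))) \<le> (1 - r\<^sup>2) * (norm (log_test (z t)) * norm (deriv g (z t)))"
        using lt w m lnm r power_le_one[of r 2] by (intro mult_mono mult_right_mono) auto
      also have "\<dots> \<le> E" using E[OF zd[of t]] by (simp add: nz)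
      finally show ?thesis using m lnm by (simp add: nG field_simps)
    qed
    have "norm (b k) \<le> 8 * E / ln m * m + B * m * (pi\<^sup>2 / (real N * \<eta>\<^sup>2))"
      using b N(1) gapN \<eta>(1)
      by (rule gap_coefficient_le) (use near far E0 B0 m lnm in \<open>auto simp: G_def\<close>)
    \<comment> \<open>The complement of the arc contributes B m times a quantity of order m^(-1/2);
      ln m <= 2 sqrt m brings this to the form m / ln m of the first term.\<close>
    also have "B * m * (pi\<^sup>2 / (real N * \<eta>\<^sup>2)) \<le> m * (2 * B * pi\<^sup>2 / \<delta> / ln m)"
    proof -
      have "1 / (real N * \<eta>\<^sup>2) \<le> 1 / (\<delta> * m * \<eta>\<^sup>2)"
        using N \<delta> m \<eta> by (intro divide_left_mono mult_right_mono) auto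
      also have "m * \<eta>\<^sup>2 = sqrt m"
      proof -
        have "m * \<eta>\<^sup>2 = m powr 1 * m powr (- 1/2)" using m by (simp add: \<eta>(2))
        also have "\<dots> = m powr (1/2)" by (simp only: powr_add[symmetric]) simp
        finally show ?thesis using m by (simp add: powr_half_sqrt)
      qed
      then have "1 / (\<delta> * m * \<eta>\<^sup>2) = 1 / \<delta> * (1 / sqrt m)" by (simp add: mult.assoc)
      also have "1 / sqrt m \<le> 2 / ln m"
        using ln_le_2_sqrt[of m] m lnm by (simp add: field_simps)
      finally have "1 / (real N * \<eta>\<^sup>2) \<le> 1 / \<delta> * (2 / ln m)"
        using \<delta> by (simp add: divide_right_mono)
      then have "B * m * pi\<^sup>2 * (1 / (real N * \<eta>\<^sup>2)) \<le> B * m * pi\<^sup>2 * (1 / \<delta> * (2 / ln m))"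
        using B0 m by (intro mult_left_mono) auto
      then show ?thesis by (simp add: mult_ac)
    qed
    finally have bk: "norm (b k) \<le> m * ((8 * E + 2 * B * pi\<^sup>2 / \<delta>) / ln m)"
      by (simp add: add_divide_distrib distrib_left mult.commute)
    have "m * norm (a k) * exp (-1) \<le> norm (b k)"
    proof -
      have "exp (-1) \<le> r ^ (n k - 1)"
        unfolding r_def m_def by (rule one_minus_inverse_power_ge) (use True in simp)
      then have "m * norm (a k) * exp (-1) \<le> m * norm (a k) * r ^ (n k - 1)"
        using m by (intro mult_left_mono) auto
      also have "\<dots> = norm (b k)" using r by (simp add: b_def m_def norm_mult norm_power)
      finally show ?thesis .
    qed
    with bk have "m * (norm (a k) * exp (-1)) \<le> m * ((8 * E + 2 * B * pi\<^sup>2 / \<delta>) / ln m)" by simp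
    then have "norm (a k) * exp (-1) \<le> (8 * E + 2 * B * pi\<^sup>2 / \<delta>) / ln m"
      using m by (subst (asm) mult_le_cancel_left_pos) auto
    then have "norm (a k) * ln m \<le> exp 1 * (8 * E + 2 * B * pi\<^sup>2 / \<delta>)"
      using lnm by (simp add: exp_minus field_simps)
    then show ?thesis using C1 by (simp add: C_def m_def)
  qed
  moreover have "C \<ge> 0" using C1 C2 by (simp add: C_def)
  ultimately show ?thesis using that by blast
qed

text \<open>The weight \<open>w / (1 + w)\<^sup>2\<close> is dominated by the increments of the bounded increasing function
  \<open>w / (1 + w)\<close> along a lacunary sequence.\<close>
lemma sum_lacunary_weight_le:
  assumes y: "0 < y"
  shows "(\<Sum>k<N. sqrt (y * real (n k)) / (1 + sqrt (y * real (n k)))\<^sup>2) \<le> sqrt lam / (sqrt lam - 1)"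
proof -
  define s where "s = sqrt lam"
  have s: "s > 1" using lam by (simp add: s_def)
  define w where "w = (\<lambda>k. sqrt (y * real (n k)))"
  define h where "h = (\<lambda>x::real. x / (1 + x))"
  have w0: "w k \<ge> 0" for k using y by (simp add: w_def)
  have h_mono: "h x \<le> h x'" if "0 \<le> x" "x \<le> x'" for x x' using that by (simp add: h_def field_simps)
  have ws: "s * w k \<le> w (Suc k)" for k
  proof -
    have "s * w k = sqrt (y * (lam * real (n k)))" by (simp add: s_def w_def real_sqrt_mult)
    also have "\<dots> \<le> w (Suc k)" unfolding w_def using gap[of k] y by (intro real_sqrt_le_mono mult_left_mono) auto
    finally show ?thesis .
  qed
  \<comment> \<open>For h(x) = x/(1+x) the increment from w to s w is (s-1) w / ((1 + s w)(1 + w)).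
    Since 1 + s w <= s (1 + w), comparing it with the weight loses only the factor s/(s-1).\<close>
  have step: "w k / (1 + w k)\<^sup>2 \<le> s / (s - 1) * (h (w (Suc k)) - h (w k))" for k
  proof -
    let ?w = "w k"
    have pos: "1 + ?w > 0" "1 + s * ?w > 0" using w0[of k] s by (auto intro: add_pos_nonneg)
    have "h (s * ?w) - h ?w = (s - 1) * ?w / ((1 + s * ?w) * (1 + ?w))"
      unfolding h_def using pos by (simp add: diff_frac_eq algebra_simps)
    moreover have "(s - 1) * ?w / (s * (1 + ?w) * (1 + ?w)) \<le> (s - 1) * ?w / ((1 + s * ?w) * (1 + ?w))"
    proof (rule divide_left_mono)
      have "1 + s * ?w \<le> s * (1 + ?w)" using s by (simp add: distrib_left)
      then show "(1 + s * ?w) * (1 + ?w) \<le> s * (1 + ?w) * (1 + ?w)"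
        using pos by (intro mult_right_mono) auto
      show "0 \<le> (s - 1) * ?w" using s w0[of k] by simp
      show "0 < (s * (1 + ?w) * (1 + ?w)) * ((1 + s * ?w) * (1 + ?w))"
        using s pos by (intro mult_pos_pos) auto
    qed
    moreover have "h (s * ?w) \<le> h (w (Suc k))" using ws[of k] w0[of k] s by (intro h_mono) auto
    ultimately have "(s - 1) * ?w / (s * (1 + ?w) * (1 + ?w)) \<le> h (w (Suc k)) - h ?w" by linarith
    then have "s / (s - 1) * ((s - 1) * ?w / (s * (1 + ?w) * (1 + ?w))) \<le> s / (s - 1) * (h (w (Suc k)) - h ?w)"
      using s by (intro mult_left_mono) auto
    moreover have "s / (s - 1) * ((s - 1) * ?w / (s * (1 + ?w) * (1 + ?w))) = ?w / (1 + ?w)\<^sup>2"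
      using s pos by (simp add: power2_eq_square)
    ultimately show ?thesis by simp
  qed
  have "(\<Sum>k<N. w k / (1 + w k)\<^sup>2) \<le> (\<Sum>k<N. s / (s - 1) * (h (w (Suc k)) - h (w k)))"
    by (rule sum_mono[OF step])
  also have "\<dots> = s / (s - 1) * (h (w N) - h (w 0))"
    unfolding sum_distrib_left[symmetric] sum_lessThan_telescope[of "\<lambda>k. h (w k)"] ..
  also have "\<dots> \<le> s / (s - 1) * 1"
  proof (rule mult_left_mono)
    have "h (w N) \<le> 1" "0 \<le> h (w 0)" using w0[of N] w0[of 0] by (auto simp: h_def)
    then show "h (w N) - h (w 0) \<le> 1" by simp
  qed (use s in auto)
  finally show ?thesis by (simp add: s_def w_def)
qed

text \<open>Termwise, the weighted derivative series is dominated by multiples of w/(1+w)^2 with w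
  the square root of (1 - |z|) n_k, and their sum over k is bounded independently of z. The outer
  factor 2 in K comes from 1 - |z|^2 <= 2 (1 - |z|).\<close>

lemma Bloch_log_of_coeff:
  assumes A: "\<And>k. norm (a k) \<le> A" and C: "C \<ge> 0" "\<And>k. norm (a k) * ln (real (n k)) \<le> C"
  shows "g \<in> Bloch_log"
proof -
  have A0: "A \<ge> 0" by (rule order_trans[OF norm_ge_zero A])
  define K where "K = 2 * (2 * exp 4 * (A + C)) * (sqrt lam / (sqrt lam - 1))"
  have "(1 - (norm z)\<^sup>2) * norm (deriv g z) * ln (exp 1 / (1 - (norm z)\<^sup>2)) \<le> K" if z: "z \<in> unit_disc" for z
  proof -
    define y where "y = 1 - norm z"
    have y: "0 < y" "y \<le> 1" using z by (auto simp: y_def)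
    note bd = one_minus_norm_sq_bounds[OF z]
    let ?L = "ln (exp 1 / (1 - (norm z)\<^sup>2))"
    have L0: "?L \<ge> 1" by (rule log_weight_ge_1[OF z])
    have L: "?L \<le> 1 + ln (1 / y)"
    proof -
      have "?L \<le> ln (exp 1 / y)"
        using bd y by (subst ln_le_cancel_iff) (auto simp: y_def intro: divide_left_mono)
      also have "\<dots> = 1 + ln (1 / y)" using y by (simp add: ln_div)
      finally show ?thesis .
    qed
    define x where "x = (\<lambda>k. real (n k) * norm (a k) * norm z ^ (n k - 1))"
    have x0: "x k \<ge> 0" for k by (simp add: x_def)
    have sx: "summable x" unfolding x_def using z by (intro summable_deriv_real) auto
    have gx: "norm (deriv g z) \<le> (\<Sum>k. x k)"
      unfolding deriv_g[OF z] x_def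
      using summable_norm[OF summable_deriv_norm[of z]] z by (simp add: norm_mult norm_power)
    have P: "(1 - (norm z)\<^sup>2) * ?L \<le> 2 * (y * (1 + ln (1 / y)))"
    proof -
      have "(1 - (norm z)\<^sup>2) * ?L \<le> 2 * y * (1 + ln (1 / y))"
        by (rule mult_mono[OF _ L]) (use bd(3) y(1) L0 in \<open>simp_all add: y_def\<close>)
      then show ?thesis by (simp only: mult.assoc)
    qed
    have P0: "0 \<le> (1 - (norm z)\<^sup>2) * ?L"
      using bd L0 by (intro mult_nonneg_nonneg) linarith+
    have weighted: "(1 - (norm z)\<^sup>2) * ?L * x k
       \<le> 2 * (2 * exp 4 * (A + C)) * (sqrt (y * real (n k)) / (1 + sqrt (y * real (n k)))\<^sup>2)" for k
    proof (cases "n k \<ge> 1")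
      case True
      have "(1 - (norm z)\<^sup>2) * ?L * x k \<le> 2 * (y * (1 + ln (1 / y))) * x k"
        by (rule mult_right_mono[OF P x0])
      also have "\<dots> = 2 * (y * (real (n k) * norm (a k) * (1 - y) ^ (n k - 1)) * (1 + ln (1 / y)))"
        by (simp add: x_def y_def)
      also have "\<dots> \<le> 2 * (2 * exp 4 * (A + C) * (sqrt (y * real (n k)) / (1 + sqrt (y * real (n k)))\<^sup>2))"
        by (rule mult_left_mono[OF log_weighted_term_le[OF y True norm_ge_zero A C(2,1)]]) simp
      finally show ?thesis by simp
    next
      case False
      then have "n k = 0" by simp
      then show ?thesis by (simp add: x_def)
    qed
    have "(1 - (norm z)\<^sup>2) * norm (deriv g z) * ?L = (1 - (norm z)\<^sup>2) * ?L * norm (deriv g z)" by simp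
    also have "\<dots> \<le> (1 - (norm z)\<^sup>2) * ?L * (\<Sum>k. x k)" by (rule mult_left_mono[OF gx P0])
    also have "\<dots> = (\<Sum>k. (1 - (norm z)\<^sup>2) * ?L * x k)" by (rule suminf_mult[OF sx, symmetric])
    also have "\<dots> \<le> K"
    proof (rule suminf_le_const[OF summable_mult[OF sx]])
      fix N
      have "(\<Sum>k<N. (1 - (norm z)\<^sup>2) * ?L * x k)
         \<le> (\<Sum>k<N. 2 * (2 * exp 4 * (A + C)) * (sqrt (y * real (n k)) / (1 + sqrt (y * real (n k)))\<^sup>2))"
        by (rule sum_mono[OF weighted])
      also have "\<dots> \<le> K"
        unfolding sum_distrib_left[symmetric] K_def
        using A0 C(1) by (intro mult_left_mono sum_lacunary_weight_le y) auto
      finally show "(\<Sum>k<N. (1 - (norm z)\<^sup>2) * ?L * x k) \<le> K" .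
    qed
    finally show ?thesis .
  qed
  then show ?thesis using g_holomorphic unfolding Bloch_log_def analytic_on_open[OF open_ball] by blast
qed

lemma multiplier_necessary:
  assumes p: "0 < p" "p \<le> q" and q: "q \<le> 1"
    and mult: "g \<in> multipliers (Dp_space p \<inter> Bloch) (Dp_space q \<inter> Bloch)"
  shows "g \<in> H_inf \<inter> Bloch_log \<and> carleson_measure (mu_gq g q)"
proof -
  have q0: "0 < q" and p1: "p \<le> 1" using p q by auto
  have m: "(\<lambda>z. f z * g z) \<in> Dp_space q \<inter> Bloch" if "f \<in> Dp_space p \<inter> Bloch" for f
    using mult that unfolding multipliers_def by blast
  have "(\<lambda>z. 1) \<in> Dp_space p \<inter> Bloch"
    using p by (auto simp: Dp_space_iff Bloch_def)
  from m[OF this] have gD: "g \<in> Dp_space q" "g \<in> Bloch" by auto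
  have sq: "summable (\<lambda>k. norm (a k) powr q)" by (rule summable_coeff_powr[OF q0 q gD(1)])
  have s1: "summable (\<lambda>k. norm (a k))" by (rule summable_coeff_of_powr[OF q0 q sq])
  have H: "g \<in> H_inf" by (rule H_inf_of_summable[OF s1])
  have car: "carleson_measure (mu_gq g q)" by (rule carleson_of_summable[OF q0 q sq])
  define A where "A = (\<Sum>k. norm (a k))"
  have A: "norm (a k) \<le> A" for k
    using sum_le_suminf[OF s1, of "{k}"] by (simp add: A_def)
  obtain M where M: "M > 0" "\<And>z. z \<in> unit_disc \<Longrightarrow> norm (g z) \<le> M"
    using H by (auto simp: H_inf_def bounded_pos)
  obtain B where B: "\<And>z. z \<in> unit_disc \<Longrightarrow> (1 - (norm z)\<^sup>2) * norm (deriv g z) \<le> B"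
    using Bloch_bound[OF gD(2)] by blast
  obtain F where F: "\<And>z. z \<in> unit_disc \<Longrightarrow> (1 - (norm z)\<^sup>2) * norm (deriv log_test z) \<le> F"
    using Bloch_bound[OF log_test_Bloch] by blast
  have "(\<lambda>z. log_test z * g z) \<in> Bloch"
    using m log_test_Dp[OF p(1) p1] log_test_Bloch by blast
  then obtain H where H': "\<And>z. z \<in> unit_disc \<Longrightarrow> (1 - (norm z)\<^sup>2) * norm (deriv (\<lambda>z. log_test z * g z) z) \<le> H"
    using Bloch_bound by blast
  \<comment> \<open>By the product rule, log_test times g' differs from the derivative of the
    product by log_test' times g, which is under control because \<open>log_test\<close> is Bloch
    and g is bounded.\<close>
  have E: "(1 - (norm z)\<^sup>2) * (norm (log_test z) * norm (deriv g z)) \<le> H + F * M" if z: "z \<in> unit_disc" for z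
  proof -
    let ?d = "1 - (norm z)\<^sup>2"
    have d: "?d > 0" using one_minus_norm_sq_bounds[OF z] by simp
    have D: "deriv (\<lambda>z. log_test z * g z) z = log_test z * deriv g z + deriv log_test z * g z"
      using log_test_holomorphic g_holomorphic z
      by (intro deriv_mult) (auto simp: holomorphic_on_imp_differentiable_at)
    have "norm (log_test z * deriv g z) \<le> norm (deriv (\<lambda>z. log_test z * g z) z) + norm (deriv log_test z * g z)"
      unfolding D using norm_triangle_ineq4[of "log_test z * deriv g z + deriv log_test z * g z" "deriv log_test z * g z"] by simp
    then have "?d * norm (log_test z * deriv g z) \<le> ?d * (norm (deriv (\<lambda>z. log_test z * g z) z) + norm (deriv log_test z * g z))"
      using d by (intro mult_left_mono) auto
    also have "\<dots> = ?d * norm (deriv (\<lambda>z. log_test z * g z) z) + (?d * norm (deriv log_test z)) * norm (g z)"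
      by (simp add: norm_mult distrib_left)
    also have "\<dots> \<le> H + F * M"
    proof (intro add_mono mult_mono)
      show "0 \<le> F" by (rule order_trans[OF _ F[of 0]]) auto
    qed (use H'[OF z] F[OF z] M(2)[OF z] in auto)
    finally show ?thesis by (simp add: norm_mult)
  qed
  obtain C where C: "C \<ge> 0" "\<And>k. norm (a k) * ln (real (n k)) \<le> C"
    using coeff_log_bound[OF E B A] by blast
  have "g \<in> Bloch_log" by (rule Bloch_log_of_coeff[OF A C])
  then show ?thesis using H car \<open>g \<in> H_inf\<close> by simp
qed

end

theorem mainTheorem7:
  fixes p q :: real and g :: "complex \<Rightarrow> complex"
  assumes "0 < p" "p \<le> q" "q \<le> 1"
    and "g analytic_on unit_disc"
  shows "(g \<in> H_inf \<inter> Bloch_log \<and> carleson_measure (mu_gq g q) \<longrightarrow>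
            g \<in> multipliers (Dp_space p \<inter> Bloch) (Dp_space q \<inter> Bloch))
       \<and> (lacunary_series g \<longrightarrow>
            (g \<in> multipliers (Dp_space p \<inter> Bloch) (Dp_space q \<inter> Bloch) \<longleftrightarrow>
             g \<in> H_inf \<inter> Bloch_log \<and> carleson_measure (mu_gq g q)))"
proof -
  have suff: "g \<in> multipliers (Dp_space p \<inter> Bloch) (Dp_space q \<inter> Bloch)"
    if "g \<in> H_inf \<inter> Bloch_log" "carleson_measure (mu_gq g q)"
    by (rule multiplier_sufficient[OF assms(1-3) that])
  have nec: "g \<in> H_inf \<inter> Bloch_log \<and> carleson_measure (mu_gq g q)"
    if lac: "lacunary_series g" and m: "g \<in> multipliers (Dp_space p \<inter> Bloch) (Dp_space q \<inter> Bloch)"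
  proof -
    obtain a :: "nat \<Rightarrow> complex" and n :: "nat \<Rightarrow> nat" and lam :: real
      where "lam > 1" "strict_mono n" "\<forall>k. lam * real (n k) \<le> real (n (Suc k))"
        "\<forall>z\<in>unit_disc. (\<lambda>k. a k * z ^ n k) sums g z"
      using lac unfolding lacunary_series_def by blast
    then interpret lacunary_function n lam a g
      by unfold_locales auto
    show ?thesis by (rule multiplier_necessary[OF assms(1-3) m])
  qed
  show ?thesis using suff nec by blast
qed

end
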